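(* Let $\mathbb{P}$ be a probability distribution on $\mathbb{R}$ with mean $0$, variance $1$, and support contained in $[-c_0,c_0]$. Let $\sigma\in(0,1]$ and let $\mu_\sigma$ be the integrated density of states of the operator $H_\omega=H_0+\sigma V_\omega$ described in the context. Then for every $\gamma>0$, every $\lambda_0\in(-2+\gamma,-\gamma)\cup(\gamma,2-\gamma)$ and every $\lambda\in(0,1]$, $$\mu_\sigma\big([\lambda_0,\lambda_0+\lambda]\big)\le \frac{2}{\sigma^3}\,\lambda^{\,1-460c_0^3\sigma/\gamma}.$$ In particular, $\mu_\sigma$ restricted to $(-2+\gamma,-\gamma)\cup(\gamma,2-\gamma)$ is Hölder continuous with exponent $1-460c_0^3\sigma/\gamma$.
   Context: The one-dimensional Anderson model: $H_\omega$ acts on $\ell^2(\mathbb{Z})$ by $(H_\omega\phi)(j)=\phi(j+1)+\phi(j-1)+\sigma\omega_j\phi(j)$, where $(\omega_j)_{j\in\mathbb{Z}}$ are i.i.d. real random variables with common law $\mathbb{P}$, and $\sigma>0$ is the coupling constant. For $n\in\mathbb{N}$, $H_{\omega,n}$ denotes the $n\times n$ real symmetric tridiagonal matrix indexed by $\{1,\dots,n\}$ with entries $1$ on the first off-diagonals and $\sigma\omega_1,\dots,\sigma\omega_n$ on the diagonal (restriction of $H_\omega$ to $\{1,\dots,n\}$ with Dirichlet boundary conditions). The integrated density of states (IDS) $\mu_\sigma$ is the measure on $\mathbb{R}$ given by $\mu_\sigma(I)=\lim_{n\to\infty}\frac1n\,\mathbb{E}\,\#\{\text{eigenvalues of }H_{\omega,n}\text{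 in }I\}$ for intervals $I$. *)

theory Defs
  imports "HOL-Probability.Probability" "Jordan_Normal_Form.Char_Poly"
begin

text \<open>The n x n Dirichlet restriction H_{omega,n} of the Anderson Hamiltonian to {1..n}.
  Matrix indices 0..n-1 correspond to sites 1..n; diagonal entry at site j is sigma * omega j,
  entries on the first off-diagonals are 1, all others 0.\<close>
definition anderson_matrix :: "(nat \<Rightarrow> real) \<Rightarrow> real \<Rightarrow> nat \<Rightarrow> real mat" where
  "anderson_matrix \<omega> \<sigma> n =
     mat n n (\<lambda>(i, j). if i = j then \<sigma> * \<omega> (i + 1)
                       else if i = j + 1 \<or> j = i + 1 then 1 else 0)"

definition eig_count :: "real mat \<Rightarrow> real set \<Rightarrow> nat" where
  "eig_count A I = (\<Sum>x \<in> {x \<in> I. eigenvalue A x}. order x (char_poly A))"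

definition ids :: "real measure \<Rightarrow> real \<Rightarrow> real set \<Rightarrow> real" where
  "ids P \<sigma> I = lim (\<lambda>n. (1 / real n) *
      (\<integral>\<omega>. real (eig_count (anderson_matrix \<omega> \<sigma> n) I) \<partial>(PiM {1..n} (\<lambda>_. P))))"

end

theory Submission
  imports Defs
begin

text \<open>
  Compare the solutions of the eigenvalue equation at the two ends \<open>E\<close> and \<open>E + \<tau>\<close> of a spectral
  window, both started with Dirichlet data. By Sturm oscillation theory the number of eigenvalues in
  the window is, up to a bounded error, the number of half turns made by the relative Pruefer angle
  \<open>\<alpha>\<close>. In the coordinates that turn the free transfer matrix into a rotation, \<open>|sin \<alpha>|\<close> is the
  Wronskian divided by the product of the norms of the two solutions; the random potential does not
  change the Wronskian, and the energy difference changes it by \<open>\<tau>\<close> times the product of the two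
  solutions. For \<open>s < 1\<close> the function \<open>|z|^(-2 s)\<close> of a solution \<open>z\<close>, corrected by small
  trigonometric terms in the angle of \<open>z\<close>, is a supermartingale as soon as \<open>1 - s\<close> exceeds a
  multiple of \<open>\<sigma> / \<gamma>\<close>: to second order in \<open>\<sigma>\<close> the averaged drift is proportional to
  \<open>- s (1 - s) \<sigma>\<^sup>2\<close>, the oscillating terms are removed by the correction (this is where the
  energies \<open>0\<close>, \<open>2\<close> and \<open>-2\<close> are resonant), and the rest is of third order. The arithmetic-geometric mean
  inequality then makes \<open>|sin \<alpha>|^s\<close> a supermartingale up to an error \<open>O(\<tau>^s)\<close> per step. Since every half turn needs
  a passage of \<open>|sin \<alpha>|\<close> from near \<open>0\<close> to near \<open>1\<close>, the expected number of half turns in \<open>n\<close> steps is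
  at most \<open>O(n \<tau>^s)\<close>.
\<close>

section \<open>Sturm oscillation\<close>

text \<open>All one-step estimates are pathwise: for each admissible value \<open>x\<close> of the
  new site, the new weight is at most the old one times a quadratic polynomial in \<open>x\<close>
  whose coefficients do not depend on \<open>x\<close>. The law then enters only through its support
  bound, its mean and its variance. The two solutions see the same \<open>x\<close>, so their
  weights are correlated; passing to the arithmetic mean lets each solution be estimated alone. The
  offset \<open>\<tau>\<close> between the energies acts as a shear with nonzero mean, so it
  contributes already at first order. It stays below the drift when
  \<open>\<tau> \<le> \<sigma> ^ 3\<close>; for wider windows the prefactor
  \<open>2 / \<sigma> ^ 3\<close> makes the claim weaker than the trivial bound 1. The value
  \<open>ids\<close> is a \<open>lim\<close>, so convergence of the averaged eigenvalue counts has
  to be established as well.\<close>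

definition sg :: "int \<Rightarrow> real" where
  "sg c = (if even c then 1 else - 1)"

lemma sg_cases: "sg c = 1 \<or> sg c = -1"
  by (simp add: sg_def)

lemma sg_square [simp]: "sg c * sg c = 1" "sg c * (sg c * x) = x"
  by (simp_all add: sg_def)

lemma sg_Suc [simp]: "sg (c + 1) = - sg c" "sg (1 + c) = - sg c"
  by (simp_all add: sg_def)

text \<open>A vanishing value of a solution inherits the sign of its predecessor, as it would at a slightly
  larger energy; hence the next value flips the sign. The Dirichlet datum \<open>0\<close> at site \<open>0\<close> fits
  this convention when the counter starts at \<open>-1\<close>.\<close>

definition sturm_valid :: "real \<Rightarrow> real \<Rightarrow> int \<Rightarrow> bool" where
  "sturm_valid u0 u1 c \<longleftrightarrow> 0 \<le> sg c * u0 \<and> (u0 = 0 \<longrightarrow> sg c * u1 < 0)"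

definition osc_step :: "real \<Rightarrow> int \<Rightarrow> int" where
  "osc_step u1 c = c + (if sg c * u1 < 0 then 1 else 0)"

lemma sg_osc_step: "0 \<le> sg (osc_step u1 c) * u1"
  by (auto simp: osc_step_def)

lemma sturm_valid_step:
  assumes "sturm_valid u0 u1 c"
  shows "sturm_valid u1 (x * u1 - u0) (osc_step u1 c)"
proof -
  have "sg (osc_step u1 c) * (x * u1 - u0) < 0" if "u1 = 0"
  proof -
    have "0 < sg c * u0"
      using assms that sg_cases[of c] by (auto simp: sturm_valid_def less_le)
    then show ?thesis
      using that by (simp add: osc_step_def)
  qed
  then show ?thesis
    using sg_osc_step by (auto simp: sturm_valid_def)
qed

text \<open>The signs of the counters move both data vectors into one half-plane, so
  \<open>c - d\<close> counts the half turns up to one, and the sign of the Wronskian decides the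
  rest. The value is the relative angle divided by pi, rounded down.\<close>

definition turns :: "real \<Rightarrow> real \<Rightarrow> int \<Rightarrow> real \<Rightarrow> real \<Rightarrow> int \<Rightarrow> int" where
  "turns u0 u1 c v0 v1 d = c - d - (if sg c * sg d * (v1 * u0 - u1 * v0) < 0 then 1 else 0)"

lemma sign_product_pos:
  assumes "0 \<le> sg c * u" "0 \<le> sg d * v"
  shows "sg c * sg d * \<bar>u * v\<bar> = u * v"
  using assms sg_cases[of c] sg_cases[of d] by (auto simp: abs_mult)

text \<open>The Wronskian grows by \<open>\<tau> * (u1 * v1)\<close>. Multiplied by the updated
  signs this increment is nonnegative, so the normalised Wronskian can change sign only upwards, and
  that completes a half turn. Testing against \<open>u1 * v1\<close> instead keeps the counters out
  of the criterion, as the angle estimates require.\<close>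

lemma turns_step:
  fixes u0 u1 v0 v1 x \<tau> :: real
  assumes U: "sturm_valid u0 u1 c" and V: "sturm_valid v0 v1 d" and "0 \<le> \<tau>"
  defines "u2 \<equiv> x * u1 - u0" and "v2 \<equiv> (x + \<tau>) * v1 - v0"
  defines "c' \<equiv> osc_step u1 c" and "d' \<equiv> osc_step v1 d"
  shows "turns u1 u2 c' v1 v2 d' = turns u0 u1 c v0 v1 d +
     (if (v1 * u0 - u1 * v0) * (u1 * v1) < 0 \<and> 0 \<le> (v2 * u1 - u2 * v1) * (u1 * v1) then 1 else 0)"
proof -
  define W where "W = v1 * u0 - u1 * v0"
  define W' where "W' = v2 * u1 - u2 * v1"
  have W': "W' = W + \<tau> * (u1 * v1)"
    by (simp add: W'_def W_def u2_def v2_def algebra_simps)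
  define p0 p1 r0 r1 where "p0 = sg c * u0" and "p1 = sg c * u1" and "r0 = sg d * v0" and "r1 = sg d * v1"
  have nn: "0 \<le> p0" "0 \<le> r0" "p0 = 0 \<Longrightarrow> p1 < 0" "r0 = 0 \<Longrightarrow> r1 < 0"
    using U V sg_cases[of c] sg_cases[of d] by (auto simp: sturm_valid_def p0_def p1_def r0_def r1_def)
  have What: "sg c * sg d * W = r1 * p0 - p1 * r0"
    using sg_cases[of c] sg_cases[of d] by (auto simp: W_def p0_def p1_def r0_def r1_def algebra_simps)
  define e where "e = sg c' * sg d'"
  have e2: "e * e = 1"
    using sg_cases[of c'] sg_cases[of d'] by (auto simp: e_def)
  have uv: "u1 * v1 = e * \<bar>u1 * v1\<bar>"
    unfolding e_def c'_def d'_def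
    by (rule sign_product_pos[symmetric]) (rule sg_osc_step)+
  have p1: "\<bar>p1\<bar> = \<bar>u1\<bar>" and r1: "\<bar>r1\<bar> = \<bar>v1\<bar>"
    using sg_cases[of c] sg_cases[of d] by (auto simp: p1_def r1_def abs_mult)
  have abs_uv: "\<bar>u1 * v1\<bar> = \<bar>p1 * r1\<bar>"
    using p1 r1 by (simp add: abs_mult)
  define T where "T = \<tau> * \<bar>u1 * v1\<bar>"
  have T: "0 \<le> T" "p1 * r1 = 0 \<Longrightarrow> T = 0"
    using \<open>0 \<le> \<tau>\<close> by (simp_all add: T_def abs_uv)
  have eW': "e * W' = e * W + T"
    using e2 unfolding W' T_def by (subst uv) (simp add: algebra_simps)
  have crossing: "(W * (u1 * v1) < 0 \<and> 0 \<le> W' * (u1 * v1)) \<longleftrightarrow> (e * W < 0 \<and> 0 \<le> e * W')"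
  proof (cases "u1 * v1 = 0")
    case True
    then show ?thesis using eW' by (auto simp: T_def)
  next
    case False
    then have pos: "0 < \<bar>u1 * v1\<bar>" by simp
    have "W * (u1 * v1) = (e * W) * \<bar>u1 * v1\<bar>" "W' * (u1 * v1) = (e * W') * \<bar>u1 * v1\<bar>"
      by (subst uv, simp)+
    moreover have "x * \<bar>u1 * v1\<bar> < 0 \<longleftrightarrow> x < 0" "0 \<le> x * \<bar>u1 * v1\<bar> \<longleftrightarrow> 0 \<le> x" for x
      using pos by (auto simp only: mult_less_0_iff zero_le_mult_iff)
    ultimately show ?thesis
      by (simp only:)
  qed
  have eq: "turns u1 u2 c' v1 v2 d' = c' - d' - (if e * W' < 0 then 1 else 0)"
    by (simp add: turns_def e_def W'_def)
  have eq0: "turns u0 u1 c v0 v1 d = c - d - (if r1 * p0 - p1 * r0 < 0 then 1 else 0)"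
    by (simp add: turns_def What[symmetric] W_def)
  \<comment> \<open>If exactly one counter moves, \<open>e\<close> is opposite to
    \<open>sg c * sg d\<close>, and validity of the data fixes the sign of the old Wronskian. Apart
    from a crossing, the jump of the counter and that of the correction term then cancel.\<close>
  have "c' - d' - (if e * W' < 0 then 1 else 0) =
        c - d - (if r1 * p0 - p1 * r0 < 0 then 1 else 0) + (if e * W < 0 \<and> 0 \<le> e * W' then 1 else 0)"
  proof (cases "p1 < 0")
    case p: True
    then have c': "c' = c + 1" by (simp add: c'_def osc_step_def p1_def)
    show ?thesis
    proof (cases "r1 < 0")
      case True
      then have d': "d' = d + 1" by (simp add: d'_def osc_step_def r1_def)
      have "e * W = r1 * p0 - p1 * r0" by (simp add: e_def c' d' What)
      then show ?thesis using c' d' eW' T by auto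
    next
      case False
      then have d': "d' = d" by (simp add: d'_def osc_step_def r1_def)
      have eW: "e * W = - (r1 * p0 - p1 * r0)" by (simp add: e_def c' d' What[symmetric])
      have "0 < r0" using False nn by (auto simp: less_le)
      then have "p1 * r0 < 0" "0 \<le> r1 * p0" using p False nn by (auto simp: mult_less_0_iff)
      then show ?thesis using c' d' eW eW' T by auto
    qed
  next
    case p: False
    then have c': "c' = c" by (simp add: c'_def osc_step_def p1_def)
    have p0: "0 < p0" using p nn by (auto simp: less_le)
    show ?thesis
    proof (cases "r1 < 0")
      case True
      then have d': "d' = d + 1" by (simp add: d'_def osc_step_def r1_def)
      have eW: "e * W = - (r1 * p0 - p1 * r0)" by (simp add: e_def c' d' What[symmetric])
      have "r1 * p0 < 0" "0 \<le> p1 * r0" using p True nn p0 by (auto simp: mult_less_0_iff)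
      then show ?thesis using c' d' eW eW' T by auto
    next
      case False
      then have d': "d' = d" by (simp add: d'_def osc_step_def r1_def)
      have "e * W = r1 * p0 - p1 * r0" by (simp add: e_def c' d' What)
      then show ?thesis using c' d' eW' T by auto
    qed
  qed
  then show ?thesis
    unfolding eq eq0 W_def[symmetric] W'_def[symmetric] crossing .
qed

fun sol :: "(nat \<Rightarrow> real) \<Rightarrow> real \<Rightarrow> nat \<Rightarrow> real" where
  "sol V E 0 = 0"
| "sol V E (Suc 0) = 1"
| "sol V E (Suc (Suc k)) = (E - V (Suc k)) * sol V E (Suc k) - sol V E k"

fun osc :: "(nat \<Rightarrow> real) \<Rightarrow> real \<Rightarrow> nat \<Rightarrow> int" where
  "osc V E 0 = - 1"
| "osc V E (Suc k) = osc_step (sol V E (Suc k)) (osc V E k)"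

lemma sturm_valid_sol: "sturm_valid (sol V E k) (sol V E (Suc k)) (osc V E k)"
proof (induction k)
  case 0
  show ?case by (simp add: sturm_valid_def sg_def)
next
  case (Suc k)
  show ?case using sturm_valid_step[OF Suc] by simp
qed

lemma osc_mono: "osc V E k \<le> osc V E (Suc k)" "osc V E (Suc k) \<le> osc V E k + 1"
  by (simp_all add: osc_step_def)

lemma sol_cong: "(\<And>i. 1 \<le> i \<Longrightarrow> i < k \<Longrightarrow> V i = V' i) \<Longrightarrow> sol V E k = sol V' E k"
  by (induction V E k rule: sol.induct) auto

lemma osc_cong: "(\<And>i. 1 \<le> i \<Longrightarrow> i < k \<Longrightarrow> V i = V' i) \<Longrightarrow> osc V E k = osc V' E k"
proof (induction k)
  case (Suc k)
  then show ?case using sol_cong[of "Suc k" V V' E] by auto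
qed simp

text \<open>Restarting the recursion with Dirichlet data at a later site changes the number of sign
  changes by at most one, because the two solutions solve the same equation.\<close>

lemma osc_shift_diff:
  fixes V :: "nat \<Rightarrow> real" and n :: nat
  defines "V' \<equiv> \<lambda>i. V (n + i)"
  shows "\<bar>(osc V E (n + k) - osc V' E k) - (osc V E n + 1)\<bar> \<le> 1"
proof -
  define m where "m k = turns (sol V E (n + k)) (sol V E (Suc (n + k))) (osc V E (n + k))
      (sol V' E k) (sol V' E (Suc k)) (osc V' E k)" for k
  \<comment> \<open>For offset 0 the Wronskian is constant, so the two halves of the crossing
    condition exclude each other.\<close>
  have "m (Suc k) = m k" for k
    unfolding m_def
    using turns_step[OF sturm_valid_sol[of V E "n + k"] sturm_valid_sol[of V' E k], of 0
        "E - V (n + Suc k)"]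
    by (auto simp: V'_def algebra_simps split: if_splits)
  then have "m k = m 0" by (induction k) auto
  then show ?thesis
    unfolding m_def turns_def by (auto split: if_splits)
qed

section \<open>Roots and eigenvalues\<close>

fun sol_poly :: "(nat \<Rightarrow> real) \<Rightarrow> nat \<Rightarrow> real poly" where
  "sol_poly V 0 = 0"
| "sol_poly V (Suc 0) = 1"
| "sol_poly V (Suc (Suc k)) = [:- V (Suc k), 1:] * sol_poly V (Suc k) - sol_poly V k"

lemma poly_sol_poly: "poly (sol_poly V k) E = sol V E k"
  by (induction V k rule: sol_poly.induct) (auto simp: algebra_simps)

lemma monic_sol_poly: "degree (sol_poly V (Suc n)) = n \<and> coeff (sol_poly V (Suc n)) n = 1"
proof (induction n rule: less_induct)
  case (less n)
  show ?case
  proof (cases n)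
    case (Suc m)
    let ?p = "sol_poly V (Suc m)" and ?q = "sol_poly V m"
    have p: "degree ?p = m" "coeff ?p m = 1" using less Suc by auto
    have q: "degree ?q < Suc m"
    proof (cases m)
      case (Suc l)
      then show ?thesis using less \<open>n = Suc m\<close> by auto
    qed simp
    have deg: "degree ([:- V (Suc m), 1:] * ?p) = Suc m"
      using p by (subst degree_mult_eq) auto
    have "degree ([:- V (Suc m), 1:] * ?p - ?q) = Suc m"
      using q deg by (metis degree_diff_less degree_add_eq_left degree_minus uminus_add_conv_diff add.commute)
    moreover have "coeff ([:- V (Suc m), 1:] * ?p - ?q) (Suc m) = 1"
      using p q by (simp add: coeff_eq_0)
    ultimately show ?thesis using Suc by simp
  qed simp
qed

lemma monic_eq_prod_roots:
  fixes p :: "'a::idom poly"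
  assumes "degree p = card S" "coeff p (card S) = 1" "finite S" "\<And>x. x \<in> S \<Longrightarrow> poly p x = 0"
  shows "p = (\<Prod>x\<in>S. [:- x, 1:])"
proof (rule ccontr)
  assume ne: "p \<noteq> (\<Prod>x\<in>S. [:- x, 1:])"
  define P where "P = (\<Prod>x\<in>S. [:- x, 1:])"
  define q where "q = p - P"
  have degP: "degree P = card S"
    unfolding P_def by (subst degree_prod_eq_sum_degree) auto
  have "lead_coeff P = 1"
    unfolding P_def lead_coeff_prod by simp
  then have lcP: "coeff P (card S) = 1" using degP by simp
  have "q \<noteq> 0" using ne by (simp add: q_def P_def)
  have "degree q \<le> card S" unfolding q_def using assms(1) degP by (intro degree_diff_le) auto
  moreover have "coeff q (card S) = 0" using assms lcP by (simp add: q_def)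
  ultimately have "degree q < card S"
    using \<open>q \<noteq> 0\<close> by (metis leading_coeff_neq_0 le_neq_implies_less)
  moreover have "S \<subseteq> {x. poly q x = 0}"
    using assms(3,4) by (auto simp: q_def P_def poly_prod)
  then have "card S \<le> degree q"
    using card_poly_roots_bound[OF \<open>q \<noteq> 0\<close>] poly_roots_finite[OF \<open>q \<noteq> 0\<close>]
    by (meson card_mono le_trans)
  ultimately show False by simp
qed

lemma sol_eq_prod_roots:
  assumes "inj_on r {..<n}" "\<And>i. i < n \<Longrightarrow> sol V (r i) (Suc n) = 0"
  shows "sol V E (Suc n) = (\<Prod>i<n. E - r i)"
proof -
  have "sol_poly V (Suc n) = (\<Prod>x\<in>r ` {..<n}. [:- x, 1:])"
    using assms monic_sol_poly[of V n]
    by (intro monic_eq_prod_roots) (auto simp: card_image poly_sol_poly)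
  then have "sol_poly V (Suc n) = (\<Prod>i<n. [:- r i, 1:])"
    using assms(1) by (simp add: prod.reindex)
  then show ?thesis
    by (simp add: poly_sol_poly[symmetric] poly_prod)
qed

section \<open>Interlacing of the zeros of successive solution values\<close>

lemma sol_pos_of_large:
  assumes "\<And>i. 1 \<le> i \<Longrightarrow> i \<le> k \<Longrightarrow> 2 \<le> E - V i"
  shows "0 < sol V E (Suc k)"
proof -
  have "0 \<le> sol V E k \<and> sol V E k + 1 \<le> sol V E (Suc k)"
    using assms
  proof (induction k)
    case (Suc k)
    then have IH: "0 \<le> sol V E k" "sol V E k + 1 \<le> sol V E (Suc k)" by auto
    have "2 * sol V E (Suc k) \<le> (E - V (Suc k)) * sol V E (Suc k)"
      using Suc.prems[of "Suc k"] IH by (intro mult_right_mono) auto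
    then show ?case using IH unfolding sol.simps(3) by linarith
  qed simp
  then show ?thesis by simp
qed

lemma sol_reflect: "sol V E (Suc k) = (- 1) ^ k * sol (\<lambda>i. - V i) (- E) (Suc k)"
proof (induction k rule: less_induct)
  case (less k)
  consider "k = 0" | "k = 1" | l where "k = Suc (Suc l)"
    by (metis One_nat_def not0_implies_Suc)
  then show ?case
  proof cases
    case 3
    have *: "sol V E (Suc l) = (- 1) ^ l * sol (\<lambda>i. - V i) (- E) (Suc l)"
      "sol V E (Suc (Suc l)) = (- 1) ^ Suc l * sol (\<lambda>i. - V i) (- E) (Suc (Suc l))"
      using 3 by (intro less; simp)+
    show ?thesis
      unfolding 3 sol.simps(3)[where k = "Suc l"] * by (simp add: algebra_simps del: sol.simps)
  qed auto
qed

text \<open>\<open>n + i\<close> has the parity of the number \<open>n - i\<close> of negative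
  factors and avoids truncated subtraction.\<close>

lemma prod_sign_alternating:
  fixes r :: "nat \<Rightarrow> real"
  assumes "i \<le> n" "\<And>j. j < i \<Longrightarrow> r j < x" "\<And>j. i \<le> j \<Longrightarrow> j < n \<Longrightarrow> x < r j"
  shows "0 < (- 1) ^ (n + i) * (\<Prod>j<n. x - r j)"
  using assms
proof (induction n arbitrary: i)
  case (Suc n)
  show ?case
  proof (cases "i = Suc n")
    case True
    then have "0 < (\<Prod>j<Suc n. x - r j)" using Suc.prems by (intro prod_pos) auto
    moreover have "(- 1 :: real) ^ (Suc n + i) = 1" using True by simp
    ultimately show ?thesis by simp
  next
    case False
    then have "0 < (- 1) ^ (n + i) * (\<Prod>j<n. x - r j)" using Suc.prems by (intro Suc.IH) auto
    moreover have "x < r n" using False Suc.prems by auto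
    ultimately have "0 < ((- 1) ^ (n + i) * (\<Prod>j<n. x - r j)) * (r n - x)" by simp
    then show ?thesis by (simp add: algebra_simps)
  qed
qed simp

text \<open>At a zero of \<open>sol V E (Suc k)\<close> the recursion reads
  \<open>sol V E (Suc (Suc k)) = - sol V E k\<close>, and interlacing one level down makes the signs
  of the right-hand side alternate. The intermediate value theorem then puts a new root into every
  gap.\<close>

lemma roots_interlace:
  "\<exists>r r'. (\<forall>i<n. sol V (r i) (Suc n) = 0) \<and> (\<forall>i\<le>n. sol V (r' i) (Suc (Suc n)) = 0) \<and>
     (\<forall>i<n. r' i < r i \<and> r i < r' (Suc i))"
proof (induction n)
  case 0
  show ?case by (rule exI[of _ "\<lambda>_. 0"], rule exI[of _ "\<lambda>_. V 1"]) simp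
next
  case (Suc n)
  then obtain r r' where r: "\<And>i. i < n \<Longrightarrow> sol V (r i) (Suc n) = 0"
    and r': "\<And>i. i \<le> n \<Longrightarrow> sol V (r' i) (Suc (Suc n)) = 0"
    and lace: "\<And>i. i < n \<Longrightarrow> r' i < r i" "\<And>i. i < n \<Longrightarrow> r i < r' (Suc i)"
    by blast
  have lt: "r' i < r' j" if "i < j" "j \<le> n" for i j
    using that
  proof (induction j)
    case (Suc j)
    then show ?case using lace[of j] by (cases "i = j") auto
  qed simp
  have r_lt: "r i < r j" if "i < j" "j < n" for i j
    using lace(2)[of i] lace(1)[of j] lt[of "Suc i" j] that by (cases "Suc i = j") auto
  have "inj_on r {..<n}"
    by (rule linorder_inj_onI) (auto dest: r_lt simp: less_imp_neq)
  then have prod: "sol V E (Suc n) = (\<Prod>i<n. E - r i)" for E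
    by (rule sol_eq_prod_roots) (rule r)
  obtain M where M: "\<And>i. i \<le> Suc (Suc n) \<Longrightarrow> \<bar>V i\<bar> \<le> M"
  proof
    show "\<bar>V i\<bar> \<le> Max ((\<lambda>i. \<bar>V i\<bar>) ` {..Suc (Suc n)})" if "i \<le> Suc (Suc n)" for i
      using that by (intro Max_ge) auto
  qed
  \<comment> \<open>The outer test points lie beyond all known roots and at least 2 beyond the range
    of the potential, so \<open>sol_pos_of_large\<close>, on the left after reflection, gives the
    signs there.\<close>
  define lo hi where "lo = min (r' 0) 0 - \<bar>M\<bar> - 2" and "hi = max (r' n) 0 + \<bar>M\<bar> + 2"
  define t where "t i = (if i = 0 then lo else if i \<le> Suc n then r' (i - 1) else hi)" for i
  have t_lt: "t i < t (Suc i)" if "i < Suc (Suc n)" for i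
    using that lt[of "i - 1" i] by (cases "i = Suc n") (auto simp: t_def lo_def hi_def)
  have sgn: "0 < (- 1) ^ (n + i) * sol V (t i) (Suc (Suc (Suc n)))" if "i \<le> Suc (Suc n)" for i
  proof -
    consider "i = 0" | "1 \<le> i" "i \<le> Suc n" | "i = Suc (Suc n)" using \<open>i \<le> _\<close> by linarith
    then show ?thesis
    proof cases
      case 1
      have "0 < sol (\<lambda>i. - V i) (- lo) (Suc (Suc (Suc n)))"
      proof (rule sol_pos_of_large)
        fix j assume "1 \<le> j" "j \<le> Suc (Suc n)"
        then show "2 \<le> - lo - - V j" using M[of j] by (auto simp: lo_def)
      qed
      moreover have "(- 1 :: real) ^ n * (- 1) ^ n = 1"
        by (simp flip: power_mult_distrib)
      ultimately show ?thesis
        using 1 sol_reflect[of V lo "Suc (Suc n)"] by (simp add: t_def mult.assoc[symmetric])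
    next
      case 2
      then obtain j where j: "i = Suc j" "j \<le> n" by (cases i) auto
      have "0 < (- 1) ^ (n + j) * (\<Prod>k<n. r' j - r k)"
      proof (rule prod_sign_alternating)
        show "r k < r' j" if "k < j" for k
          using lace(2)[of k] lt[of "Suc k" j] that j by (cases "Suc k = j") auto
        show "r' j < r k" if "j \<le> k" "k < n" for k
          using lace(1)[of k] lt[of j k] that by (cases "k = j") auto
      qed (use j in auto)
      then show ?thesis
        using j r'[of j] by (simp add: t_def prod del: sol.simps(3)) (simp add: prod)
    next
      case 3
      have "0 < sol V hi (Suc (Suc (Suc n)))"
      proof (rule sol_pos_of_large)
        fix j assume "1 \<le> j" "j \<le> Suc (Suc n)"
        then show "2 \<le> hi - V j" using M[of j] by (auto simp: hi_def)
      qed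
      then show ?thesis using 3 by (simp add: t_def)
    qed
  qed
  have "\<exists>x. t i < x \<and> x < t (Suc i) \<and> sol V x (Suc (Suc (Suc n))) = 0" if "i < Suc (Suc n)" for i
  proof -
    have "0 < ((- 1) ^ (n + i) * sol V (t i) (Suc (Suc (Suc n)))) *
        ((- 1) ^ (n + Suc i) * sol V (t (Suc i)) (Suc (Suc (Suc n))))"
      by (rule mult_pos_pos; rule sgn; use that in linarith)
    also have "\<dots> = ((- 1) ^ (n + i) * (- 1) ^ (n + i)) * - (sol V (t i) (Suc (Suc (Suc n))) * sol V (t (Suc i)) (Suc (Suc (Suc n))))"
      by (simp only: power_Suc add_Suc_right) (simp only: ac_simps mult_minus_left mult_minus_right mult_1)
    also have "(- 1 :: real) ^ (n + i) * (- 1) ^ (n + i) = 1"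
      by (simp flip: power_mult_distrib)
    finally have "poly (sol_poly V (Suc (Suc (Suc n)))) (t i) * poly (sol_poly V (Suc (Suc (Suc n)))) (t (Suc i)) < 0"
      by (simp add: poly_sol_poly del: sol.simps sol_poly.simps)
    from poly_IVT[OF t_lt[OF that] this] show ?thesis
      by (auto simp: poly_sol_poly simp del: sol.simps sol_poly.simps)
  qed
  then obtain r'' where r'': "\<And>i. i < Suc (Suc n) \<Longrightarrow> t i < r'' i \<and> r'' i < t (Suc i) \<and> sol V (r'' i) (Suc (Suc (Suc n))) = 0"
    by metis
  have "r'' i < r' i" "r' i < r'' (Suc i)" if "i < Suc n" for i
    using r''[of i] r''[of "Suc i"] that by (auto simp: t_def split: if_splits)
  then show ?case
    using r' r'' by (intro exI[of _ r'] exI[of _ r'']) (auto simp del: sol.simps)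
qed

lemma prod_sign_card_greater:
  fixes r :: "nat \<Rightarrow> real"
  assumes "(\<Prod>i<n. E - r i) \<noteq> 0"
  shows "0 < sg (int (card {i\<in>{..<n}. E < r i})) * (\<Prod>i<n. E - r i)"
  using assms
proof (induction n)
  case 0
  show ?case by (simp add: sg_def)
next
  case (Suc n)
  have IH: "0 < sg (int (card {i\<in>{..<n}. E < r i})) * (\<Prod>i<n. E - r i)" and ne: "E \<noteq> r n"
    using Suc by auto
  show ?case
  proof (cases "E < r n")
    case True
    then have "{i\<in>{..<Suc n}. E < r i} = insert n {i\<in>{..<n}. E < r i}"
      by (auto simp: less_Suc_eq)
    then have "sg (int (card {i\<in>{..<Suc n}. E < r i})) = - sg (int (card {i\<in>{..<n}. E < r i}))"
      by simp
    then show ?thesis using mult_pos_pos[OF IH, of "r n - E"] True by (simp add: algebra_simps)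
  next
    case False
    then have "{i\<in>{..<Suc n}. E < r i} = {i\<in>{..<n}. E < r i}"
      by (auto simp: less_Suc_eq)
    then show ?thesis using mult_pos_pos[OF IH, of "E - r n"] False ne by (simp add: algebra_simps)
  qed
qed

definition sol_roots :: "(nat \<Rightarrow> real) \<Rightarrow> nat \<Rightarrow> real set" where
  "sol_roots V n = {x. sol V x (Suc n) = 0}"

lemma finite_sol_roots: "finite (sol_roots V n)"
proof -
  have "sol_poly V (Suc n) \<noteq> 0" using monic_sol_poly[of V n] by auto
  from poly_roots_finite[OF this] show ?thesis
    by (simp add: sol_roots_def poly_sol_poly)
qed

lemma sol_roots_eq_image:
  assumes "inj_on r {..<n}" "\<And>i. i < n \<Longrightarrow> sol V (r i) (Suc n) = 0"
  shows "sol_roots V n = r ` {..<n}"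
  using sol_eq_prod_roots[OF assms] by (auto simp: sol_roots_def)

lemma card_sol_roots: "card (sol_roots V n) = n"
proof -
  obtain r where r: "inj_on r {..<n}" "\<And>i. i < n \<Longrightarrow> sol V (r i) (Suc n) = 0"
  proof (cases n)
    case (Suc m)
    obtain r r' where "\<And>i. i \<le> m \<Longrightarrow> sol V (r' i) (Suc (Suc m)) = 0"
      and lace: "\<And>i. i < m \<Longrightarrow> r' i < r i" "\<And>i. i < m \<Longrightarrow> r i < r' (Suc i)"
      using roots_interlace[of m V] by blast
    moreover have "r' i < r' j" if "i < j" "j < n" for i j
      using that
    proof (induction j)
      case (Suc j)
      then show ?case using lace[of j] \<open>n = Suc m\<close> by (cases "i = j") auto
    qed simp
    then have "inj_on r' {..<n}"
      by (intro linorder_inj_onI) (auto simp: less_imp_neq)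
    ultimately show ?thesis using that Suc by auto
  qed auto
  then show ?thesis by (simp add: sol_roots_eq_image card_image)
qed

text \<open>By interlacing, the number of roots above \<open>E\<close> stays or grows by one with
  each site, and the sign of the new value decides which, as in \<open>osc_step\<close>. At a zero
  the number stays, which matches the convention that a vanishing value inherits the old
  sign.\<close>

lemma osc_eq_card_roots: "osc V E (Suc n) = int (card {x \<in> sol_roots V n. E < x})"
proof (induction n)
  case 0
  show ?case by (simp add: sol_roots_def osc_step_def sg_def)
next
  case (Suc n)
  obtain r r' where r: "\<And>i. i < n \<Longrightarrow> sol V (r i) (Suc n) = 0"
    and r': "\<And>i. i < Suc n \<Longrightarrow> sol V (r' i) (Suc (Suc n)) = 0"
    and lace: "\<And>i. i < n \<Longrightarrow> r' i < r i" "\<And>i. i < n \<Longrightarrow> r i < r' (Suc i)"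
    using roots_interlace[of n V] unfolding less_Suc_eq_le by blast
  have lt: "r' i < r' j" if "i < j" "j \<le> n" for i j
    using that
  proof (induction j)
    case (Suc j)
    then show ?case using lace[of j] by (cases "i = j") auto
  qed simp
  have r_lt: "r i < r j" if "i < j" "j < n" for i j
    using lace(2)[of i] lace(1)[of j] lt[of "Suc i" j] that by (cases "Suc i = j") auto
  have inj: "inj_on r {..<n}" "inj_on r' {..<Suc n}"
    by (rule linorder_inj_onI, use r_lt lt in \<open>auto simp: less_imp_neq less_Suc_eq_le\<close>)+
  define A A' where "A = {i\<in>{..<n}. E < r i}" and "A' = {i\<in>{..<Suc n}. E < r' i}"
  have fin: "finite A" "finite A'" by (auto simp: A_def A'_def)
  have "{x \<in> sol_roots V n. E < x} = r ` A"
    using sol_roots_eq_image[OF inj(1), of V] r by (auto simp: A_def)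
  then have N: "card {x \<in> sol_roots V n. E < x} = card A"
    by (simp add: card_image inj_on_subset[OF inj(1)] A_def subset_iff)
  have "{x \<in> sol_roots V (Suc n). E < x} = r' ` A'"
    using sol_roots_eq_image[OF inj(2), of V] r' by (auto simp: A'_def simp del: sol.simps)
  then have N': "card {x \<in> sol_roots V (Suc n). E < x} = card A'"
    by (simp add: card_image inj_on_subset[OF inj(2)] A'_def subset_iff)
  have prod: "sol V E (Suc (Suc n)) = (\<Prod>i<Suc n. E - r' i)"
    by (rule sol_eq_prod_roots[OF inj(2) r'])
  have sgn: "0 < sg (int (card A')) * sol V E (Suc (Suc n))" if "sol V E (Suc (Suc n)) \<noteq> 0"
    using prod_sign_card_greater[of E r' "Suc n"] that unfolding prod A'_def by blast
  have "Suc ` A \<subseteq> A'"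
    using lace(2) by (force simp: A_def A'_def)
  then have lower: "card A \<le> card A'"
    using card_mono[OF fin(2), of "Suc ` A"] by (simp add: card_image)
  have "A' \<subseteq> insert n A"
    using lace(1) by (force simp: A_def A'_def less_Suc_eq)
  then have upper: "card A' \<le> card A + 1"
    using card_mono[of "insert n A" A'] fin card_insert_le_m1[of "Suc (card A)" A n] by simp
  have zero: "card A' = card A" if "sol V E (Suc (Suc n)) = 0"
  proof -
    have "E \<in> r' ` {..<Suc n}"
      using that sol_roots_eq_image[OF inj(2) r'] by (auto simp: sol_roots_def simp del: sol.simps)
    then obtain k where k: "k \<le> n" "E = r' k" by (auto simp: less_Suc_eq_le)
    have "A' = {k<..<Suc n}"
    proof -
      have "E < r' i \<longleftrightarrow> k < i" if "i \<le> n" for i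
        using lt[of k i] lt[of i k] that k by (cases i k rule: linorder_cases) auto
      then show ?thesis by (auto simp: A'_def less_Suc_eq_le)
    qed
    moreover have "A = {k..<n}"
    proof -
      have "E < r i \<longleftrightarrow> k \<le> i" if "i < n" for i
      proof (cases "k \<le> i")
        case True
        then show ?thesis using lace(1)[of i] lt[of k i] that k by (cases "k = i") auto
      next
        case False
        then show ?thesis using lace(2)[of i] lt[of "Suc i" k] that k by (cases "k = Suc i") auto
      qed
      then show ?thesis by (auto simp: A_def)
    qed
    ultimately show ?thesis by simp
  qed
  have "osc_step (sol V E (Suc (Suc n))) (int (card A)) = int (card A')"
  proof (cases "sol V E (Suc (Suc n)) = 0")
    case True
    then show ?thesis using zero by (simp add: osc_step_def)
  next
    case False
    have "card A' = card A \<or> card A' = card A + 1" using lower upper by linarith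
    then show ?thesis using sgn[OF False] by (auto simp: osc_step_def)
  qed
  then show ?case using Suc N N' by simp
qed

section \<open>The Dirichlet matrix and its spectrum\<close>

lemma eigenvalue_anderson_of_sol_root:
  assumes "x \<in> sol_roots (\<lambda>i. \<sigma> * \<omega> i) n"
  shows "eigenvalue (anderson_matrix \<omega> \<sigma> n) x"
proof -
  define V where "V = (\<lambda>i. \<sigma> * \<omega> i)"
  define A where "A = anderson_matrix \<omega> \<sigma> n"
  define v where "v = vec n (\<lambda>i. sol V x (Suc i))"
  have A: "A \<in> carrier_mat n n" by (simp add: A_def anderson_matrix_def)
  have end0: "sol V x (Suc n) = 0" using assms by (simp add: sol_roots_def V_def)
  then have n: "0 < n" by (cases n) auto
  have "v \<noteq> 0\<^sub>v n"
  proof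
    assume "v = 0\<^sub>v n"
    then have "v $ 0 = 0" using n by simp
    then show False using n by (simp add: v_def)
  qed
  moreover have "A *\<^sub>v v = x \<cdot>\<^sub>v v"
  proof (rule eq_vecI)
    fix i assume "i < dim_vec (x \<cdot>\<^sub>v v)"
    then have i: "i < n" by (simp add: v_def)
    let ?u = "sol V x"
    have "(A *\<^sub>v v) $ i = (\<Sum>j = 0..<n. A $$ (i, j) * ?u (Suc j))"
      using i A by (simp add: scalar_prod_def v_def)
    also have "\<dots> = (\<Sum>j = 0..<n. (if j = i then V (Suc i) * ?u (Suc i) else 0)
        + (if j = Suc i then ?u (Suc j) else 0) + (if Suc j = i then ?u (Suc j) else 0))"
      using i by (intro sum.cong) (auto simp: A_def anderson_matrix_def V_def)
    also have "\<dots> = V (Suc i) * ?u (Suc i) + (if Suc i < n then ?u (Suc (Suc i)) else 0)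
        + (\<Sum>j = 0..<n. if Suc j = i then ?u (Suc j) else 0)"
      using i by (simp add: sum.distrib del: sol.simps)
    \<comment> \<open>The neighbour missing in the last row costs nothing, because the solution
      vanishes at site \<open>n + 1\<close>.\<close>
    also have "(if Suc i < n then ?u (Suc (Suc i)) else 0) = ?u (Suc (Suc i))"
      using end0 i by (cases "Suc i < n") (auto simp: not_less less_Suc_eq_le dest!: le_antisym simp del: sol.simps)
    also have "(\<Sum>j = 0..<n. if Suc j = i then ?u (Suc j) else 0) = ?u i"
    proof (cases i)
      case (Suc l)
      have "(\<Sum>j = 0..<n. if Suc j = i then ?u (Suc j) else 0) = (\<Sum>j = 0..<n. if j = l then ?u (Suc l) else 0)"
        using Suc by (intro sum.cong) auto
      then show ?thesis using Suc i by (simp del: sol.simps)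
    qed simp
    also have "V (Suc i) * ?u (Suc i) + ?u (Suc (Suc i)) + ?u i = x * ?u (Suc i)"
      by (simp add: algebra_simps)
    finally show "(A *\<^sub>v v) $ i = (x \<cdot>\<^sub>v v) $ i"
      using i by (simp add: v_def)
  qed (use A in \<open>auto simp: v_def\<close>)
  ultimately have "eigenvector A v x"
    using A by (simp add: eigenvector_def v_def)
  then show ?thesis
    unfolding eigenvalue_def A_def by blast
qed

text \<open>No determinant is expanded: each of the \<open>n\<close> distinct roots carries an
  explicit eigenvector, and a monic polynomial of degree \<open>n\<close> is determined by
  \<open>n\<close> distinct roots.\<close>

lemma char_poly_anderson:
  "char_poly (anderson_matrix \<omega> \<sigma> n) = (\<Prod>x\<in>sol_roots (\<lambda>i. \<sigma> * \<omega> i) n. [:- x, 1:])"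
proof -
  have A: "anderson_matrix \<omega> \<sigma> n \<in> carrier_mat n n" by (simp add: anderson_matrix_def)
  show ?thesis
    using degree_monic_char_poly[OF A] eigenvalue_anderson_of_sol_root[of _ \<sigma> \<omega> n]
    by (intro monic_eq_prod_roots)
      (auto simp: card_sol_roots finite_sol_roots eigenvalue_root_char_poly[OF A])
qed

lemma order_prod_distinct_linear:
  fixes S :: "'a::idom set"
  assumes "finite S" "x \<in> S"
  shows "order x (\<Prod>y\<in>S. [:- y, 1:]) = 1"
proof -
  define q where "q = (\<Prod>y\<in>S - {x}. [:- y, 1:])"
  have q: "poly q x \<noteq> 0" using assms by (auto simp: q_def poly_prod)
  have "(\<Prod>y\<in>S. [:- y, 1:]) = [:- x, 1:] * q"
    unfolding q_def using assms by (rule prod.remove)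
  moreover have "order x ([:- x, 1:] * q) = 1"
  proof -
    have "order x [:- x, 1:] = 1" using order_power_n_n[of x 1] by simp
    moreover have "order x q = 0" using q by (rule order_0I)
    moreover have "[:- x, 1:] * q \<noteq> 0" using q by (metis mult_eq_0_iff pCons_eq_0_iff poly_0 zero_neq_one)
    ultimately show ?thesis using Polynomial.order_mult[of "[:- x, 1:]" q x] by linarith
  qed
  ultimately show ?thesis by simp
qed

lemma eig_count_anderson:
  "eig_count (anderson_matrix \<omega> \<sigma> n) I = card (I \<inter> sol_roots (\<lambda>i. \<sigma> * \<omega> i) n)"
proof -
  define R where "R = sol_roots (\<lambda>i. \<sigma> * \<omega> i) n"
  have A: "anderson_matrix \<omega> \<sigma> n \<in> carrier_mat n n" by (simp add: anderson_matrix_def)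
  have fin: "finite R" by (simp add: R_def finite_sol_roots)
  have cp: "char_poly (anderson_matrix \<omega> \<sigma> n) = (\<Prod>x\<in>R. [:- x, 1:])"
    by (simp add: R_def char_poly_anderson)
  have "eigenvalue (anderson_matrix \<omega> \<sigma> n) x \<longleftrightarrow> x \<in> R" for x
    using fin by (auto simp: eigenvalue_root_char_poly[OF A] cp poly_prod)
  then have "{x \<in> I. eigenvalue (anderson_matrix \<omega> \<sigma> n) x} = I \<inter> R" by auto
  then show ?thesis
    using fin by (simp add: eig_count_def cp order_prod_distinct_linear R_def)
qed

lemma eig_count_anderson_le: "eig_count (anderson_matrix \<omega> \<sigma> n) I \<le> n"
  unfolding eig_count_anderson
  by (metis Int_lower2 card_mono card_sol_roots finite_sol_roots)

section \<open>Existence of the integrated density of states\<close>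

text \<open>A two-sided form of Fekete's argument: \<open>a (m * n)\<close> is compared both with
  \<open>m\<close> copies of \<open>a n\<close> and with \<open>n\<close> copies of
  \<open>a m\<close>, which makes the quotients Cauchy.\<close>

lemma almost_additive_convergent:
  fixes a :: "nat \<Rightarrow> real"
  assumes "\<And>m n. \<bar>a (m + n) - a m - a n\<bar> \<le> C"
  shows "convergent (\<lambda>n. a n / real n)"
proof -
  have C: "0 \<le> C" using assms[of 0 0] by linarith
  have mult: "\<bar>a (m * n) - real m * a n\<bar> \<le> (real m + 1) * C" for m n
  proof (induction m)
    case 0
    then show ?case using assms[of 0 0] by simp
  next
    case (Suc m)
    have "\<bar>a (n + m * n) - a n - a (m * n)\<bar> \<le> C" by (rule assms)
    with Suc show ?case by (simp add: algebra_simps)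
  qed
  have close: "\<bar>a n / real n - a m / real m\<bar> \<le> 2 * C / real n + 2 * C / real m" if "0 < n" "0 < m" for m n
  proof -
    have "\<bar>real m * a n - real n * a m\<bar> \<le> (real m + 1) * C + (real n + 1) * C"
      using mult[of m n] mult[of n m] by (simp add: mult.commute)
    also have "\<dots> \<le> (2 * real m) * C + (2 * real n) * C"
      using that C by (intro add_mono mult_right_mono) auto
    finally have "\<bar>real m * a n - real n * a m\<bar> / (real n * real m) \<le> ((2 * real m) * C + (2 * real n) * C) / (real n * real m)"
      by (intro divide_right_mono) auto
    moreover have "a n / real n - a m / real m = (real m * a n - real n * a m) / (real n * real m)"
      "((2 * real m) * C + (2 * real n) * C) / (real n * real m) = 2 * C / real n + 2 * C / real m"
      using that by (simp_all add: field_simps)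
    ultimately show ?thesis by (simp add: abs_divide)
  qed
  have "Cauchy (\<lambda>n. a n / real n)"
  proof (rule metric_CauchyI)
    fix e :: real assume "0 < e"
    obtain N where N: "4 * C / e < real N" using reals_Archimedean2 by blast
    have small: "2 * C / real n < e / 2" if "Suc N \<le> n" for n
    proof -
      have "4 * C / e < real n" using N that by linarith
      then show ?thesis using \<open>0 < e\<close> that by (simp add: field_simps)
    qed
    show "\<exists>M. \<forall>m\<ge>M. \<forall>n\<ge>M. dist (a m / real m) (a n / real n) < e"
    proof (intro exI allI impI)
      fix m n assume "Suc N \<le> m" "Suc N \<le> n"
      then show "dist (a m / real m) (a n / real n) < e"
        using close[of m n] small[of m] small[of n] by (simp add: dist_real_def)
    qed
  qed
  then show ?thesis by (rule Cauchy_convergent)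
qed

lemma eventually_at_left_finite:
  fixes a :: real
  assumes "finite R"
  shows "\<forall>\<^sub>F E in at_left a. \<forall>x\<in>R. E < x \<longleftrightarrow> a \<le> x"
proof (rule eventually_ball_finite[OF assms], rule ballI)
  fix x :: real
  have lt: "\<forall>\<^sub>F E in at_left a. E < a"
    by (simp add: eventually_at_filter)
  show "\<forall>\<^sub>F E in at_left a. E < x \<longleftrightarrow> a \<le> x"
  proof (cases "a \<le> x")
    case True
    then show ?thesis using lt by (auto elim!: eventually_mono)
  next
    case False
    then have "\<forall>\<^sub>F E in at_left a. x < E"
      by (intro order_tendstoD(1)[where y = a]) auto
    then show ?thesis using False by (auto elim!: eventually_mono)
  qed
qed

text \<open>\<open>osc\<close> counts roots strictly above the energy; approaching \<open>a\<close>
  from the left keeps an eigenvalue at \<open>a\<close> in the count.\<close>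

lemma eventually_eig_count_eq_osc:
  assumes "a \<le> b"
  shows "\<forall>\<^sub>F E in at_left a. int (eig_count (anderson_matrix \<omega> \<sigma> n) {a..b}) =
    osc (\<lambda>i. \<sigma> * \<omega> i) E (Suc n) - osc (\<lambda>i. \<sigma> * \<omega> i) b (Suc n)"
proof -
  define R where "R = sol_roots (\<lambda>i. \<sigma> * \<omega> i) n"
  have fin: "finite R" by (simp add: R_def finite_sol_roots)
  have "int (card ({a..b} \<inter> R)) = int (card {x \<in> R. E < x}) - int (card {x \<in> R. b < x})"
    if E: "\<forall>x\<in>R. E < x \<longleftrightarrow> a \<le> x" for E
  proof -
    have "{x \<in> R. E < x} = ({a..b} \<inter> R) \<union> {x \<in> R. b < x}"
    proof -
      have "{x \<in> R. E < x} = {x \<in> R. a \<le> x}" using E by (intro Collect_cong) blast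
      also have "\<dots> = ({a..b} \<inter> R) \<union> {x \<in> R. b < x}" using assms by auto
      finally show ?thesis .
    qed
    moreover have "card (({a..b} \<inter> R) \<union> {x \<in> R. b < x}) = card ({a..b} \<inter> R) + card {x \<in> R. b < x}"
      using fin by (intro card_Un_disjoint) auto
    ultimately show ?thesis by simp
  qed
  from eventually_mono[OF eventually_at_left_finite[OF fin] this] show ?thesis
    unfolding osc_eq_card_roots eig_count_anderson R_def[symmetric] .
qed

lemma eig_count_le_osc_diff:
  assumes "E < a" "a \<le> b"
  shows "int (eig_count (anderson_matrix \<omega> \<sigma> n) {a..b}) \<le>
    osc (\<lambda>i. \<sigma> * \<omega> i) E (Suc n) - osc (\<lambda>i. \<sigma> * \<omega> i) b (Suc n)"
proof -
  define R where "R = sol_roots (\<lambda>i. \<sigma> * \<omega> i) n"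
  have fin: "finite R" by (simp add: R_def finite_sol_roots)
  have "card ({a..b} \<inter> R) + card {x \<in> R. b < x} = card (({a..b} \<inter> R) \<union> {x \<in> R. b < x})"
    using fin by (intro card_Un_disjoint[symmetric]) auto
  also have "\<dots> \<le> card {x \<in> R. E < x}"
    using fin assms by (intro card_mono) auto
  finally show ?thesis
    unfolding osc_eq_card_roots eig_count_anderson R_def[symmetric] by simp
qed

lemma eig_count_almost_additive:
  assumes "a \<le> b"
  shows "\<bar>int (eig_count (anderson_matrix \<omega> \<sigma> (n + m)) {a..b}) - int (eig_count (anderson_matrix \<omega> \<sigma> n) {a..b})
     - int (eig_count (anderson_matrix (\<lambda>i. \<omega> (n + i)) \<sigma> m) {a..b})\<bar> \<le> 3"
proof -
  define V where "V = (\<lambda>i. \<sigma> * \<omega> i)"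
  define V' where "V' = (\<lambda>i. V (n + i))"
  have "\<forall>\<^sub>F E in at_left a.
      int (eig_count (anderson_matrix \<omega> \<sigma> (n + m)) {a..b}) = osc V E (Suc (n + m)) - osc V b (Suc (n + m)) \<and>
      int (eig_count (anderson_matrix \<omega> \<sigma> n) {a..b}) = osc V E (Suc n) - osc V b (Suc n) \<and>
      int (eig_count (anderson_matrix (\<lambda>i. \<omega> (n + i)) \<sigma> m) {a..b}) = osc V' E (Suc m) - osc V' b (Suc m)"
    unfolding V_def V'_def by (intro eventually_conj eventually_eig_count_eq_osc assms)
  then obtain E where E: "int (eig_count (anderson_matrix \<omega> \<sigma> (n + m)) {a..b}) = osc V E (Suc (n + m)) - osc V b (Suc (n + m))"
      "int (eig_count (anderson_matrix \<omega> \<sigma> n) {a..b}) = osc V E (Suc n) - osc V b (Suc n)"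
      "int (eig_count (anderson_matrix (\<lambda>i. \<omega> (n + i)) \<sigma> m) {a..b}) = osc V' E (Suc m) - osc V' b (Suc m)"
    using eventually_happens'[OF trivial_limit_at_left_real] by blast
  have "\<bar>(osc V E (Suc (n + m)) - osc V' E (Suc m)) - (osc V E n + 1)\<bar> \<le> 1" for E
    using osc_shift_diff[of V E n "Suc m"] by (simp add: V'_def del: osc.simps)
  \<comment> \<open>At each of the two energies the defect of the counter, taken at
    \<open>n + m + 1\<close>, \<open>n + 1\<close> and \<open>m + 1\<close>, lies between -1 and 2;
    hence the difference is at most 3.\<close>
  from this[of E] this[of b] show ?thesis
    unfolding E using osc_mono[of V E n] osc_mono[of V b n] by linarith
qed

lemma anderson_matrix_cong:
  assumes "\<And>i. i \<in> {1..n} \<Longrightarrow> \<omega> i = \<omega>' i"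
  shows "anderson_matrix \<omega> \<sigma> n = anderson_matrix \<omega>' \<sigma> n"
  unfolding anderson_matrix_def using assms by (intro eq_matI) auto

section \<open>Random potentials: measurability and convergence of the averaged counts\<close>

locale random_potential = prob_space P for P :: "real measure" +
  assumes sets_P [measurable_cong]: "sets P = sets borel"
begin

abbreviation Pn :: "nat \<Rightarrow> (nat \<Rightarrow> real) measure" where
  "Pn n \<equiv> PiM {1..n} (\<lambda>_. P)"

lemma prob_space_Pn: "prob_space (Pn n)"
  by (rule prob_space_PiM) (rule prob_space_axioms)

lemma integral_const_Pn: "(\<integral>\<omega>. c \<partial>Pn n) = (c :: real)"
  using prob_space.prob_space[OF prob_space_Pn, of n] by (simp only: lebesgue_integral_const scaleR_one)

lemma integrable_const_Pn: "integrable (Pn n) (\<lambda>\<omega>. c :: real)"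
  using prob_space_Pn[of n] by (simp only: prob_space_def finite_measure.integrable_const)

lemma measurable_coord: "i \<in> {1..n} \<Longrightarrow> (\<lambda>\<omega>. \<omega> i) \<in> borel_measurable (Pn n)"
  using measurable_component_singleton[of i "{1..n}" "\<lambda>_. P"] measurable_cong_sets[OF refl sets_P] by blast

lemma measurable_sol:
  "k \<le> Suc n \<Longrightarrow> (\<lambda>\<omega>. sol (\<lambda>i. \<sigma> * \<omega> i) E k) \<in> borel_measurable (Pn n)"
proof (induction k rule: less_induct)
  case (less k)
  consider "k = 0" | "k = 1" | l where "k = Suc (Suc l)"
    by (metis One_nat_def not0_implies_Suc)
  then show ?case
  proof cases
    case 3
    have [measurable]: "(\<lambda>\<omega>. sol (\<lambda>i. \<sigma> * \<omega> i) E l) \<in> borel_measurable (Pn n)"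
      "(\<lambda>\<omega>. sol (\<lambda>i. \<sigma> * \<omega> i) E (Suc l)) \<in> borel_measurable (Pn n)"
      "(\<lambda>\<omega>. \<omega> (Suc l)) \<in> borel_measurable (Pn n)"
      using less 3 by (auto intro!: less.IH measurable_coord)
    show ?thesis unfolding 3 sol.simps by measurable
  qed auto
qed

lemma measurable_osc:
  "k \<le> Suc n \<Longrightarrow> (\<lambda>\<omega>. osc (\<lambda>i. \<sigma> * \<omega> i) E k) \<in> measurable (Pn n) (count_space UNIV)"
proof (induction k)
  case (Suc k)
  have [measurable]: "(\<lambda>\<omega>. osc (\<lambda>i. \<sigma> * \<omega> i) E k) \<in> measurable (Pn n) (count_space UNIV)"
    using Suc by simp
  have [measurable]: "(\<lambda>\<omega>. sol (\<lambda>i. \<sigma> * \<omega> i) E (Suc k)) \<in> borel_measurable (Pn n)"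
    using Suc by (intro measurable_sol)
  have [measurable]: "sg \<in> borel_measurable (count_space UNIV)" by simp
  show ?case unfolding osc.simps osc_step_def by measurable
qed simp

text \<open>The count is an eventually constant limit of differences of \<open>osc\<close>, and
  \<open>osc\<close> arises by recursion from measurable operations; no measurable selection of
  eigenvalues is involved.\<close>

lemma measurable_eig_count:
  assumes "a \<le> b"
  shows "(\<lambda>\<omega>. real (eig_count (anderson_matrix \<omega> \<sigma> n) {a..b})) \<in> borel_measurable (Pn n)"
proof (rule borel_measurable_LIMSEQ_real)
  define E where "E j = a - 1 / real (Suc j)" for j
  have lim: "filterlim E (at_left a) sequentially"
    unfolding filterlim_at
  proof
    show "\<forall>\<^sub>F j in sequentially. E j \<in> {..<a} \<and> E j \<noteq> a" by (auto simp: E_def)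
    have "E \<longlonglongrightarrow> a - 0" unfolding E_def
      by (intro tendsto_intros LIMSEQ_Suc lim_1_over_n)
    then show "E \<longlonglongrightarrow> a" by simp
  qed
  show "(\<lambda>j. real_of_int (osc (\<lambda>i. \<sigma> * \<omega> i) (E j) (Suc n) - osc (\<lambda>i. \<sigma> * \<omega> i) b (Suc n)))
      \<longlonglongrightarrow> real (eig_count (anderson_matrix \<omega> \<sigma> n) {a..b})" for \<omega>
  proof (rule tendsto_eventually)
    have "\<forall>\<^sub>F j in sequentially. int (eig_count (anderson_matrix \<omega> \<sigma> n) {a..b}) =
      osc (\<lambda>i. \<sigma> * \<omega> i) (E j) (Suc n) - osc (\<lambda>i. \<sigma> * \<omega> i) b (Suc n)"
      using eventually_eig_count_eq_osc[OF assms, of \<omega> \<sigma> n] lim by (rule eventually_compose_filterlim)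
    then show "\<forall>\<^sub>F j in sequentially. real_of_int (osc (\<lambda>i. \<sigma> * \<omega> i) (E j) (Suc n) - osc (\<lambda>i. \<sigma> * \<omega> i) b (Suc n)) =
      real (eig_count (anderson_matrix \<omega> \<sigma> n) {a..b})"
      by eventually_elim (metis of_int_of_nat_eq)
  qed
  fix j
  have [measurable]: "(\<lambda>\<omega>. osc (\<lambda>i. \<sigma> * \<omega> i) E (Suc n)) \<in> measurable (Pn n) (count_space UNIV)" for E
    by (rule measurable_osc) simp
  show "(\<lambda>\<omega>. real_of_int (osc (\<lambda>i. \<sigma> * \<omega> i) (E j) (Suc n) - osc (\<lambda>i. \<sigma> * \<omega> i) b (Suc n))) \<in> borel_measurable (Pn n)"
    by measurable
qed

lemma integrable_eig_count:
  assumes "a \<le> b"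
  shows "integrable (Pn n) (\<lambda>\<omega>. real (eig_count (anderson_matrix \<omega> \<sigma> n) {a..b}))"
proof -
  interpret Pn: prob_space "Pn n" by (rule prob_space_Pn)
  show ?thesis
    using measurable_eig_count[OF assms]
    by (intro Pn.integrable_const_bound[where B = n]) (auto simp: eig_count_anderson_le)
qed

text \<open>Stationarity: a block of sites embedded injectively into a larger block sees the same
  product law. The embeddings used later are the identity and a shift.\<close>

lemma integral_eig_count_reindex:
  fixes f :: "nat \<Rightarrow> nat"
  assumes "a \<le> b" "inj_on f {1..n}" "f \<in> {1..n} \<rightarrow> {1..k}"
  shows "(\<integral>\<omega>. real (eig_count (anderson_matrix (\<lambda>i. \<omega> (f i)) \<sigma> n) {a..b}) \<partial>Pn k) =
      (\<integral>\<omega>. real (eig_count (anderson_matrix \<omega> \<sigma> n) {a..b}) \<partial>Pn n)" (is "_ = ?R")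
    and "integrable (Pn k) (\<lambda>\<omega>. real (eig_count (anderson_matrix (\<lambda>i. \<omega> (f i)) \<sigma> n) {a..b}))"
proof -
  let ?t = "\<lambda>\<omega>. \<lambda>i\<in>{1..n}. \<omega> (f i)"
  have distr: "distr (Pn k) (Pn n) ?t = Pn n"
    using distr_PiM_reindex[of "{1..k}" "\<lambda>_. P" f "{1..n}"] assms prob_space_axioms by simp
  have t: "?t \<in> measurable (Pn k) (Pn n)"
    using assms by (intro measurable_restrict measurable_component_singleton) auto
  have eq: "anderson_matrix (?t \<omega>) \<sigma> n = anderson_matrix (\<lambda>i. \<omega> (f i)) \<sigma> n" for \<omega>
    by (rule anderson_matrix_cong) simp
  show "(\<integral>\<omega>. real (eig_count (anderson_matrix (\<lambda>i. \<omega> (f i)) \<sigma> n) {a..b}) \<partial>Pn k) = ?R"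
    using integral_distr[OF t measurable_eig_count[OF assms(1)], of \<sigma>]
    unfolding distr eq by simp
  show "integrable (Pn k) (\<lambda>\<omega>. real (eig_count (anderson_matrix (\<lambda>i. \<omega> (f i)) \<sigma> n) {a..b}))"
    using integrable_distr[OF t, of "\<lambda>\<omega>. real (eig_count (anderson_matrix \<omega> \<sigma> n) {a..b})"]
      integrable_eig_count[OF assms(1), of n \<sigma>] unfolding distr eq by simp
qed

text \<open>The term \<open>lim\<close> carries no information for a divergent sequence. Almost
  additivity of the counts passes to their expectations by stationarity and supplies the
  convergence.\<close>

lemma ids_LIMSEQ:
  assumes "a \<le> b"
  shows "(\<lambda>n. 1 / real n * (\<integral>\<omega>. real (eig_count (anderson_matrix \<omega> \<sigma> n) {a..b}) \<partial>Pn n))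
    \<longlonglongrightarrow> ids P \<sigma> {a..b}"
proof -
  define N where "N \<omega> n = real (eig_count (anderson_matrix \<omega> \<sigma> n) {a..b})" for \<omega> n
  define A where "A n = (\<integral>\<omega>. N \<omega> n \<partial>Pn n)" for n
  have "\<bar>A (n + m) - A n - A m\<bar> \<le> 3" for n m
  proof -
    have 1: "A n = (\<integral>\<omega>. N \<omega> n \<partial>Pn (n + m))" "integrable (Pn (n + m)) (\<lambda>\<omega>. N \<omega> n)"
      using integral_eig_count_reindex[OF assms, of "\<lambda>i. i" n "n + m" \<sigma>] by (auto simp: A_def N_def)
    have 2: "A m = (\<integral>\<omega>. N (\<lambda>i. \<omega> (n + i)) m \<partial>Pn (n + m))"
        "integrable (Pn (n + m)) (\<lambda>\<omega>. N (\<lambda>i. \<omega> (n + i)) m)"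
      using integral_eig_count_reindex[OF assms, of "\<lambda>i. n + i" m "n + m" \<sigma>] by (auto simp: A_def N_def)
    have 3: "integrable (Pn (n + m)) (\<lambda>\<omega>. N \<omega> (n + m))"
      unfolding N_def by (rule integrable_eig_count[OF assms])
    have "A (n + m) - A n - A m = (\<integral>\<omega>. N \<omega> (n + m) - N \<omega> n - N (\<lambda>i. \<omega> (n + i)) m \<partial>Pn (n + m))"
      using 1 2 3 by (simp add: A_def[of "n + m"])
    also have "\<bar>\<dots>\<bar> \<le> (\<integral>\<omega>. \<bar>N \<omega> (n + m) - N \<omega> n - N (\<lambda>i. \<omega> (n + i)) m\<bar> \<partial>Pn (n + m))"
      by (rule integral_abs_bound)
    also have "\<dots> \<le> (\<integral>\<omega>. 3 \<partial>Pn (n + m))"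
    proof (rule integral_mono)
      show "\<bar>N \<omega> (n + m) - N \<omega> n - N (\<lambda>i. \<omega> (n + i)) m\<bar> \<le> 3" for \<omega>
        using eig_count_almost_additive[OF assms, of \<omega> \<sigma> n m] unfolding N_def by linarith
    qed (use 1 2 3 integrable_const_Pn[of "n + m" 3] in auto)
    finally show ?thesis unfolding integral_const_Pn .
  qed
  then have "convergent (\<lambda>n. A n / real n)"
    by (rule almost_additive_convergent)
  then have "convergent (\<lambda>n. 1 / real n * A n)" by simp
  then show ?thesis
    unfolding ids_def A_def N_def convergent_LIMSEQ_iff .
qed

lemma ids_le_1:
  assumes "a \<le> b"
  shows "ids P \<sigma> {a..b} \<le> 1"
proof (rule LIMSEQ_le_const2[OF ids_LIMSEQ[OF assms]], intro exI allI impI)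
  fix n :: nat
  have "(\<integral>\<omega>. real (eig_count (anderson_matrix \<omega> \<sigma> n) {a..b}) \<partial>Pn n) \<le> (\<integral>\<omega>. real n \<partial>Pn n)" (is "?I \<le> _")
    using integrable_eig_count[OF assms] integrable_const_Pn
    by (intro integral_mono) (auto simp: eig_count_anderson_le)
  then have "?I \<le> real n" unfolding integral_const_Pn .
  then show "1 / real n * ?I \<le> 1"
    by (cases "n = 0") (auto simp: field_simps)
qed

end

section \<open>The corrected norm of a solution\<close>

text \<open>Lagrange remainder: the powers that occur are at most
  \<open>(9 / 10) powr (- 4) \<le> 2\<close> and \<open>s * (s + 1) * (s + 2) \<le> 6\<close>, so
  the third derivative is at most 12, and dividing by \<open>fact 3\<close> leaves 2.\<close>

lemma powr_neg_Taylor: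
  fixes s x :: real
  assumes s: "0 < s" "s \<le> 1" and x: "\<bar>x\<bar> \<le> 1 / 10"
  shows "(1 + x) powr (- s) \<le> 1 - s * x + s * (s + 1) / 2 * x\<^sup>2 + 2 * \<bar>x\<bar> ^ 3"
    and "\<bar>(1 + x) powr (- s) - 1\<bar> \<le> 2 * \<bar>x\<bar>"
proof -
  define d where "d m t = (- 1) ^ m * pochhammer s m * (1 + t) powr (- s - real m)" for m :: nat and t :: real
  have deriv: "DERIV (d m) t :> d (Suc m) t" if "- 1 / 10 \<le> t" for m t
    unfolding d_def using that
    by (auto intro!: derivative_eq_intros simp: pochhammer_Suc algebra_simps)
  have bound: "(1 + t) powr (- s - real m) \<le> 2" if t: "- 1 / 10 \<le> t" and "m \<le> 3" for m t
  proof -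
    have "(1 + t) powr (- s - real m) \<le> (9 / 10) powr (- s - real m)"
      using that s by (intro powr_mono2') auto
    also have "\<dots> \<le> (9 / 10) powr (- 4)"
      using that s by (intro powr_mono') auto
    also have "\<dots> = inverse ((9 / 10) ^ 4)"
      by (simp add: powr_minus powr_numeral)
    also have "\<dots> \<le> 2" by (simp add: power4_eq_xxxx)
    finally show ?thesis .
  qed
  have Taylor_x: "\<exists>t. - 1 / 10 \<le> t \<and> (1 + x) powr (- s) = (\<Sum>m<n. d m 0 / fact m * x ^ m) + d n t / fact n * x ^ n"
    if "x \<noteq> 0" "0 < n" for n
  proof -
    have d0: "d 0 = (\<lambda>x. (1 + x) powr (- s))" by (simp add: d_def fun_eq_iff)
    have "\<exists>t. (if x < 0 then x < t \<and> t < 0 else 0 < t \<and> t < x) \<and>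
        (1 + x) powr (- s) = (\<Sum>m<n. d m 0 / fact m * (x - 0) ^ m) + d n t / fact n * (x - 0) ^ n"
      using that x deriv d0
      by (intro Taylor[where a = "- 1 / 10" and b = "1 / 10"]) auto
    then obtain t where t: "if x < 0 then x < t \<and> t < 0 else 0 < t \<and> t < x"
      and eq: "(1 + x) powr (- s) = (\<Sum>m<n. d m 0 / fact m * (x - 0) ^ m) + d n t / fact n * (x - 0) ^ n"
      by blast
    have "- 1 / 10 \<le> t" using t x by (auto split: if_splits)
    with eq show ?thesis by auto
  qed
  have "(1 + x) powr (- s) \<le> 1 - s * x + s * (s + 1) / 2 * x\<^sup>2 + 2 * \<bar>x\<bar> ^ 3 \<and> \<bar>(1 + x) powr (- s) - 1\<bar> \<le> 2 * \<bar>x\<bar>"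
  proof (cases "x = 0")
    case False
    have p1: "pochhammer s (Suc 0) = s" and p2: "pochhammer s 2 = s * (s + 1)" and p3: "pochhammer s 3 = s * (s + 1) * (s + 2)"
      by (simp_all add: pochhammer_Suc eval_nat_numeral algebra_simps)
    from Taylor_x[OF False, of 3] obtain t where t: "- 1 / 10 \<le> t"
      and eq: "(1 + x) powr (- s) = (\<Sum>m<3. d m 0 / fact m * x ^ m) + d 3 t / fact 3 * x ^ 3" by auto
    have sum3: "(\<Sum>m<3. d m 0 / fact m * x ^ m) = 1 - s * x + s * (s + 1) / 2 * x\<^sup>2"
      by (simp add: eval_nat_numeral d_def pochhammer_Suc algebra_simps)
    have "s * (s + 1) * (s + 2) \<le> 1 * 2 * 3"
      using s by (intro mult_mono) auto
    then have "s * (s + 1) * (s + 2) * (1 + t) powr (- s - real 3) \<le> (1 * 2 * 3) * 2"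
      using s bound[OF t, of 3] by (intro mult_mono) auto
    then have "\<bar>d 3 t\<bar> \<le> 12"
      using s by (simp add: d_def p3 abs_mult)
    then have "\<bar>d 3 t\<bar> * \<bar>x\<bar> ^ 3 \<le> 12 * \<bar>x\<bar> ^ 3"
      by (intro mult_right_mono) auto
    then have "\<bar>d 3 t / fact 3 * x ^ 3\<bar> \<le> 2 * \<bar>x\<bar> ^ 3"
      by (simp add: abs_mult power_abs fact_numeral)
    then have one: "(1 + x) powr (- s) \<le> 1 - s * x + s * (s + 1) / 2 * x\<^sup>2 + 2 * \<bar>x\<bar> ^ 3"
      using eq sum3 by linarith
    from Taylor_x[OF False, of 1] obtain t where t: "- 1 / 10 \<le> t"
      and eq: "(1 + x) powr (- s) = 1 + d 1 t * x" by (auto simp: d_def)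
    have "s * (1 + t) powr (- s - real 1) \<le> 1 * 2"
      using s bound[OF t, of 1] by (intro mult_mono) auto
    then have "\<bar>d 1 t\<bar> \<le> 2" using s by (simp add: d_def abs_mult)
    then have "\<bar>d 1 t\<bar> * \<bar>x\<bar> \<le> 2 * \<bar>x\<bar>" by (intro mult_right_mono) auto
    then show ?thesis using one eq by (simp add: abs_mult)
  qed (use s in auto)
  then show "(1 + x) powr (- s) \<le> 1 - s * x + s * (s + 1) / 2 * x\<^sup>2 + 2 * \<bar>x\<bar> ^ 3"
    "\<bar>(1 + x) powr (- s) - 1\<bar> \<le> 2 * \<bar>x\<bar>" by auto
qed

text \<open>In the coordinates in which the free transfer matrix is a rotation, a potential of strength
  \<open>a\<close> acts on a solution by the shear \<open>kick a\<close>.\<close>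

definition kick :: "real \<Rightarrow> complex \<Rightarrow> complex" where
  "kick a z = z - of_real (a * Im z)"

lemma kick_simps [simp]: "Re (kick a z) = Re z - a * Im z" "Im (kick a z) = Im z"
  by (simp_all add: kick_def)

lemma kick_scale: "kick a (of_real r * z) = of_real r * kick a z"
  by (simp add: complex_eq_iff algebra_simps)

lemma kick_nonzero: "z \<noteq> 0 \<Longrightarrow> kick a z \<noteq> 0"
  by (auto simp: complex_eq_iff)

text \<open>\<open>S\<close> is the sine of twice the angle of \<open>z\<close>, and the squared
  norm after the kick is \<open>1 - a * S + a\<^sup>2 * (Im z)\<^sup>2\<close>. The cubic errors,
  2.01 from squaring the increment and 2.08 from the Taylor remainder, are rounded up to 5.\<close>

lemma kick_norm_powr:
  fixes z :: complex and a s :: real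
  defines "S \<equiv> 2 * Re z * Im z"
  assumes z: "cmod z = 1" and a: "\<bar>a\<bar> \<le> 1 / 100" and s: "0 < s" "s \<le> 1"
  shows "cmod (kick a z) powr (- 2 * s) \<le>
      1 + a * (s * S) + a\<^sup>2 * (s * (s + 1) / 2 * S\<^sup>2 - s * (Im z)\<^sup>2) + 5 * \<bar>a\<bar> ^ 3"
    and "\<bar>cmod (kick a z) powr (- 2 * s) - 1\<bar> \<le> 3 * \<bar>a\<bar>"
proof -
  define y where "y = (Im z)\<^sup>2"
  have xy: "(Re z)\<^sup>2 + y = 1" using z unfolding y_def by (metis cmod_power2 one_power2)
  have y: "0 \<le> y" "y \<le> 1" using xy zero_le_power2[of "Re z"] by (simp add: y_def, linarith)
  have S: "\<bar>S\<bar> \<le> 1"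
    using sum_squares_bound[of "Re z" "Im z"] sum_squares_bound[of "Re z" "- Im z"] xy
    by (simp add: S_def y_def)
  define x where "x = - (a * S) + a\<^sup>2 * y"
  have norm2: "(cmod (kick a z))\<^sup>2 = 1 + x"
    unfolding cmod_power2 x_def using xy by (simp add: S_def y_def power2_eq_square algebra_simps)
  have "z \<noteq> 0" using z by auto
  then have "cmod (kick a z) \<noteq> 0" using kick_nonzero[of z a] by simp
  then have pow: "cmod (kick a z) powr (- 2 * s) = (1 + x) powr (- s)"
    unfolding norm2[symmetric] by (simp add: powr_powr flip: powr_numeral)
  have a2: "a\<^sup>2 \<le> \<bar>a\<bar> / 100"
    using mult_left_mono[OF a, of "\<bar>a\<bar>"] by (simp add: power2_eq_square)
  have a2y: "0 \<le> a\<^sup>2 * y" "a\<^sup>2 * y \<le> a\<^sup>2"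
    using y mult_left_mono[of y 1 "a\<^sup>2"] by auto
  have aS: "\<bar>a * S\<bar> \<le> \<bar>a\<bar>"
    using mult_left_mono[OF S, of "\<bar>a\<bar>"] by (simp add: abs_mult)
  have absx: "\<bar>x\<bar> \<le> 101 / 100 * \<bar>a\<bar>"
    using aS a2y a2 unfolding x_def by linarith
  then have x: "\<bar>x\<bar> \<le> 1 / 10" using a by linarith
  note T = powr_neg_Taylor[OF s x]
  show "\<bar>cmod (kick a z) powr (- 2 * s) - 1\<bar> \<le> 3 * \<bar>a\<bar>"
    unfolding pow using T(2) absx by linarith
  have "\<bar>x\<bar> ^ 3 \<le> (101 / 100 * \<bar>a\<bar>) ^ 3"
    using absx by (intro power_mono) auto
  then have x3: "\<bar>x\<bar> ^ 3 \<le> 104 / 100 * \<bar>a\<bar> ^ 3"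
    unfolding power_mult_distrib by (rule order_trans) (intro mult_right_mono, auto simp: power3_eq_cube)
  have x2: "x\<^sup>2 \<le> a\<^sup>2 * S\<^sup>2 + 201 / 100 * \<bar>a\<bar> ^ 3"
  proof -
    have "x\<^sup>2 = a\<^sup>2 * S\<^sup>2 + (- 2 * (a * S) * (a\<^sup>2 * y) + (a\<^sup>2 * y) * (a\<^sup>2 * y))"
      by (simp add: x_def power2_eq_square algebra_simps)
    moreover have "\<bar>(a * S) * (a\<^sup>2 * y)\<bar> \<le> \<bar>a\<bar> * a\<^sup>2"
      unfolding abs_mult using aS a2y by (intro mult_mono) (auto simp: abs_mult)
    moreover have "(a\<^sup>2 * y) * (a\<^sup>2 * y) \<le> (\<bar>a\<bar> / 100) * a\<^sup>2"
      using a2y a2 by (intro mult_mono) auto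
    moreover have "\<bar>a\<bar> * a\<^sup>2 = \<bar>a\<bar> ^ 3" by (simp add: power3_eq_cube power2_eq_square)
    ultimately show ?thesis by simp
  qed
  have ss: "s * (s + 1) / 2 \<le> 1" "0 \<le> s * (s + 1) / 2"
    using s mult_mono[of s 1 "s + 1" 2] by auto
  have "s * (s + 1) / 2 * x\<^sup>2 \<le> s * (s + 1) / 2 * (a\<^sup>2 * S\<^sup>2 + 201 / 100 * \<bar>a\<bar> ^ 3)"
    using ss x2 by (intro mult_left_mono) auto
  also have "\<dots> \<le> s * (s + 1) / 2 * (a\<^sup>2 * S\<^sup>2) + 201 / 100 * \<bar>a\<bar> ^ 3"
    using mult_right_mono[OF ss(1), of "201 / 100 * \<bar>a\<bar> ^ 3"] unfolding distrib_left by simp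
  finally have "(1 + x) powr (- s) \<le> 1 - s * x + (s * (s + 1) / 2 * (a\<^sup>2 * S\<^sup>2) + 201 / 100 * \<bar>a\<bar> ^ 3) + 2 * (104 / 100 * \<bar>a\<bar> ^ 3)"
    using T(1) x3 by linarith
  moreover have "- (s * x) = a * (s * S) - a\<^sup>2 * (s * y)"
    by (simp add: x_def algebra_simps)
  moreover have "a\<^sup>2 * (s * (s + 1) / 2 * S\<^sup>2 - s * y) = s * (s + 1) / 2 * (a\<^sup>2 * S\<^sup>2) - a\<^sup>2 * (s * y)"
    by (simp add: algebra_simps)
  moreover have "0 \<le> \<bar>a\<bar> ^ 3" by simp
  ultimately show "cmod (kick a z) powr (- 2 * s) \<le>
      1 + a * (s * S) + a\<^sup>2 * (s * (s + 1) / 2 * S\<^sup>2 - s * (Im z)\<^sup>2) + 5 * \<bar>a\<bar> ^ 3"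
    unfolding pow y_def[symmetric] by linarith
qed

text \<open>\<open>z / cnj z\<close> is the phase of twice the angle, hence blind to the sign of the
  solution, and \<open>L\<close> is its derivative in \<open>a\<close> at 0. A quadratic remainder
  is good enough because the phase gets multiplied by the small coefficients \<open>c1\<close> and
  \<open>c2\<close>.\<close>

lemma kick_phase_expansion:
  fixes z :: complex and a :: real
  defines "w \<equiv> z / cnj z" and "w1 \<equiv> kick a z / cnj (kick a z)"
  assumes z: "cmod z = 1" and a: "\<bar>a\<bar> \<le> 1 / 100"
  defines "L \<equiv> 2 * \<i> * of_real ((Im z)\<^sup>2) / (cnj z)\<^sup>2"
  shows "cmod L \<le> 2" "cmod (w1 - w) \<le> 3 * \<bar>a\<bar>" "cmod (w1 - w - of_real a * L) \<le> 3 * a\<^sup>2"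
proof -
  define y where "y = Im z"
  define D where "D = cnj z - of_real (a * y)"
  have y: "\<bar>y\<bar> \<le> 1" using z abs_Im_le_cmod[of z] by (simp add: y_def)
  then have y2: "y\<^sup>2 \<le> 1" by (simp add: abs_square_le_1)
  have "\<bar>a * y\<bar> \<le> 1 / 100 * 1" unfolding abs_mult using a y by (intro mult_mono) auto
  moreover have "cmod (cnj z) - cmod (of_real (a * y) :: complex) \<le> cmod D"
    unfolding D_def by (rule norm_triangle_ineq2)
  ultimately have D: "99 / 100 \<le> cmod D" using z by (simp del: of_real_mult)
  then have D0: "D \<noteq> 0" by auto
  have z0: "cnj z \<noteq> 0" using z by auto
  have cD: "cnj (kick a z) = D" by (simp add: D_def y_def kick_def)
  have kz: "kick a z = z - of_real (a * y)" by (simp add: kick_def y_def)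
  have zc: "z - cnj z = 2 * \<i> * of_real y" by (simp add: y_def complex_eq_iff)
  have "w1 - w = (kick a z * cnj z - z * D) / (cnj z * D)"
    unfolding w1_def w_def cD using z0 D0 by (simp add: field_simps)
  also have "kick a z * cnj z - z * D = of_real (a * y) * (z - cnj z)"
    by (simp add: kz D_def algebra_simps)
  also have "\<dots> = of_real a * (2 * \<i> * of_real (y\<^sup>2))"
    unfolding zc by (simp add: power2_eq_square)
  finally have diff: "w1 - w = of_real a * (2 * \<i> * of_real (y\<^sup>2)) / (cnj z * D)" .
  have "cmod (w1 - w) = \<bar>a\<bar> * (2 * y\<^sup>2) / cmod D"
    unfolding diff using z by (simp add: norm_mult norm_divide norm_power)
  also have "\<dots> \<le> \<bar>a\<bar> * (2 * 1) / (99 / 100)"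
    using D y2 by (intro frac_le mult_left_mono) auto
  also have "\<dots> \<le> 3 * \<bar>a\<bar>" by simp
  finally show "cmod (w1 - w) \<le> 3 * \<bar>a\<bar>" .
  have "cmod L = 2 * y\<^sup>2"
    unfolding L_def y_def[symmetric] using z by (simp add: norm_mult norm_divide norm_power)
  then show "cmod L \<le> 2" using y2 by simp
  have "w1 - w - of_real a * L = of_real a * (2 * \<i> * of_real (y\<^sup>2)) * (cnj z - D) / ((cnj z)\<^sup>2 * D)"
    unfolding diff L_def y_def[symmetric] using z0 D0 by (simp add: field_simps power2_eq_square)
  also have "cnj z - D = of_real (a * y)" by (simp add: D_def)
  finally have "cmod (w1 - w - of_real a * L) = \<bar>a\<bar> * (2 * y\<^sup>2) * \<bar>a * y\<bar> / cmod D"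
    using z by (simp add: norm_mult norm_divide norm_power abs_mult)
  also have "\<dots> \<le> \<bar>a\<bar> * (2 * 1) * (\<bar>a\<bar> * 1) / (99 / 100)"
    unfolding abs_mult using D y2 y by (intro frac_le mult_mono) auto
  also have "\<dots> \<le> 3 * a\<^sup>2" by (simp add: power2_eq_square)
  finally show "cmod (w1 - w - of_real a * L) \<le> 3 * a\<^sup>2" .
qed

text \<open>Twice and four times the angle are the frequencies in the second-order term of the norm
  expansion.\<close>

definition corr :: "complex \<Rightarrow> complex \<Rightarrow> complex \<Rightarrow> real" where
  "corr c1 c2 w = Re (c1 * w + c2 * w\<^sup>2)"

lemma abs_corr_le: "cmod w = 1 \<Longrightarrow> \<bar>corr c1 c2 w\<bar> \<le> cmod c1 + cmod c2"
proof -
  assume w: "cmod w = 1"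
  have "\<bar>corr c1 c2 w\<bar> \<le> cmod (c1 * w + c2 * w\<^sup>2)"
    unfolding corr_def by (rule abs_Re_le_cmod)
  also have "\<dots> \<le> cmod (c1 * w) + cmod (c2 * w\<^sup>2)" by (rule norm_triangle_ineq)
  finally show ?thesis using w by (simp add: norm_mult norm_power)
qed

definition weight :: "real \<Rightarrow> complex \<Rightarrow> complex \<Rightarrow> complex \<Rightarrow> real" where
  "weight s c1 c2 z = cmod z powr (- 2 * s) * (1 + corr c1 c2 (z / cnj z))"

lemma norm_phase: "z \<noteq> 0 \<Longrightarrow> cmod (z / cnj z) = 1"
  by (simp add: norm_divide)

text \<open>\<open>N\<close> is chosen before \<open>a\<close>, so that the linear term can average
  out. The second-order coefficient is the one of \<open>kick_norm_powr\<close>, split into its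
  angular mean \<open>- s * (1 - s) / 4\<close> and its oscillating part.\<close>

lemma weight_kick_unit:
  fixes z c1 c2 :: complex and s :: real
  defines "w \<equiv> z / cnj z" and "K \<equiv> cmod c1 + cmod c2"
  assumes z: "cmod z = 1" and s: "0 < s" "s \<le> 1" and K: "K \<le> 1 / 100"
  shows "\<exists>N. \<bar>N\<bar> \<le> 2 \<and> (\<forall>a. \<bar>a\<bar> \<le> 1 / 100 \<longrightarrow> weight s c1 c2 (kick a z) \<le> 1 + corr c1 c2 w + a * N
      + a\<^sup>2 * (- s * (1 - s) / 4 + s / 2 * Re w - s * (s + 1) / 4 * Re (w\<^sup>2)) + 35 * K * a\<^sup>2 + 6 * \<bar>a\<bar> ^ 3)"
proof -
  define S where "S = 2 * Re z * Im z"
  define Br where "Br = s * (s + 1) / 2 * S\<^sup>2 - s * (Im z)\<^sup>2"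
  define L where "L = 2 * \<i> * of_real ((Im z)\<^sup>2) / (cnj z)\<^sup>2"
  define M where "M = Re (c1 * L + c2 * (2 * w * L))"
  define g where "g = corr c1 c2 w"
  define N where "N = s * S * (1 + g) + M"
  have z0: "z \<noteq> 0" using z by auto
  have K0: "0 \<le> K" by (simp add: K_def)
  have w: "cmod w = 1" using norm_phase[OF z0] by (simp add: w_def)
  have g: "\<bar>g\<bar> \<le> K" using abs_corr_le[OF w] by (simp add: g_def K_def)
  have zz: "z * cnj z = 1" using z by (simp add: complex_norm_square[symmetric])
  have wz: "w = z\<^sup>2"
    using zz z0 unfolding w_def by (simp add: field_simps power2_eq_square)
  have xy: "(Re z)\<^sup>2 + (Im z)\<^sup>2 = 1" using z by (metis cmod_power2 one_power2)
  have Rew: "Re w = 1 - 2 * (Im z)\<^sup>2" and Imw: "Im w = S"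
    using xy by (simp_all add: wz S_def power2_eq_square)
  have "(Re w)\<^sup>2 + (Im w)\<^sup>2 = 1" using w by (metis cmod_power2 one_power2)
  then have Rew2: "Re (w\<^sup>2) = 1 - 2 * S\<^sup>2" by (simp add: Imw power2_eq_square)
  have Br_eq: "- s * (1 - s) / 4 + s / 2 * Re w - s * (s + 1) / 4 * Re (w\<^sup>2) = Br"
    unfolding Rew Rew2 Br_def by (simp add: field_simps)
  have S1: "\<bar>S\<bar> \<le> 1" using abs_Im_le_cmod[of w] w Imw by simp
  have y1: "(Im z)\<^sup>2 \<le> 1" "0 \<le> (Im z)\<^sup>2" using xy by (smt (verit) zero_le_power2)+
  have "S\<^sup>2 \<le> 1" using S1 by (simp add: abs_square_le_1)
  moreover have "s * (s + 1) / 2 \<le> 1" using s mult_mono[of s 1 "s + 1" 2] by auto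
  ultimately have "0 \<le> s * (s + 1) / 2 * S\<^sup>2" "s * (s + 1) / 2 * S\<^sup>2 \<le> 1 * 1"
    using s by (simp, intro mult_mono) auto
  moreover have "0 \<le> s * (Im z)\<^sup>2" "s * (Im z)\<^sup>2 \<le> 1 * 1"
    using s y1 mult_mono[of s 1 "(Im z)\<^sup>2" 1] by auto
  ultimately have Br1: "\<bar>Br\<bar> \<le> 1" unfolding Br_def by linarith
  have sS: "\<bar>s * S\<bar> \<le> 1" unfolding abs_mult using s S1 mult_mono[of s 1 "\<bar>S\<bar>" 1] by auto
  have L2: "cmod L \<le> 2" unfolding L_def by (rule kick_phase_expansion(1)[OF z, of 0]) simp
  have "\<bar>M\<bar> \<le> cmod (c1 * L + c2 * (2 * w * L))" unfolding M_def by (rule abs_Re_le_cmod)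
  also have "\<dots> \<le> cmod (c1 * L) + cmod (c2 * (2 * w * L))" by (rule norm_triangle_ineq)
  also have "\<dots> = cmod c1 * cmod L + cmod c2 * (2 * cmod L)" using w by (simp add: norm_mult)
  also have "\<dots> \<le> cmod c1 * 4 + cmod c2 * 4"
    using L2 by (intro add_mono mult_left_mono) auto
  finally have M4: "\<bar>M\<bar> \<le> 4 * K" by (simp add: K_def)
  have "\<bar>s * S * (1 + g)\<bar> \<le> 1 * (101 / 100)"
    unfolding abs_mult[of "s * S"] using sS g K by (intro mult_mono) auto
  then have N: "\<bar>N\<bar> \<le> 2" unfolding N_def using M4 K by linarith
  moreover have "weight s c1 c2 (kick a z) \<le> 1 + g + a * N + a\<^sup>2 * Br + 35 * K * a\<^sup>2 + 6 * \<bar>a\<bar> ^ 3"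
    if a: "\<bar>a\<bar> \<le> 1 / 100" for a
  proof -
    define w1 where "w1 = kick a z / cnj (kick a z)"
    define R where "R = cmod (kick a z) powr (- 2 * s)"
    have w1: "cmod w1 = 1" unfolding w1_def by (rule norm_phase[OF kick_nonzero[OF z0]])
    note ph = kick_phase_expansion[OF z a, folded w_def w1_def L_def]
    have R: "R \<le> 1 + a * (s * S) + a\<^sup>2 * Br + 5 * \<bar>a\<bar> ^ 3" "\<bar>R - 1\<bar> \<le> 3 * \<bar>a\<bar>"
      using kick_norm_powr[OF z a s] by (auto simp: R_def Br_def S_def)
    have a2: "\<bar>a\<bar> * \<bar>a\<bar> = a\<^sup>2" by (simp add: power2_eq_square)
    define \<Delta> where "\<Delta> = corr c1 c2 w1 - g"
    have "\<Delta> - a * M = Re (c1 * (w1 - w - of_real a * L) + c2 * ((w1 - w)\<^sup>2 + 2 * w * (w1 - w - of_real a * L)))"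
      by (simp add: \<Delta>_def g_def corr_def M_def algebra_simps power2_eq_square)
    also have "\<bar>\<dots>\<bar> \<le> cmod c1 * cmod (w1 - w - of_real a * L) + cmod c2 * cmod ((w1 - w)\<^sup>2 + 2 * w * (w1 - w - of_real a * L))"
      by (rule order_trans[OF abs_Re_le_cmod]) (simp only: norm_triangle_ineq flip: norm_mult)
    also have "\<dots> \<le> cmod c1 * (15 * a\<^sup>2) + cmod c2 * (15 * a\<^sup>2)"
    proof (intro add_mono mult_left_mono)
      show "cmod (w1 - w - of_real a * L) \<le> 15 * a\<^sup>2" using ph(3) by (smt (verit) zero_le_power2)
      have "cmod ((w1 - w)\<^sup>2 + 2 * w * (w1 - w - of_real a * L)) \<le> (cmod (w1 - w))\<^sup>2 + 2 * cmod (w1 - w - of_real a * L)"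
        using w by (intro order_trans[OF norm_triangle_ineq]) (simp add: norm_mult norm_power)
      also have "(cmod (w1 - w))\<^sup>2 \<le> (3 * \<bar>a\<bar>)\<^sup>2" using ph(2) by (intro power_mono) auto
      finally show "cmod ((w1 - w)\<^sup>2 + 2 * w * (w1 - w - of_real a * L)) \<le> 15 * a\<^sup>2"
        using ph(3) by (simp add: power_mult_distrib)
    qed auto
    finally have D1: "\<bar>\<Delta> - a * M\<bar> \<le> 15 * K * a\<^sup>2" by (simp add: K_def algebra_simps)
    have "\<Delta> = Re (c1 * (w1 - w) + c2 * ((w1 - w) * (w1 + w)))"
      by (simp add: \<Delta>_def g_def corr_def algebra_simps power2_eq_square)
    also have "\<bar>\<dots>\<bar> \<le> cmod c1 * cmod (w1 - w) + cmod c2 * (cmod (w1 - w) * cmod (w1 + w))"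
      by (rule order_trans[OF abs_Re_le_cmod]) (simp only: norm_triangle_ineq flip: norm_mult)
    also have "\<dots> \<le> cmod c1 * (6 * \<bar>a\<bar>) + cmod c2 * (3 * \<bar>a\<bar> * 2)"
      using ph(2) norm_triangle_ineq[of w1 w] w w1 by (intro add_mono mult_left_mono mult_mono) auto
    finally have D2: "\<bar>\<Delta>\<bar> \<le> 6 * K * \<bar>a\<bar>" by (simp add: K_def algebra_simps)
    have "(R - 1) * \<Delta> \<le> \<bar>R - 1\<bar> * \<bar>\<Delta>\<bar>" by (metis abs_ge_self abs_mult)
    also have "\<dots> \<le> (3 * \<bar>a\<bar>) * (6 * K * \<bar>a\<bar>)" using R(2) D2 by (intro mult_mono) auto
    also have "\<dots> = 18 * K * a\<^sup>2" using a2 by (simp add: algebra_simps)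
    finally have E2: "(R - 1) * \<Delta> \<le> 18 * K * a\<^sup>2" .
    have "0 \<le> 1 + g" using g K by linarith
    then have "R * (1 + g) \<le> (1 + a * (s * S) + a\<^sup>2 * Br + 5 * \<bar>a\<bar> ^ 3) * (1 + g)"
      using R(1) by (rule mult_right_mono[rotated])
    also have "\<dots> = 1 + g + a * (s * S * (1 + g)) + a\<^sup>2 * Br + a\<^sup>2 * (Br * g) + 5 * \<bar>a\<bar> ^ 3 * (1 + g)"
      by (simp add: algebra_simps)
    also have "a\<^sup>2 * (Br * g) \<le> a\<^sup>2 * K"
    proof (rule mult_left_mono)
      have "Br * g \<le> \<bar>Br\<bar> * \<bar>g\<bar>" by (metis abs_ge_self abs_mult)
      also have "\<dots> \<le> 1 * K" using Br1 g by (intro mult_mono) auto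
      finally show "Br * g \<le> K" by simp
    qed simp
    also have "5 * \<bar>a\<bar> ^ 3 * (1 + g) \<le> 5 * \<bar>a\<bar> ^ 3 * (6 / 5)"
      using g K by (intro mult_left_mono) auto
    finally have E1: "R * (1 + g) \<le> 1 + g + a * (s * S * (1 + g)) + a\<^sup>2 * Br + a\<^sup>2 * K + 6 * \<bar>a\<bar> ^ 3" by simp
    \<comment> \<open>The multiples of \<open>K * a\<^sup>2\<close> in \<open>E1\<close>,
      \<open>D1\<close> and \<open>E2\<close> are 1, 15 and 18, together below 35.\<close>
    have "weight s c1 c2 (kick a z) = R * (1 + g) + \<Delta> + (R - 1) * \<Delta>"
      by (simp add: weight_def R_def \<Delta>_def w1_def algebra_simps)
    moreover have "a * N = a * (s * S * (1 + g)) + a * M" by (simp add: N_def algebra_simps)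
    moreover have "0 \<le> K * a\<^sup>2" using K0 by simp
    ultimately show ?thesis using E1 E2 D1 by (simp add: algebra_simps abs_le_iff)
  qed
  ultimately show ?thesis
    unfolding Br_eq g_def by blast
qed

lemma weight_scale:
  assumes "0 < r"
  shows "weight s c1 c2 (of_real r * z) = r powr (- 2 * s) * weight s c1 c2 z"
  using assms by (simp add: weight_def norm_mult powr_mult)

text \<open>The coefficients \<open>c1\<close>, \<open>c2\<close> solve the cohomological equation that cancels the
  oscillating second-order terms; what remains of the second order is \<open>- s (1 - s) / 4\<close>, which
  has to absorb all terms of higher order.\<close>

lemma weight_step:
  fixes z e c1 c2 :: complex and s b \<delta> c0 :: real
  defines "K \<equiv> cmod c1 + cmod c2" and "A \<equiv> b * c0 + \<delta>"
  assumes z: "z \<noteq> 0" and e: "cmod e = 1" and s: "0 < s" "s \<le> 1" and K: "K \<le> 1 / 100"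
    and b: "0 \<le> b" "0 \<le> \<delta>" and A: "A \<le> 1 / 100"
    and c1: "c1 * ((cnj e)\<^sup>2 - 1) = of_real (b\<^sup>2 * (s / 2))"
    and c2: "c2 * ((cnj e) ^ 4 - 1) = of_real (- b\<^sup>2 * (s * (s + 1) / 4))"
    and small: "2 * \<delta> + 2 * \<delta>\<^sup>2 + (b\<^sup>2 + \<delta>\<^sup>2) * (35 * K + 6 * A) \<le> s * (1 - s) / 4 * b\<^sup>2"
  shows "\<exists>\<beta>0 \<beta>1 \<beta>2. \<beta>0 + \<beta>2 \<le> 1 \<and> (\<forall>x. \<bar>x\<bar> \<le> c0 \<longrightarrow>
      weight s c1 c2 (kick (b * x - \<delta>) (e * z)) \<le> weight s c1 c2 z * (\<beta>0 + \<beta>1 * x + \<beta>2 * x\<^sup>2))"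
proof -
  define r where "r = cmod z"
  define y where "y = e * z / of_real r"
  have r: "0 < r" using z by (simp add: r_def)
  have y: "cmod y = 1" using r e by (simp add: y_def norm_mult norm_divide r_def)
  have ez: "e * z = of_real r * y" using r by (simp add: y_def)
  define w where "w = y / cnj y"
  have y0: "y \<noteq> 0" using y by auto
  have e0: "e \<noteq> 0" using e by auto
  have w: "cmod w = 1" unfolding w_def by (rule norm_phase[OF y0])
  have ee: "e * cnj e = 1" using e by (simp add: complex_norm_square[symmetric])
  have phase: "z / cnj z = (cnj e)\<^sup>2 * w"
  proof -
    have "w = (e * z) / cnj (e * z)" unfolding w_def ez using r by simp
    also have "\<dots> = e * (e * cnj e) * z / (cnj e * cnj z)" unfolding ee by simp
    also have "\<dots> = e\<^sup>2 * (z / cnj z)" using e0 by (simp add: power2_eq_square)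
    finally have "(cnj e)\<^sup>2 * w = (e * cnj e)\<^sup>2 * (z / cnj z)" by (simp add: power_mult_distrib)
    then show ?thesis unfolding ee by simp
  qed
  define Br where "Br = - s * (1 - s) / 4 + s / 2 * Re w - s * (s + 1) / 4 * Re (w\<^sup>2)"
  define g where "g = corr c1 c2 w"
  define h where "h = corr c1 c2 (z / cnj z)"
  \<comment> \<open>\<open>h\<close> and \<open>g\<close> are the corrections before and after the
    free rotation, which multiplies the phase by \<open>e\<^sup>2\<close>. The equations for
    \<open>c1\<close> and \<open>c2\<close> make their difference cancel the oscillating
    part.\<close>
  have "h - g = Re (c1 * ((cnj e)\<^sup>2 - 1) * w + c2 * ((cnj e) ^ 4 - 1) * w\<^sup>2)"
    by (simp add: h_def g_def phase corr_def algebra_simps power_mult_distrib flip: power_mult)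
  also have "\<dots> = b\<^sup>2 * (Br + s * (1 - s) / 4)"
    unfolding c1 c2 by (simp add: Br_def field_simps)
  finally have hg: "h = g + b\<^sup>2 * Br + s * (1 - s) / 4 * b\<^sup>2" by (simp add: algebra_simps)
  have "\<bar>h\<bar> \<le> K" unfolding h_def K_def by (rule abs_corr_le[OF norm_phase[OF z]])
  then have h: "0 < 1 + h" using K by linarith
  have "Br \<le> 2"
  proof -
    have "Re w \<le> 1" "- 1 \<le> Re (w\<^sup>2)"
      using abs_Re_le_cmod[of w] abs_Re_le_cmod[of "w\<^sup>2"] w by (auto simp: norm_power)
    then have "s / 2 * Re w \<le> s / 2 * 1" "s * (s + 1) / 4 * (- 1) \<le> s * (s + 1) / 4 * Re (w\<^sup>2)"
      using s by (intro mult_left_mono; simp)+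
    moreover have "- s * (1 - s) / 4 \<le> 0" using s by simp
    moreover have "s * (s + 1) / 4 \<le> 1 * 2 / 4" using s by (intro divide_right_mono mult_mono) auto
    ultimately show ?thesis unfolding Br_def using s by linarith
  qed
  define Q where "Q = Br + 35 * K + 6 * A"
  obtain N where N: "\<bar>N\<bar> \<le> 2" and bound: "\<And>a. \<bar>a\<bar> \<le> 1 / 100 \<Longrightarrow>
      weight s c1 c2 (kick a y) \<le> 1 + g + a * N + a\<^sup>2 * Br + 35 * K * a\<^sup>2 + 6 * \<bar>a\<bar> ^ 3"
    using weight_kick_unit[OF y s K[unfolded K_def]] unfolding w_def[symmetric] g_def Br_def K_def by blast
  \<comment> \<open>These are the coefficients in \<open>x\<close> after inserting
    \<open>a = b * x - \<delta>\<close>. For mean 0 and variance 1 the expected factor is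
    \<open>\<beta>0 + \<beta>2\<close>, so the bound on this sum is the supermartingale
    property.\<close>
  define \<beta>0 \<beta>1 \<beta>2 where "\<beta>0 = (1 + g - \<delta> * N + \<delta>\<^sup>2 * Q) / (1 + h)"
    and "\<beta>1 = (b * N - 2 * b * \<delta> * Q) / (1 + h)" and "\<beta>2 = b\<^sup>2 * Q / (1 + h)"
  have "1 + g - \<delta> * N + \<delta>\<^sup>2 * Q + b\<^sup>2 * Q \<le> 1 + h"
  proof -
    have "- (\<delta> * N) \<le> \<delta> * 2" using N b mult_left_mono[of "- N" 2 \<delta>] by simp
    moreover have "\<delta>\<^sup>2 * Br \<le> \<delta>\<^sup>2 * 2" using \<open>Br \<le> 2\<close> by (intro mult_left_mono) auto
    moreover have "\<delta>\<^sup>2 * Q + b\<^sup>2 * Q = \<delta>\<^sup>2 * Br + b\<^sup>2 * Br + (b\<^sup>2 + \<delta>\<^sup>2) * (35 * K + 6 * A)"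
      by (simp add: Q_def algebra_simps)
    ultimately show ?thesis using small unfolding hg by linarith
  qed
  then have "\<beta>0 + \<beta>2 \<le> 1"
    using h by (simp add: \<beta>0_def \<beta>2_def add_divide_distrib[symmetric])
  moreover have "weight s c1 c2 (kick (b * x - \<delta>) (e * z)) \<le> weight s c1 c2 z * (\<beta>0 + \<beta>1 * x + \<beta>2 * x\<^sup>2)"
    if x: "\<bar>x\<bar> \<le> c0" for x
  proof -
    define a where "a = b * x - \<delta>"
    have "\<bar>b * x\<bar> \<le> b * c0" using b x by (simp add: abs_mult mult_left_mono)
    then have aA: "\<bar>a\<bar> \<le> A" using b unfolding a_def A_def by linarith
    \<comment> \<open>The absolute cube is no polynomial in \<open>x\<close>; the support bound
      trades one factor for \<open>A\<close> and leaves a quadratic, whose expectation is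
      known.\<close>
    have "\<bar>a\<bar> ^ 3 \<le> A * a\<^sup>2"
      using mult_right_mono[OF aA, of "a\<^sup>2"] by (simp add: power3_eq_cube power2_eq_square abs_mult_self_eq mult.assoc)
    then have "weight s c1 c2 (kick a y) \<le> 1 + g + a * N + a\<^sup>2 * Q"
      using bound[of a] aA A unfolding Q_def by (simp add: algebra_simps)
    also have "\<dots> = (1 + h) * \<beta>0 + (1 + h) * \<beta>1 * x + (1 + h) * \<beta>2 * x\<^sup>2"
    proof -
      have "(1 + h) * \<beta>0 = 1 + g - \<delta> * N + \<delta>\<^sup>2 * Q" "(1 + h) * \<beta>1 = b * N - 2 * b * \<delta> * Q" "(1 + h) * \<beta>2 = b\<^sup>2 * Q"
        using h by (simp_all add: \<beta>0_def \<beta>1_def \<beta>2_def)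
      then show ?thesis by (simp only: a_def) (simp add: algebra_simps power2_eq_square)
    qed
    also have "\<dots> = (1 + h) * (\<beta>0 + \<beta>1 * x + \<beta>2 * x\<^sup>2)" by (simp add: algebra_simps)
    finally have "r powr (- 2 * s) * weight s c1 c2 (kick a y) \<le>
        r powr (- 2 * s) * ((1 + h) * (\<beta>0 + \<beta>1 * x + \<beta>2 * x\<^sup>2))"
      by (intro mult_left_mono) auto
    moreover have "weight s c1 c2 z = r powr (- 2 * s) * (1 + h)"
      by (simp add: weight_def r_def h_def)
    ultimately show ?thesis
      unfolding a_def[symmetric] ez kick_scale weight_scale[OF r] by (simp only: mult.assoc)
  qed
  ultimately show ?thesis by blast
qed

section \<open>The relative angle of two solutions\<close>

definition wronskian :: "real \<Rightarrow> real \<Rightarrow> real \<Rightarrow> real \<Rightarrow> real" where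
  "wronskian u0 u1 v0 v1 = v1 * u0 - u1 * v0"

lemma powr_add_le:
  fixes x y s :: real
  assumes "0 \<le> x" "0 \<le> y" "0 < s" "s \<le> 1"
  shows "(x + y) powr s \<le> x powr s + y powr s"
proof (cases "x + y = 0")
  case False
  then have xy: "0 < x + y" using assms by linarith
  have le: "t \<le> t powr s" if "0 \<le> t" "t \<le> 1" for t :: real
  proof (cases "t = 0")
    case False
    then show ?thesis using powr_mono'[of s 1 t] that assms by simp
  qed simp
  have "x / (x + y) + y / (x + y) \<le> (x / (x + y)) powr s + (y / (x + y)) powr s"
    using assms xy by (intro add_mono le) auto
  moreover have "x / (x + y) + y / (x + y) = 1"
    using xy by (simp add: add_divide_distrib[symmetric])
  ultimately have "1 \<le> (x powr s + y powr s) / (x + y) powr s"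
    using assms xy by (simp add: powr_divide add_divide_distrib)
  then show ?thesis using xy by (simp add: le_divide_eq)
qed (use assms in simp)

text \<open>With \<open>E0 = 2 cos k\<close>, \<open>sqrt q\<close> is \<open>sin k\<close>, and
  \<open>\<sigma> / sqrt q\<close>, \<open>\<tau> / sqrt q\<close> are the strengths of the random
  and of the deterministic shear. \<open>small\<close> says that the negative drift absorbs the
  deterministic shear and all remainders.\<close>

locale prufer =
  fixes E0 \<tau> \<sigma> c0 s q :: real and c1 c2 :: complex
  assumes q: "q = 1 - E0\<^sup>2 / 4" "0 < q"
    and pos: "0 < \<sigma>" "0 < \<tau>" "0 \<le> c0"
    and s: "0 < s" "s \<le> 1"
    and K: "cmod c1 + cmod c2 \<le> 1 / 100"
    and A: "\<sigma> / sqrt q * c0 + \<tau> / sqrt q \<le> 1 / 100"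
    and c1: "c1 * ((cnj (Complex (E0 / 2) (sqrt q)))\<^sup>2 - 1) = of_real ((\<sigma> / sqrt q)\<^sup>2 * (s / 2))"
    and c2: "c2 * ((cnj (Complex (E0 / 2) (sqrt q))) ^ 4 - 1) = of_real (- (\<sigma> / sqrt q)\<^sup>2 * (s * (s + 1) / 4))"
    and small: "2 * (\<tau> / sqrt q) + 2 * (\<tau> / sqrt q)\<^sup>2 + ((\<sigma> / sqrt q)\<^sup>2 + (\<tau> / sqrt q)\<^sup>2) *
        (35 * (cmod c1 + cmod c2) + 6 * (\<sigma> / sqrt q * c0 + \<tau> / sqrt q)) \<le> s * (1 - s) / 4 * (\<sigma> / sqrt q)\<^sup>2"
begin

definition rot :: complex where
  "rot = Complex (E0 / 2) (sqrt q)"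

text \<open>This is \<open>u1 - cnj rot * u0\<close>, an eigencoordinate of the free transfer
  matrix: a free step at energy \<open>E0\<close> multiplies it by \<open>rot\<close>.\<close>

definition zc :: "real \<Rightarrow> real \<Rightarrow> complex" where
  "zc u0 u1 = Complex (u1 - E0 / 2 * u0) (sqrt q * u0)"

text \<open>The real inner product of \<open>zc u0 u1\<close> and \<open>zc v0 v1\<close>, so the
  product of their norms times the cosine of the relative angle.\<close>

definition cosine :: "real \<Rightarrow> real \<Rightarrow> real \<Rightarrow> real \<Rightarrow> real" where
  "cosine u0 u1 v0 v1 = u0 * v0 + u1 * v1 - E0 / 2 * (u0 * v1 + u1 * v0)"

definition adv :: "real \<Rightarrow> real \<Rightarrow> real \<Rightarrow> real \<Rightarrow> real" where
  "adv t u0 u1 x = (E0 + t - \<sigma> * x) * u1 - u0"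

definition eta :: real where
  "eta = 2 * (\<tau> / sqrt q) powr s"

abbreviation wt :: "complex \<Rightarrow> real" where
  "wt \<equiv> weight s c1 c2"

definition fval :: "real \<Rightarrow> real \<Rightarrow> real \<Rightarrow> real \<Rightarrow> real" where
  "fval u0 u1 v0 v1 = (sqrt q * \<bar>wronskian u0 u1 v0 v1\<bar>) powr s * sqrt (wt (zc u0 u1) * wt (zc v0 v1))"

text \<open>\<open>fval\<close> is the corrected \<open>|sin \<alpha>|^s\<close>. While the relative angle is acute modulo \<open>\<pi>\<close>, the potential
  \<open>psi\<close> follows \<open>fval\<close> capped at \<open>1 / 2\<close>; on the obtuse half, where \<open>fval\<close> decreases again, it stays at the cap,
  so that each completed half turn contributes \<open>1 / 2\<close>.\<close>

definition psi :: "real \<Rightarrow> real \<Rightarrow> int \<Rightarrow> real \<Rightarrow> real \<Rightarrow> int \<Rightarrow> real" where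
  "psi u0 u1 c v0 v1 d = real_of_int (turns u0 u1 c v0 v1 d) / 2 +
     (if 0 \<le> wronskian u0 u1 v0 v1 * cosine u0 u1 v0 v1 then min (fval u0 u1 v0 v1) (1 / 2) else 1 / 2)"

lemma sqrt_q: "0 < sqrt q" "sqrt q * sqrt q = q" "(sqrt q)\<^sup>2 = q"
  using q(2) by auto

lemma norm_rot: "cmod rot = 1"
proof -
  have "(cmod rot)\<^sup>2 = (E0 / 2)\<^sup>2 + (sqrt q)\<^sup>2"
    unfolding cmod_power2 rot_def by simp
  also have "\<dots> = 1" unfolding sqrt_q unfolding q(1) by (simp add: power2_eq_square)
  finally show ?thesis by (simp add: power2_eq_1_iff) (use norm_ge_zero[of rot] in linarith)
qed

text \<open>Both solutions are viewed in the coordinates of the energy \<open>E0\<close>; the offset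
  \<open>t\<close> of the second one becomes part of the kick.\<close>

lemma zc_step:
  "zc u1 ((E0 + t - \<sigma> * x) * u1 - u0) = kick (\<sigma> / sqrt q * x - t / sqrt q) (rot * zc u0 u1)"
proof (rule complex_eqI)
  have "sqrt q * (sqrt q * u0) = u0 - E0 * (E0 * u0) / 4"
    unfolding mult.assoc[symmetric] sqrt_q(2) unfolding q(1) by (simp add: algebra_simps power2_eq_square)
  moreover have "(\<sigma> / sqrt q * x - t / sqrt q) * (sqrt q * u1) = (\<sigma> * x - t) * u1"
    using sqrt_q(1) by (simp add: field_simps)
  moreover have "Im (rot * zc u0 u1) = sqrt q * u1"
    by (simp add: zc_def rot_def algebra_simps)
  ultimately show "Re (zc u1 ((E0 + t - \<sigma> * x) * u1 - u0)) = Re (kick (\<sigma> / sqrt q * x - t / sqrt q) (rot * zc u0 u1))"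
    by (simp add: zc_def rot_def algebra_simps)
qed (simp add: zc_def rot_def algebra_simps)

lemma zc_nonzero: "u0 \<noteq> 0 \<or> u1 \<noteq> 0 \<Longrightarrow> zc u0 u1 \<noteq> 0"
  using sqrt_q(1) by (auto simp: zc_def complex_eq_iff)

lemma cnj_zc_mult: "cnj (zc u0 u1) * zc v0 v1 = Complex (cosine u0 u1 v0 v1) (- sqrt q * wronskian u0 u1 v0 v1)"
proof (rule complex_eqI)
  have "sqrt q * (sqrt q * (u0 * v0)) = u0 * v0 - E0 * (E0 * (u0 * v0)) / 4"
    unfolding mult.assoc[symmetric] sqrt_q(2) unfolding q(1) by (simp add: algebra_simps power2_eq_square)
  then show "Re (cnj (zc u0 u1) * zc v0 v1) = Re (Complex (cosine u0 u1 v0 v1) (- sqrt q * wronskian u0 u1 v0 v1))"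
    by (simp add: zc_def cosine_def algebra_simps)
qed (simp add: zc_def wronskian_def algebra_simps)

lemma sine_cosine: "q * (wronskian u0 u1 v0 v1)\<^sup>2 + (cosine u0 u1 v0 v1)\<^sup>2 = (cmod (zc u0 u1) * cmod (zc v0 v1))\<^sup>2"
proof -
  have "(cmod (zc u0 u1) * cmod (zc v0 v1))\<^sup>2 = (cmod (cnj (zc u0 u1) * zc v0 v1))\<^sup>2"
    by (simp add: norm_mult)
  also have "\<dots> = q * (wronskian u0 u1 v0 v1)\<^sup>2 + (cosine u0 u1 v0 v1)\<^sup>2"
    unfolding cnj_zc_mult cmod_power2 using q(2) by (simp add: power_mult_distrib)
  finally show ?thesis ..
qed

lemma tau_le: "\<tau> / sqrt q \<le> 1 / 100" "\<tau>\<^sup>2 < 4 * q"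
proof -
  have "0 \<le> \<sigma> / sqrt q * c0" using pos sqrt_q(1) by simp
  then show t: "\<tau> / sqrt q \<le> 1 / 100" using A by linarith
  then have "\<tau> \<le> sqrt q / 100" using sqrt_q(1) by (simp add: field_simps)
  then have "\<tau>\<^sup>2 \<le> (sqrt q / 100)\<^sup>2" using pos by (intro power_mono) auto
  also have "\<dots> < 4 * q" using q(2) by (simp add: power_divide)
  finally show "\<tau>\<^sup>2 < 4 * q" .
qed

text \<open>If the slopes of two solutions differ by at most \<open>\<tau>\<close>, their angle is acute.\<close>

lemma cosine_pos:
  assumes "\<bar>wronskian u0 u1 v0 v1\<bar> \<le> \<tau> * \<bar>u0 * v0\<bar>" "u0 * v0 \<noteq> 0"
  shows "0 < cosine u0 u1 v0 v1 * (u0 * v0)"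
proof -
  define p where "p = u0 * v0"
  \<comment> \<open>Divided by \<open>p\<close>, \<open>a\<close> and \<open>b\<close> are the
    slopes recentred by \<open>E0 / 2\<close>. Their product is negative at most to the order of
    their squared distance, which \<open>q\<close> outweighs.\<close>
  define a where "a = (u1 - E0 / 2 * u0) * v0"
  define b where "b = (v1 - E0 / 2 * v0) * u0"
  have ba: "b - a = wronskian u0 u1 v0 v1" by (simp add: a_def b_def wronskian_def algebra_simps)
  have "(wronskian u0 u1 v0 v1)\<^sup>2 \<le> (\<tau> * \<bar>p\<bar>)\<^sup>2"
    using assms(1) pos unfolding p_def[symmetric] by (metis abs_le_square_iff abs_of_nonneg abs_ge_zero mult_nonneg_nonneg less_imp_le)
  then have "(b - a)\<^sup>2 \<le> \<tau>\<^sup>2 * p\<^sup>2" unfolding ba by (simp add: power_mult_distrib)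
  moreover have "4 * (a * b) = (a + b)\<^sup>2 - (b - a)\<^sup>2" by (simp add: power2_eq_square algebra_simps)
  moreover have "0 \<le> (a + b)\<^sup>2" by simp
  moreover have "0 < (4 * q - \<tau>\<^sup>2) * p\<^sup>2" using tau_le(2) assms(2) by (simp add: p_def)
  then have "\<tau>\<^sup>2 * p\<^sup>2 < 4 * (q * p\<^sup>2)" by (simp add: algebra_simps)
  moreover have "cosine u0 u1 v0 v1 * p = a * b + q * p\<^sup>2"
    unfolding q(1) by (simp add: cosine_def a_def b_def p_def field_simps power2_eq_square)
  ultimately show ?thesis unfolding p_def[symmetric] by linarith
qed

lemma cosine_swap: "cosine u1 u0 v1 v0 = cosine u0 u1 v0 v1"
  by (simp add: cosine_def algebra_simps)

lemma wronskian_swap: "wronskian u1 u0 v1 v0 = - wronskian u0 u1 v0 v1"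
  by (simp add: wronskian_def algebra_simps)

lemma wronskian_step:
  "wronskian u1 (X * u1 - u0) v1 ((X + \<tau>) * v1 - v0) = wronskian u0 u1 v0 v1 + \<tau> * (u1 * v1)"
  by (simp add: wronskian_def algebra_simps)

lemma wt_bounds:
  assumes "z \<noteq> 0"
  shows "99 / 100 * cmod z powr (- 2 * s) \<le> wt z" "wt z \<le> 2 * cmod z powr (- 2 * s)" "0 < wt z"
proof -
  have c: "\<bar>corr c1 c2 (z / cnj z)\<bar> \<le> 1 / 100"
    using abs_corr_le[OF norm_phase[OF assms]] K by (rule order_trans)
  have p: "0 < cmod z powr (- 2 * s)" using assms by simp
  have "cmod z powr (- 2 * s) * (99 / 100) \<le> wt z" "wt z \<le> cmod z powr (- 2 * s) * 2"
    unfolding weight_def using c p by (intro mult_left_mono; simp add: abs_le_iff)+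
  then show "99 / 100 * cmod z powr (- 2 * s) \<le> wt z" "wt z \<le> 2 * cmod z powr (- 2 * s)" "0 < wt z"
    using p by (simp, simp, linarith)
qed

lemma powr_square: "(r :: real) powr (- 2 * s) = (r powr (- s))\<^sup>2"
  by (simp add: power2_eq_square flip: powr_add)

lemma sqrt_wt_bounds:
  assumes "z \<noteq> 0" "z' \<noteq> 0"
  shows "99 / 100 * (cmod z * cmod z') powr (- s) \<le> sqrt (wt z * wt z')"
    "sqrt (wt z * wt z') \<le> 2 * (cmod z * cmod z') powr (- s)"
proof -
  define x y where "x = cmod z powr (- s)" and "y = cmod z' powr (- s)"
  have xy: "(cmod z * cmod z') powr (- s) = x * y" by (simp add: x_def y_def powr_mult)
  have nn: "0 \<le> x" "0 \<le> y" by (auto simp: x_def y_def)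
  note b = wt_bounds[OF assms(1), unfolded powr_square x_def[symmetric]]
    wt_bounds[OF assms(2), unfolded powr_square y_def[symmetric]]
  have "(99 / 100 * x\<^sup>2) * (99 / 100 * y\<^sup>2) \<le> wt z * wt z'" "wt z * wt z' \<le> (2 * x\<^sup>2) * (2 * y\<^sup>2)"
    using b by (intro mult_mono; simp)+
  then have "(99 / 100 * (x * y))\<^sup>2 \<le> wt z * wt z'" "wt z * wt z' \<le> (2 * (x * y))\<^sup>2"
    by (simp_all add: power2_eq_square mult_ac)
  then show "99 / 100 * (cmod z * cmod z') powr (- s) \<le> sqrt (wt z * wt z')"
    "sqrt (wt z * wt z') \<le> 2 * (cmod z * cmod z') powr (- s)"
    unfolding xy using nn by (auto simp del: times_divide_eq_left intro!: real_le_rsqrt real_le_lsqrt)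
qed

text \<open>Since \<open>sqrt q * \<bar>u\<bar> \<le> cmod (zc u u')\<close>, the scaled Wronskian
  increment is at most \<open>\<tau> / sqrt q\<close> times the product of the norms, which the
  negative powers in the weights cancel. The factor 2 in \<open>eta\<close> accounts for the
  corrections.\<close>

lemma tau_increment:
  assumes "u1 \<noteq> 0 \<or> u2 \<noteq> 0" "v1 \<noteq> 0 \<or> v2 \<noteq> 0"
  shows "(sqrt q * (\<tau> * \<bar>u1 * v1\<bar>)) powr s * sqrt (wt (zc u1 u2) * wt (zc v1 v2)) \<le> eta"
proof -
  define r where "r = cmod (zc u1 u2) * cmod (zc v1 v2)"
  have nz: "zc u1 u2 \<noteq> 0" "zc v1 v2 \<noteq> 0" using assms by (auto intro!: zc_nonzero)
  have r: "0 < r" using nz by (simp add: r_def)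
  have "sqrt q * \<bar>u\<bar> \<le> cmod (zc u u')" for u u'
    using abs_Im_le_cmod[of "zc u u'"] sqrt_q(1) by (simp add: zc_def abs_mult)
  then have "(sqrt q * \<bar>u1\<bar>) * (sqrt q * \<bar>v1\<bar>) \<le> r"
    unfolding r_def using sqrt_q(1) by (intro mult_mono) auto
  then have "\<tau> / sqrt q * ((sqrt q * \<bar>u1\<bar>) * (sqrt q * \<bar>v1\<bar>)) \<le> \<tau> / sqrt q * r"
    using pos sqrt_q(1) by (intro mult_left_mono) auto
  then have "sqrt q * (\<tau> * \<bar>u1 * v1\<bar>) \<le> \<tau> / sqrt q * r"
    using sqrt_q(1) by (simp add: abs_mult field_simps)
  then have "(sqrt q * (\<tau> * \<bar>u1 * v1\<bar>)) powr s \<le> (\<tau> / sqrt q * r) powr s"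
    using pos sqrt_q(1) s by (intro powr_mono2) auto
  then have "(sqrt q * (\<tau> * \<bar>u1 * v1\<bar>)) powr s * sqrt (wt (zc u1 u2) * wt (zc v1 v2)) \<le>
      (\<tau> / sqrt q * r) powr s * (2 * r powr (- s))"
    unfolding r_def using sqrt_wt_bounds(2)[OF nz] wt_bounds(3)[OF nz(1)] wt_bounds(3)[OF nz(2)]
    by (intro mult_mono) auto
  also have "\<dots> = eta"
    unfolding powr_mult[of "\<tau> / sqrt q" r s] using r by (simp add: eta_def powr_minus)
  finally show ?thesis .
qed

section \<open>Passages of the relative angle within one step\<close>

lemma kick_norm_ge:
  assumes "\<bar>a\<bar> \<le> 1 / 100"
  shows "99 / 100 * cmod y \<le> cmod (kick a y)"
proof -
  have "\<bar>a * Im y\<bar> \<le> 1 / 100 * cmod y"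
    unfolding abs_mult using assms abs_Im_le_cmod[of y] by (intro mult_mono) auto
  moreover have "cmod y - cmod (of_real (a * Im y) :: complex) \<le> cmod (kick a y)"
    unfolding kick_def by (rule norm_triangle_ineq2)
  ultimately show ?thesis by (simp del: of_real_mult)
qed

text \<open>Kicks of size \<open>1 / 100\<close> move the cosine only slightly, so its sign can
  change only near a right angle.\<close>

lemma kick_inner_diff:
  assumes "\<bar>a\<bar> \<le> 1 / 100" "\<bar>a'\<bar> \<le> 1 / 100"
  shows "\<bar>Re (cnj (kick a y) * kick a' y') - Re (cnj y * y')\<bar> \<le> 1 / 20 * (cmod (kick a y) * cmod (kick a' y'))"
proof -
  have bnd: "cmod (kick a y - y) \<le> 1 / 100 * cmod y" if "\<bar>a\<bar> \<le> 1 / 100" for a y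
  proof -
    have "cmod (kick a y - y) = \<bar>a\<bar> * \<bar>Im y\<bar>" by (simp add: kick_def norm_mult)
    also have "\<dots> \<le> 1 / 100 * cmod y" using that abs_Im_le_cmod[of y] by (intro mult_mono) auto
    finally show ?thesis .
  qed
  have "cnj (kick a y) * kick a' y' - cnj y * y' =
      cnj (kick a y - y) * kick a' y' + cnj y * (kick a' y' - y')" by (simp add: algebra_simps)
  then have "cmod (cnj (kick a y) * kick a' y' - cnj y * y') \<le>
      cmod (kick a y - y) * cmod (kick a' y') + cmod y * cmod (kick a' y' - y')"
    by (metis norm_triangle_ineq norm_mult complex_mod_cnj)
  also have "\<dots> \<le> (1 / 100 * cmod y) * cmod (kick a' y') + cmod y * (1 / 100 * cmod y')"
    using bnd assms by (intro add_mono mult_mono) auto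
  also have "\<dots> \<le> (1 / 100 * (100 / 99 * cmod (kick a y))) * cmod (kick a' y')
      + (100 / 99 * cmod (kick a y)) * (1 / 100 * (100 / 99 * cmod (kick a' y')))"
    using kick_norm_ge[OF assms(1), of y] kick_norm_ge[OF assms(2), of y']
    by (intro add_mono mult_mono mult_left_mono) auto
  also have "\<dots> \<le> 1 / 20 * (cmod (kick a y) * cmod (kick a' y'))"
    by (simp add: field_simps)
  finally show ?thesis
    using abs_Re_le_cmod[of "cnj (kick a y) * kick a' y' - cnj y * y'"] by simp
qed

text \<open>A cosine of at most \<open>1 / 20\<close> leaves a sine of at least
  \<open>9 / 10\<close>, and the corrections cost at most a factor \<open>99 / 100\<close>; the cap
  \<open>1 / 2\<close> lies safely below.\<close>

lemma fval_ge_half: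
  assumes "u0 \<noteq> 0 \<or> u1 \<noteq> 0" "v0 \<noteq> 0 \<or> v1 \<noteq> 0"
    and "\<bar>cosine u0 u1 v0 v1\<bar> \<le> 1 / 20 * (cmod (zc u0 u1) * cmod (zc v0 v1))"
  shows "1 / 2 \<le> fval u0 u1 v0 v1"
proof -
  define r where "r = cmod (zc u0 u1) * cmod (zc v0 v1)"
  define W where "W = \<bar>wronskian u0 u1 v0 v1\<bar>"
  have nz: "zc u0 u1 \<noteq> 0" "zc v0 v1 \<noteq> 0" using assms by (auto intro!: zc_nonzero)
  have r: "0 < r" using nz by (simp add: r_def)
  have "(cosine u0 u1 v0 v1)\<^sup>2 \<le> (1 / 20 * r)\<^sup>2"
    using assms(3) unfolding r_def[symmetric] using r by (metis abs_le_square_iff abs_of_pos zero_less_mult_iff zero_less_divide_1_iff zero_less_numeral)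
  then have "(9 / 10 * r)\<^sup>2 \<le> (sqrt q * W)\<^sup>2"
    using sine_cosine[of u0 u1 v0 v1] unfolding r_def[symmetric] W_def power_mult_distrib sqrt_q(3) power2_abs
    by (simp add: power_divide) (smt (verit) zero_le_power2)
  then have "9 / 10 * r \<le> sqrt q * W"
    by (rule power2_le_imp_le) (use sqrt_q(1) in \<open>simp add: W_def\<close>)
  then have "(9 / 10 * r) powr s \<le> (sqrt q * W) powr s"
    using r s by (intro powr_mono2) auto
  then have "(9 / 10 * r) powr s * (99 / 100 * r powr (- s)) \<le> fval u0 u1 v0 v1"
    unfolding fval_def W_def using sqrt_wt_bounds(1)[OF nz] unfolding r_def by (intro mult_mono) auto
  moreover have "(9 / 10 * r) powr s * (99 / 100 * r powr (- s)) = 99 / 100 * (9 / 10) powr s"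
    unfolding powr_mult[of "9 / 10" r s] using r by (simp add: powr_minus)
  moreover have "9 / 10 \<le> (9 / 10 :: real) powr s"
    using s powr_mono'[of s 1 "9 / 10"] by simp
  ultimately show ?thesis by linarith
qed

context
  fixes u0 u1 v0 v1 :: real
  assumes nzU: "u0 \<noteq> 0 \<or> u1 \<noteq> 0" and nzV: "v0 \<noteq> 0 \<or> v1 \<noteq> 0"
begin

private lemma next_nonzero: "u1 \<noteq> 0 \<or> adv 0 u0 u1 x \<noteq> 0" "v1 \<noteq> 0 \<or> adv \<tau> v0 v1 x \<noteq> 0"
  using nzU nzV by (auto simp: adv_def)

private lemma wronskian_next: "wronskian u1 (adv 0 u0 u1 x) v1 (adv \<tau> v0 v1 x) = wronskian u0 u1 v0 v1 + \<tau> * (u1 * v1)"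
  using wronskian_step[of u1 "E0 - \<sigma> * x" u0 v1 v0] by (simp add: adv_def algebra_simps)

private lemma next_kick:
  "zc u1 (adv 0 u0 u1 x) = kick (\<sigma> / sqrt q * x) (rot * zc u0 u1)"
  "zc v1 (adv \<tau> v0 v1 x) = kick (\<sigma> / sqrt q * x - \<tau> / sqrt q) (rot * zc v0 v1)"
  using zc_step[of u1 0 x u0] zc_step[of v1 \<tau> x v0] by (simp_all add: adv_def)

text \<open>At a crossing the Wronskian jumps across zero, so before and after it is bounded by the
  jump \<open>\<tau> * \<bar>u1 * v1\<bar>\<close>. Both times the cosine has the sign of
  \<open>u1 * v1\<close> by \<open>cosine_pos\<close>, so the angle passes from obtuse to
  acute.\<close>

lemma crossing_consequences:
  fixes x :: real
  defines "W \<equiv> wronskian u0 u1 v0 v1" and "W' \<equiv> wronskian u1 (adv 0 u0 u1 x) v1 (adv \<tau> v0 v1 x)"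
  assumes cross: "W * (u1 * v1) < 0" "0 \<le> W' * (u1 * v1)"
  shows "W * cosine u0 u1 v0 v1 < 0" "0 \<le> W' * cosine u1 (adv 0 u0 u1 x) v1 (adv \<tau> v0 v1 x)" "\<bar>W'\<bar> \<le> \<tau> * \<bar>u1 * v1\<bar>"
proof -
  define p where "p = u1 * v1"
  have p: "p \<noteq> 0" using cross(1) by (auto simp: p_def)
  have W': "W' = W + \<tau> * p" unfolding W'_def W_def p_def by (rule wronskian_next)
  have "W' * p = W * p + \<tau> * p\<^sup>2" unfolding W' by (simp add: algebra_simps power2_eq_square)
  then have le: "\<bar>W * p\<bar> \<le> \<tau> * p\<^sup>2" "\<bar>W' * p\<bar> \<le> \<tau> * p\<^sup>2"
    using cross unfolding p_def[symmetric] by linarith+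
  have cancel: "\<bar>X\<bar> \<le> \<tau> * \<bar>p\<bar>" if "\<bar>X * p\<bar> \<le> \<tau> * p\<^sup>2" for X
  proof -
    have "\<bar>X\<bar> * \<bar>p\<bar> \<le> (\<tau> * \<bar>p\<bar>) * \<bar>p\<bar>" using that by (simp add: abs_mult power2_eq_square mult.assoc)
    then show ?thesis using p by (simp add: mult_le_cancel_right)
  qed
  show W'p: "\<bar>W'\<bar> \<le> \<tau> * \<bar>u1 * v1\<bar>" using cancel[OF le(2)] by (simp add: p_def)
  have "0 < cosine u1 (adv 0 u0 u1 x) v1 (adv \<tau> v0 v1 x) * p"
    unfolding p_def using W'p p by (intro cosine_pos) (auto simp: W'_def p_def)
  then have "0 \<le> (W' * p) * (cosine u1 (adv 0 u0 u1 x) v1 (adv \<tau> v0 v1 x) * p)"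
    using cross(2) unfolding p_def[symmetric] by simp
  also have "\<dots> = (W' * cosine u1 (adv 0 u0 u1 x) v1 (adv \<tau> v0 v1 x)) * p\<^sup>2" by (simp add: power2_eq_square)
  finally show "0 \<le> W' * cosine u1 (adv 0 u0 u1 x) v1 (adv \<tau> v0 v1 x)"
    using p by (simp only: zero_le_mult_iff) (auto simp: not_le)
  \<comment> \<open>Before the step the bound involves \<open>u1 * v1\<close> instead of
    \<open>u0 * v0\<close>; exchanging the two sites makes \<open>cosine_pos\<close>
    applicable.\<close>
  have "0 < cosine u1 u0 v1 v0 * p"
    unfolding p_def using cancel[OF le(1)] p
    by (intro cosine_pos) (auto simp: wronskian_swap[of u1 u0] W_def p_def)
  moreover have "cosine u1 u0 v1 v0 = cosine u0 u1 v0 v1" by (rule cosine_swap)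
  ultimately have "(W * p) * (cosine u0 u1 v0 v1 * p) < 0"
    using mult_neg_pos[OF cross(1), of "cosine u0 u1 v0 v1 * p"] unfolding p_def by simp
  moreover have "(W * p) * (cosine u0 u1 v0 v1 * p) = (W * cosine u0 u1 v0 v1) * p\<^sup>2" by (simp add: power2_eq_square)
  ultimately show "W * cosine u0 u1 v0 v1 < 0"
    using p by (simp only: mult_less_0_iff) (auto simp: not_le)
qed

lemma kick_sizes:
  assumes "\<bar>x\<bar> \<le> c0"
  shows "\<bar>\<sigma> / sqrt q * x\<bar> \<le> 1 / 100" "\<bar>\<sigma> / sqrt q * x - \<tau> / sqrt q\<bar> \<le> 1 / 100"
proof -
  have "\<bar>\<sigma> / sqrt q * x\<bar> \<le> \<sigma> / sqrt q * c0"
    unfolding abs_mult using assms pos sqrt_q(1) by (intro mult_mono) auto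
  moreover have "0 < \<tau> / sqrt q" using pos sqrt_q(1) by simp
  ultimately show "\<bar>\<sigma> / sqrt q * x\<bar> \<le> 1 / 100" "\<bar>\<sigma> / sqrt q * x - \<tau> / sqrt q\<bar> \<le> 1 / 100"
    using A by linarith+
qed

text \<open>If the cosine kept its sign, the Wronskian would have to change sides. It can do so only
  towards the sign of \<open>u1 * v1\<close>, and \<open>cosine_pos\<close> then makes the new pair
  acute. So the cosine changes sign, and the sine is near 1.\<close>

lemma leave_acute:
  assumes x: "\<bar>x\<bar> \<le> c0"
    and acute: "0 \<le> wronskian u0 u1 v0 v1 * cosine u0 u1 v0 v1"
    and obtuse: "wronskian u1 (adv 0 u0 u1 x) v1 (adv \<tau> v0 v1 x) * cosine u1 (adv 0 u0 u1 x) v1 (adv \<tau> v0 v1 x) < 0"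
  shows "1 / 2 \<le> fval u1 (adv 0 u0 u1 x) v1 (adv \<tau> v0 v1 x)"
proof (rule fval_ge_half)
  define W B W' B' p where "W = wronskian u0 u1 v0 v1" and "B = cosine u0 u1 v0 v1"
    and "W' = wronskian u1 (adv 0 u0 u1 x) v1 (adv \<tau> v0 v1 x)" and "B' = cosine u1 (adv 0 u0 u1 x) v1 (adv \<tau> v0 v1 x)" and "p = u1 * v1"
  have B: "B = Re (cnj (rot * zc u0 u1) * (rot * zc v0 v1))"
  proof -
    have "cnj (rot * zc u0 u1) * (rot * zc v0 v1) = (rot * cnj rot) * (cnj (zc u0 u1) * zc v0 v1)"
      by (simp add: mult_ac)
    also have "rot * cnj rot = 1" using norm_rot by (simp add: complex_norm_square[symmetric])
    finally show ?thesis by (simp add: cnj_zc_mult B_def)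
  qed
  have B': "B' = Re (cnj (zc u1 (adv 0 u0 u1 x)) * zc v1 (adv \<tau> v0 v1 x))" by (simp add: cnj_zc_mult B'_def)
  have diff: "\<bar>B' - B\<bar> \<le> 1 / 20 * (cmod (zc u1 (adv 0 u0 u1 x)) * cmod (zc v1 (adv \<tau> v0 v1 x)))"
    unfolding B B' next_kick by (intro kick_inner_diff kick_sizes x)
  have "B * B' \<le> 0"
  proof (rule ccontr)
    assume "\<not> B * B' \<le> 0"
    then have BB: "0 < B * B'" by simp
    have "(W * B) * (W' * B') \<le> 0"
      unfolding W_def B_def W'_def B'_def using acute less_imp_le[OF obtuse] by (rule mult_nonneg_nonpos)
    then have "(W * W') * (B * B') \<le> 0" by (simp add: mult_ac)
    then have WW: "W * W' \<le> 0" using BB by (metis mult_pos_pos not_le)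
    have W': "W' = W + \<tau> * p" unfolding W'_def W_def p_def by (rule wronskian_next)
    have "W' \<noteq> 0" using obtuse by (auto simp: W'_def)
    then have "0 < W'\<^sup>2" by simp
    also have sq: "W'\<^sup>2 \<le> \<tau> * (W' * p)"
      using WW unfolding power2_eq_square by (subst (2) W') (simp add: algebra_simps)
    finally have pos_p: "0 < W' * p" using pos(2) by (simp add: zero_less_mult_iff)
    have "\<bar>W'\<bar> * \<bar>W'\<bar> \<le> (\<tau> * \<bar>p\<bar>) * \<bar>W'\<bar>"
      using sq pos_p by (simp add: power2_eq_square abs_mult[symmetric] mult_ac)
    then have "\<bar>W'\<bar> \<le> \<tau> * \<bar>p\<bar>" by (rule mult_right_le_imp_le) (use \<open>W' \<noteq> 0\<close> in simp)
    then have "0 < B' * p"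
      unfolding B'_def p_def using pos_p by (intro cosine_pos) (auto simp: W'_def p_def)
    then have "0 < (W' * p) * (B' * p)" using pos_p by simp
    also have "\<dots> = (W' * B') * p\<^sup>2" by (simp add: power2_eq_square)
    finally have "0 < W' * B'" using zero_le_power2[of p] by (simp only: zero_less_mult_iff) linarith
    then show False using obtuse by (simp add: W'_def B'_def)
  qed
  then have "\<bar>B'\<bar> \<le> \<bar>B' - B\<bar>" by (simp only: mult_le_0_iff) linarith
  with diff show "\<bar>cosine u1 (adv 0 u0 u1 x) v1 (adv \<tau> v0 v1 x)\<bar> \<le> 1 / 20 * (cmod (zc u1 (adv 0 u0 u1 x)) * cmod (zc v1 (adv \<tau> v0 v1 x)))"
    unfolding B'_def by linarith
qed (rule next_nonzero)+

lemma fval_crossing_le: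
  assumes "\<bar>wronskian u1 (adv 0 u0 u1 x) v1 (adv \<tau> v0 v1 x)\<bar> \<le> \<tau> * \<bar>u1 * v1\<bar>"
  shows "fval u1 (adv 0 u0 u1 x) v1 (adv \<tau> v0 v1 x) \<le> eta"
proof -
  have "(sqrt q * \<bar>wronskian u1 (adv 0 u0 u1 x) v1 (adv \<tau> v0 v1 x)\<bar>) powr s \<le> (sqrt q * (\<tau> * \<bar>u1 * v1\<bar>)) powr s"
    using assms sqrt_q(1) s by (intro powr_mono2 mult_left_mono) auto
  then have "fval u1 (adv 0 u0 u1 x) v1 (adv \<tau> v0 v1 x) \<le> (sqrt q * (\<tau> * \<bar>u1 * v1\<bar>)) powr s * sqrt (wt (zc u1 (adv 0 u0 u1 x)) * wt (zc v1 (adv \<tau> v0 v1 x)))"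
    unfolding fval_def
    using wt_bounds(3)[OF zc_nonzero[OF next_nonzero(1)]] wt_bounds(3)[OF zc_nonzero[OF next_nonzero(2)]]
    by (intro mult_right_mono real_sqrt_ge_zero mult_nonneg_nonneg) (auto intro: less_imp_le)
  also have "\<dots> \<le> eta" by (rule tau_increment[OF next_nonzero])
  finally show ?thesis .
qed

lemma wt_step:
  assumes "z \<noteq> 0" "0 \<le> t" "t \<le> \<tau>"
  shows "\<exists>\<beta>0 \<beta>1 \<beta>2. \<beta>0 + \<beta>2 \<le> 1 \<and> (\<forall>x. \<bar>x\<bar> \<le> c0 \<longrightarrow>
      wt (kick (\<sigma> / sqrt q * x - t / sqrt q) (rot * z)) \<le> wt z * (\<beta>0 + \<beta>1 * x + \<beta>2 * x\<^sup>2))"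
proof (rule weight_step)
  have t: "0 \<le> t / sqrt q" "t / sqrt q \<le> \<tau> / sqrt q" "0 \<le> \<sigma> / sqrt q * c0"
    using assms pos sqrt_q(1) by (auto simp: divide_right_mono)
  then have t2: "(t / sqrt q)\<^sup>2 \<le> (\<tau> / sqrt q)\<^sup>2" by (intro power_mono)
  show "\<sigma> / sqrt q * c0 + t / sqrt q \<le> 1 / 100" using t A by linarith
  have "((\<sigma> / sqrt q)\<^sup>2 + (t / sqrt q)\<^sup>2) * (35 * (cmod c1 + cmod c2) + 6 * (\<sigma> / sqrt q * c0 + t / sqrt q))
      \<le> ((\<sigma> / sqrt q)\<^sup>2 + (\<tau> / sqrt q)\<^sup>2) * (35 * (cmod c1 + cmod c2) + 6 * (\<sigma> / sqrt q * c0 + \<tau> / sqrt q))"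
    using t t2 by (intro mult_mono add_mono mult_left_mono order_refl) auto
  then show "2 * (t / sqrt q) + 2 * (t / sqrt q)\<^sup>2 + ((\<sigma> / sqrt q)\<^sup>2 + (t / sqrt q)\<^sup>2) *
      (35 * (cmod c1 + cmod c2) + 6 * (\<sigma> / sqrt q * c0 + t / sqrt q)) \<le> s * (1 - s) / 4 * (\<sigma> / sqrt q)\<^sup>2"
    using small t t2 by linarith
  show "0 \<le> \<sigma> / sqrt q" using pos sqrt_q(1) by simp
  show "c1 * ((cnj rot)\<^sup>2 - 1) = of_real ((\<sigma> / sqrt q)\<^sup>2 * (s / 2))"
    "c2 * ((cnj rot) ^ 4 - 1) = of_real (- (\<sigma> / sqrt q)\<^sup>2 * (s * (s + 1) / 4))"
    unfolding rot_def by (rule c1, rule c2)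
  show "0 \<le> t / sqrt q" by (rule t)
qed (use assms norm_rot s K in auto)

lemma fval_step:
  "\<exists>\<beta>0 \<beta>1 \<beta>2. \<beta>0 + \<beta>2 \<le> 1 \<and> (\<forall>x. \<bar>x\<bar> \<le> c0 \<longrightarrow>
      fval u1 (adv 0 u0 u1 x) v1 (adv \<tau> v0 v1 x) \<le> fval u0 u1 v0 v1 * (\<beta>0 + \<beta>1 * x + \<beta>2 * x\<^sup>2) + eta)"
proof -
  have nz: "zc u0 u1 \<noteq> 0" "zc v0 v1 \<noteq> 0" using nzU nzV by (auto intro!: zc_nonzero)
  obtain a0 a1 a2 where a: "a0 + a2 \<le> 1" "\<And>x. \<bar>x\<bar> \<le> c0 \<Longrightarrow> wt (zc u1 (adv 0 u0 u1 x)) \<le> wt (zc u0 u1) * (a0 + a1 * x + a2 * x\<^sup>2)"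
    using wt_step[OF nz(1), of 0] pos unfolding next_kick by auto
  obtain b0 b1 b2 where b: "b0 + b2 \<le> 1" "\<And>x. \<bar>x\<bar> \<le> c0 \<Longrightarrow> wt (zc v1 (adv \<tau> v0 v1 x)) \<le> wt (zc v0 v1) * (b0 + b1 * x + b2 * x\<^sup>2)"
    using wt_step[OF nz(2), of \<tau>] pos unfolding next_kick by auto
  define W where "W = (sqrt q * \<bar>wronskian u0 u1 v0 v1\<bar>) powr s"
  have "fval u1 (adv 0 u0 u1 x) v1 (adv \<tau> v0 v1 x) \<le> fval u0 u1 v0 v1 * ((a0 + b0) / 2 + (a1 + b1) / 2 * x + (a2 + b2) / 2 * x\<^sup>2) + eta"
    if x: "\<bar>x\<bar> \<le> c0" for x
  proof -
    define X Y where "X = wt (zc u1 (adv 0 u0 u1 x))" and "Y = wt (zc v1 (adv \<tau> v0 v1 x))"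
    define P Q where "P = a0 + a1 * x + a2 * x\<^sup>2" and "Q = b0 + b1 * x + b2 * x\<^sup>2"
    have XY: "0 < X" "0 < Y" "X \<le> wt (zc u0 u1) * P" "Y \<le> wt (zc v0 v1) * Q"
      using wt_bounds(3)[OF zc_nonzero[OF next_nonzero(1)]] wt_bounds(3)[OF zc_nonzero[OF next_nonzero(2)]]
        a(2)[OF x] b(2)[OF x] by (auto simp: X_def Y_def P_def Q_def)
    have PQ: "0 < P" "0 < Q"
      using XY wt_bounds(3)[OF nz(1)] wt_bounds(3)[OF nz(2)]
      by (metis less_le_trans zero_less_mult_pos)+
    have "X * Y \<le> (wt (zc u0 u1) * P) * (wt (zc v0 v1) * Q)" using XY by (intro mult_mono) auto
    also have "\<dots> = (wt (zc u0 u1) * wt (zc v0 v1)) * (P * Q)" by (simp add: mult_ac)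
    finally have "sqrt (X * Y) \<le> sqrt (wt (zc u0 u1) * wt (zc v0 v1)) * sqrt (P * Q)"
      unfolding real_sqrt_mult[symmetric] by (rule real_sqrt_le_mono)
    \<comment> \<open>Unlike the geometric mean of \<open>P\<close> and \<open>Q\<close>, their
      arithmetic mean is again quadratic in \<open>x\<close>, so two moments remain enough.\<close>
    also have "\<dots> \<le> sqrt (wt (zc u0 u1) * wt (zc v0 v1)) * ((P + Q) / 2)"
      using PQ wt_bounds(3)[OF nz(1)] wt_bounds(3)[OF nz(2)]
      by (intro mult_left_mono arith_geo_mean_sqrt) auto
    finally have sq: "sqrt (X * Y) \<le> sqrt (wt (zc u0 u1) * wt (zc v0 v1)) * ((P + Q) / 2)" .
    have "(sqrt q * \<bar>wronskian u1 (adv 0 u0 u1 x) v1 (adv \<tau> v0 v1 x)\<bar>) powr s \<le> W + (sqrt q * (\<tau> * \<bar>u1 * v1\<bar>)) powr s"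
    proof -
      have "sqrt q * \<bar>wronskian u1 (adv 0 u0 u1 x) v1 (adv \<tau> v0 v1 x)\<bar> \<le> sqrt q * \<bar>wronskian u0 u1 v0 v1\<bar> + sqrt q * (\<tau> * \<bar>u1 * v1\<bar>)"
        unfolding wronskian_next distrib_left[symmetric] using pos sqrt_q(1)
        by (intro mult_left_mono) (auto simp: abs_mult intro!: order_trans[OF abs_triangle_ineq])
      then have "(sqrt q * \<bar>wronskian u1 (adv 0 u0 u1 x) v1 (adv \<tau> v0 v1 x)\<bar>) powr s \<le>
          (sqrt q * \<bar>wronskian u0 u1 v0 v1\<bar> + sqrt q * (\<tau> * \<bar>u1 * v1\<bar>)) powr s"
        using s sqrt_q(1) by (intro powr_mono2) auto
      also have "\<dots> \<le> W + (sqrt q * (\<tau> * \<bar>u1 * v1\<bar>)) powr s"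
        unfolding W_def using s sqrt_q(1) pos by (intro powr_add_le) auto
      finally show ?thesis .
    qed
    then have "fval u1 (adv 0 u0 u1 x) v1 (adv \<tau> v0 v1 x) \<le> (W + (sqrt q * (\<tau> * \<bar>u1 * v1\<bar>)) powr s) * sqrt (X * Y)"
      unfolding fval_def X_def[symmetric] Y_def[symmetric] using XY by (intro mult_right_mono) auto
    also have "\<dots> \<le> W * (sqrt (wt (zc u0 u1) * wt (zc v0 v1)) * ((P + Q) / 2)) + eta"
      unfolding distrib_right
    proof (rule add_mono)
      show "W * sqrt (X * Y) \<le> W * (sqrt (wt (zc u0 u1) * wt (zc v0 v1)) * ((P + Q) / 2))"
        using sq by (rule mult_left_mono) (simp add: W_def)
      show "(sqrt q * (\<tau> * \<bar>u1 * v1\<bar>)) powr s * sqrt (X * Y) \<le> eta"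
        unfolding X_def Y_def by (rule tau_increment[OF next_nonzero])
    qed
    also have "\<dots> = fval u0 u1 v0 v1 * ((P + Q) / 2) + eta"
      by (simp add: fval_def W_def)
    also have "(P + Q) / 2 = (a0 + b0) / 2 + (a1 + b1) / 2 * x + (a2 + b2) / 2 * x\<^sup>2"
      by (simp add: P_def Q_def field_simps)
    finally show ?thesis .
  qed
  moreover have "(a0 + b0) / 2 + (a2 + b2) / 2 \<le> 1" using a(1) b(1) by (simp add: field_simps)
  ultimately show ?thesis by blast
qed

end

end

section \<open>Expected number of half turns\<close>

context prufer
begin

lemma sturm_valid_nonzero: "sturm_valid u0 u1 c \<Longrightarrow> u0 \<noteq> 0 \<or> u1 \<noteq> 0"
  by (auto simp: sturm_valid_def)

lemma fval_nonneg: "0 \<le> fval u0 u1 v0 v1"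
proof -
  have "0 \<le> wt z" for z
  proof (cases "z = 0")
    case False
    then show ?thesis using wt_bounds(3) by (simp add: less_imp_le)
  qed (simp add: weight_def)
  then show ?thesis by (simp add: fval_def)
qed

lemma psi_le: "psi u0 u1 c v0 v1 d \<le> real_of_int (turns u0 u1 c v0 v1 d) / 2 + 1 / 2"
  unfolding psi_def by (auto simp: min_def)

lemma psi_ge: "real_of_int (turns u0 u1 c v0 v1 d) / 2 \<le> psi u0 u1 c v0 v1 d"
  using fval_nonneg by (simp add: psi_def)

lemma turns_adv:
  assumes "sturm_valid u0 u1 c" "sturm_valid v0 v1 d"
  shows "turns u1 (adv 0 u0 u1 x) (osc_step u1 c) v1 (adv \<tau> v0 v1 x) (osc_step v1 d) = turns u0 u1 c v0 v1 d +
     (if wronskian u0 u1 v0 v1 * (u1 * v1) < 0 \<and>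
         0 \<le> wronskian u1 (adv 0 u0 u1 x) v1 (adv \<tau> v0 v1 x) * (u1 * v1) then 1 else 0)"
  using turns_step[OF assms, of \<tau> "E0 - \<sigma> * x"] pos(2)
  by (simp add: adv_def wronskian_def diff_add_eq)

context
  fixes u0 u1 v0 v1 :: real and c d :: int
  assumes U: "sturm_valid u0 u1 c" and V: "sturm_valid v0 v1 d"
begin

private abbreviation "psi' x \<equiv> psi u1 (adv 0 u0 u1 x) (osc_step u1 c) v1 (adv \<tau> v0 v1 x) (osc_step v1 d)"

private lemmas nz = sturm_valid_nonzero[OF U] sturm_valid_nonzero[OF V]

text \<open>Here \<open>psi\<close> sits at the cap. A crossing adds \<open>1 / 2\<close> through
  the turn count but resets the capped term from \<open>1 / 2\<close> to at most
  \<open>eta\<close>.\<close>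

private lemma psi_step_obtuse:
  assumes "\<not> 0 \<le> wronskian u0 u1 v0 v1 * cosine u0 u1 v0 v1"
  shows "psi' x \<le> psi u0 u1 c v0 v1 d + eta"
proof -
  have eta: "0 \<le> eta" by (simp add: eta_def)
  have eq: "psi u0 u1 c v0 v1 d = real_of_int (turns u0 u1 c v0 v1 d) / 2 + 1 / 2"
    using assms by (simp add: psi_def)
  show ?thesis
  proof (cases "wronskian u0 u1 v0 v1 * (u1 * v1) < 0 \<and> 0 \<le> wronskian u1 (adv 0 u0 u1 x) v1 (adv \<tau> v0 v1 x) * (u1 * v1)")
    case True
    note cc = crossing_consequences[OF nz, of x, OF True[THEN conjunct1] True[THEN conjunct2]]
    have "psi' x = real_of_int (turns u0 u1 c v0 v1 d + 1) / 2 + min (fval u1 (adv 0 u0 u1 x) v1 (adv \<tau> v0 v1 x)) (1 / 2)"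
      using True cc(2) unfolding psi_def turns_adv[OF U V] by simp
    then show ?thesis using fval_crossing_le[OF nz cc(3)] unfolding eq by (simp add: add_divide_distrib)
  next
    case False
    then have "turns u1 (adv 0 u0 u1 x) (osc_step u1 c) v1 (adv \<tau> v0 v1 x) (osc_step v1 d) = turns u0 u1 c v0 v1 d"
      unfolding turns_adv[OF U V] by simp
    then show ?thesis
      using psi_le[of u1 "adv 0 u0 u1 x" "osc_step u1 c" v1 "adv \<tau> v0 v1 x" "osc_step v1 d"] eta
      unfolding eq by linarith
  qed
qed

text \<open>No crossing starts on the acute half, and leaving it forces \<open>fval\<close> to be at
  least \<open>1 / 2\<close>; the capped value therefore covers both possible outcomes.\<close>

private lemma psi_step_acute:
  assumes acute: "0 \<le> wronskian u0 u1 v0 v1 * cosine u0 u1 v0 v1" and x: "\<bar>x\<bar> \<le> c0"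
  shows "psi' x \<le> real_of_int (turns u0 u1 c v0 v1 d) / 2 + min (fval u1 (adv 0 u0 u1 x) v1 (adv \<tau> v0 v1 x)) (1 / 2)"
proof -
  have "\<not> (wronskian u0 u1 v0 v1 * (u1 * v1) < 0 \<and> 0 \<le> wronskian u1 (adv 0 u0 u1 x) v1 (adv \<tau> v0 v1 x) * (u1 * v1))"
    using crossing_consequences(1)[OF nz, of x] acute by (meson not_le)
  then have "turns u1 (adv 0 u0 u1 x) (osc_step u1 c) v1 (adv \<tau> v0 v1 x) (osc_step v1 d) = turns u0 u1 c v0 v1 d"
    unfolding turns_adv[OF U V] by simp
  then show ?thesis
    unfolding psi_def using leave_acute[OF nz x acute] by (auto simp: not_le)
qed

lemma expected_psi_step:
  fixes P :: "real measure"
  assumes P: "prob_space P" "sets P = sets borel" "AE x in P. \<bar>x\<bar> \<le> c0" "(\<integral>x. x \<partial>P) = 0" "(\<integral>x. x\<^sup>2 \<partial>P) = 1"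
    and nonneg: "0 \<le> psi u0 u1 c v0 v1 d"
  shows "(\<integral>x. psi' x \<partial>P) \<le> psi u0 u1 c v0 v1 d + eta"
proof (cases "integrable P psi'")
  case False
  \<comment> \<open>A non-integrable function has Bochner integral 0, so nonnegativity of the old
    value settles this case without any measurability of \<open>psi'\<close> in
    \<open>x\<close>.\<close>
  then show ?thesis using nonneg by (simp add: not_integrable_integral_eq eta_def)
next
  case True
  interpret P: prob_space P by fact
  have const: "(\<integral>x. r \<partial>P) = (r :: real)" for r by (simp add: P.prob_space)
  show ?thesis
  proof (cases "0 \<le> wronskian u0 u1 v0 v1 * cosine u0 u1 v0 v1")
    case False
    have "(\<integral>x. psi' x \<partial>P) \<le> (\<integral>x. psi u0 u1 c v0 v1 d + eta \<partial>P)"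
      using True psi_step_obtuse[OF False] by (intro integral_mono) auto
    then show ?thesis unfolding const .
  next
    case acute: True
    obtain \<beta>0 \<beta>1 \<beta>2 where b: "\<beta>0 + \<beta>2 \<le> 1" "\<And>x. \<bar>x\<bar> \<le> c0 \<Longrightarrow>
        fval u1 (adv 0 u0 u1 x) v1 (adv \<tau> v0 v1 x) \<le> fval u0 u1 v0 v1 * (\<beta>0 + \<beta>1 * x + \<beta>2 * x\<^sup>2) + eta"
      using fval_step[OF nz] by blast
    define m f where "m = real_of_int (turns u0 u1 c v0 v1 d) / 2" and "f = fval u0 u1 v0 v1"
    have meas: "(\<lambda>x. x) \<in> borel_measurable P" "(\<lambda>x. x\<^sup>2) \<in> borel_measurable P"
      unfolding measurable_cong_sets[OF P(2) refl] by auto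
    have i1: "integrable P (\<lambda>x. x)"
      using meas(1) P(3) by (intro P.integrable_const_bound[of _ c0]) auto
    have i2: "integrable P (\<lambda>x. x\<^sup>2)"
    proof (rule P.integrable_const_bound[of _ "c0\<^sup>2"])
      show "AE x in P. norm (x\<^sup>2) \<le> c0\<^sup>2"
        using P(3)
      proof (rule AE_mp, intro AE_I2 impI)
        fix x :: real assume "\<bar>x\<bar> \<le> c0"
        then have "\<bar>x\<bar>\<^sup>2 \<le> c0\<^sup>2" by (intro power_mono) auto
        then show "norm (x\<^sup>2) \<le> c0\<^sup>2" by simp
      qed
    qed (rule meas)
    \<comment> \<open>Two bounds, one by the cap and one by the uncapped value, together give
      Jensen's inequality for \<open>min\<close>.\<close>
    have le: "(\<integral>x. psi' x \<partial>P) \<le> (\<integral>x. m + 1 / 2 \<partial>P)"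
    proof (rule integral_mono_AE[OF True])
      show "AE x in P. psi' x \<le> m + 1 / 2"
        using P(3)
      proof (rule AE_mp, intro AE_I2 impI)
        fix x assume "\<bar>x\<bar> \<le> c0"
        then show "psi' x \<le> m + 1 / 2" using psi_step_acute[OF acute, of x] unfolding m_def by linarith
      qed
    qed simp
    have "(\<integral>x. psi' x \<partial>P) \<le> (\<integral>x. (m + eta + f * \<beta>0) + (f * \<beta>1) * x + (f * \<beta>2) * x\<^sup>2 \<partial>P)"
    proof (rule integral_mono_AE[OF True])
      show "integrable P (\<lambda>x. (m + eta + f * \<beta>0) + (f * \<beta>1) * x + (f * \<beta>2) * x\<^sup>2)"
        using i1 i2 by auto
      show "AE x in P. psi' x \<le> (m + eta + f * \<beta>0) + (f * \<beta>1) * x + (f * \<beta>2) * x\<^sup>2"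
        using P(3)
      proof (rule AE_mp, intro AE_I2 impI)
        fix x assume x: "\<bar>x\<bar> \<le> c0"
        have "psi' x \<le> m + (f * (\<beta>0 + \<beta>1 * x + \<beta>2 * x\<^sup>2) + eta)"
          using psi_step_acute[OF acute x] b(2)[OF x] unfolding m_def f_def by linarith
        then show "psi' x \<le> (m + eta + f * \<beta>0) + (f * \<beta>1) * x + (f * \<beta>2) * x\<^sup>2"
          by (simp add: algebra_simps)
      qed
    qed
    also have "\<dots> = m + eta + f * (\<beta>0 + \<beta>2)"
      using i1 i2 P(4,5) by (simp add: P.prob_space algebra_simps)
    also have "\<dots> \<le> m + eta + f * 1"
      using b(1) fval_nonneg unfolding f_def by (intro add_left_mono mult_left_mono) auto
    finally have "(\<integral>x. psi' x \<partial>P) \<le> m + eta + f" by simp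
    moreover have "0 \<le> eta" by (simp add: eta_def)
    moreover have "psi u0 u1 c v0 v1 d = m + min f (1 / 2)" using acute by (simp add: psi_def m_def f_def)
    ultimately show ?thesis using le unfolding const by linarith
  qed
qed

end

end

section \<open>Summation along the random potential\<close>

locale anderson_prufer = prufer E0 \<tau> \<sigma> c0 s q c1 c2 + random_potential P
  for E0 \<tau> \<sigma> c0 s q c1 c2 P +
  assumes bounded: "AE x in P. \<bar>x\<bar> \<le> c0" and mean: "(\<integral>x. x \<partial>P) = 0" and var: "(\<integral>x. x\<^sup>2 \<partial>P) = 1"
begin

abbreviation U :: "(nat \<Rightarrow> real) \<Rightarrow> nat \<Rightarrow> real" where "U \<omega> \<equiv> sol (\<lambda>i. \<sigma> * \<omega> i) E0"
abbreviation V :: "(nat \<Rightarrow> real) \<Rightarrow> nat \<Rightarrow> real" where "V \<omega> \<equiv> sol (\<lambda>i. \<sigma> * \<omega> i) (E0 + \<tau>)"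
abbreviation cU :: "(nat \<Rightarrow> real) \<Rightarrow> nat \<Rightarrow> int" where "cU \<omega> \<equiv> osc (\<lambda>i. \<sigma> * \<omega> i) E0"
abbreviation cV :: "(nat \<Rightarrow> real) \<Rightarrow> nat \<Rightarrow> int" where "cV \<omega> \<equiv> osc (\<lambda>i. \<sigma> * \<omega> i) (E0 + \<tau>)"

definition rel_turns :: "nat \<Rightarrow> (nat \<Rightarrow> real) \<Rightarrow> int" where
  "rel_turns n \<omega> = turns (U \<omega> n) (U \<omega> (Suc n)) (cU \<omega> n) (V \<omega> n) (V \<omega> (Suc n)) (cV \<omega> n)"

definition Psi :: "nat \<Rightarrow> (nat \<Rightarrow> real) \<Rightarrow> real" where
  "Psi n \<omega> = psi (U \<omega> n) (U \<omega> (Suc n)) (cU \<omega> n) (V \<omega> n) (V \<omega> (Suc n)) (cV \<omega> n)"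

lemma sol_adv:
  "U \<omega> (Suc (Suc n)) = adv 0 (U \<omega> n) (U \<omega> (Suc n)) (\<omega> (Suc n))"
  "V \<omega> (Suc (Suc n)) = adv \<tau> (V \<omega> n) (V \<omega> (Suc n)) (\<omega> (Suc n))"
  by (simp_all add: adv_def)

lemma rel_turns_bounds: "0 \<le> rel_turns n \<omega> \<and> rel_turns n \<omega> \<le> int n"
proof (induction n)
  case 0
  show ?case by (simp add: rel_turns_def turns_def)
next
  case (Suc n)
  have "rel_turns (Suc n) \<omega> = rel_turns n \<omega> \<or> rel_turns (Suc n) \<omega> = rel_turns n \<omega> + 1"
    unfolding rel_turns_def sol_adv osc.simps turns_adv[OF sturm_valid_sol sturm_valid_sol] by simp
  then show ?case using Suc by auto
qed

lemma Psi_bounds: "real_of_int (rel_turns n \<omega>) / 2 \<le> Psi n \<omega>" "0 \<le> Psi n \<omega>" "Psi n \<omega> \<le> real n / 2 + 1 / 2"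
proof -
  have *: "real_of_int (rel_turns n \<omega>) / 2 \<le> Psi n \<omega>" "Psi n \<omega> \<le> real_of_int (rel_turns n \<omega>) / 2 + 1 / 2"
    unfolding Psi_def rel_turns_def by (rule psi_ge, rule psi_le)
  have "0 \<le> real_of_int (rel_turns n \<omega>)" "real_of_int (rel_turns n \<omega>) \<le> real n"
    using rel_turns_bounds[of n \<omega>] by linarith+
  with * show "real_of_int (rel_turns n \<omega>) / 2 \<le> Psi n \<omega>" "0 \<le> Psi n \<omega>" "Psi n \<omega> \<le> real n / 2 + 1 / 2"
    by linarith+
qed

lemma measurable_Psi: "Psi n \<in> borel_measurable (Pn n)"
proof -
  have [measurable]: "(\<lambda>\<omega>. sol (\<lambda>i. \<sigma> * \<omega> i) E n) \<in> borel_measurable (Pn n)"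
    "(\<lambda>\<omega>. sol (\<lambda>i. \<sigma> * \<omega> i) E (Suc n)) \<in> borel_measurable (Pn n)"
    "(\<lambda>\<omega>. osc (\<lambda>i. \<sigma> * \<omega> i) E n) \<in> measurable (Pn n) (count_space UNIV)" for E
    by (intro measurable_sol measurable_osc; simp)+
  have [measurable]: "sg \<in> borel_measurable (count_space UNIV)" by simp
  have [measurable]: "cnj \<in> borel_measurable borel"
    by (intro borel_measurable_continuous_onI continuous_intros)
  show ?thesis
    unfolding Psi_def psi_def turns_def wronskian_def cosine_def fval_def weight_def corr_def zc_def Complex_eq
    by measurable
qed

text \<open>Solutions up to site \<open>n + 1\<close> and counters up to \<open>n\<close> see only
  the first \<open>n\<close> coordinates; with these fixed, the next step depends on
  \<open>x\<close> alone.\<close>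

lemma Psi_update:
  "Psi (Suc n) (fun_upd \<omega> (Suc n) x) = psi (U \<omega> (Suc n)) (adv 0 (U \<omega> n) (U \<omega> (Suc n)) x) (osc_step (U \<omega> (Suc n)) (cU \<omega> n))
     (V \<omega> (Suc n)) (adv \<tau> (V \<omega> n) (V \<omega> (Suc n)) x) (osc_step (V \<omega> (Suc n)) (cV \<omega> n))"
proof -
  have sol: "sol (\<lambda>i. \<sigma> * (fun_upd \<omega> (Suc n) x) i) E k = sol (\<lambda>i. \<sigma> * \<omega> i) E k" if "k \<le> Suc n" for E k
    using that by (intro sol_cong) auto
  have osc: "osc (\<lambda>i. \<sigma> * (fun_upd \<omega> (Suc n) x) i) E n = osc (\<lambda>i. \<sigma> * \<omega> i) E n" for E
    by (intro osc_cong) auto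
  show ?thesis
    unfolding Psi_def sol_adv osc.simps using sol osc by simp
qed

lemma expected_Psi: "(\<integral>\<omega>. Psi n \<omega> \<partial>Pn n) \<le> real n * eta"
proof (induction n)
  case 0
  have "Psi 0 \<omega> = 0" for \<omega>
    by (simp add: Psi_def psi_def turns_def wronskian_def fval_def)
  then show ?case by simp
next
  case (Suc n)
  interpret prod: product_sigma_finite "\<lambda>_ :: nat. P"
    by unfold_locales
  have ins: "{1..Suc n} = insert (Suc n) {1..n}" by auto
  have int: "integrable (Pn n) (Psi n)" for n
  proof -
    interpret Q: prob_space "Pn n" by (rule prob_space_Pn)
    show ?thesis
      using Psi_bounds[of n] by (intro Q.integrable_const_bound[of _ "real n / 2 + 1 / 2"] measurable_Psi) auto
  qed
  have "(\<integral>\<omega>. Psi (Suc n) \<omega> \<partial>Pn (Suc n)) = (\<integral>\<omega>. (\<integral>x. Psi (Suc n) (fun_upd \<omega> (Suc n) x) \<partial>P) \<partial>Pn n)"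
    using int[of "Suc n"] unfolding ins by (intro prod.product_integral_insert) auto
  also have "\<dots> \<le> (\<integral>\<omega>. Psi n \<omega> + eta \<partial>Pn n)"
  \<comment> \<open>This rule asks for integrability of the upper bound only, which spares the inner
    integral.\<close>
  proof (rule integral_mono')
    show "integrable (Pn n) (\<lambda>\<omega>. Psi n \<omega> + eta)"
      by (intro Bochner_Integration.integrable_add int integrable_const_Pn)
    show "(\<integral>x. Psi (Suc n) (fun_upd \<omega> (Suc n) x) \<partial>P) \<le> Psi n \<omega> + eta" for \<omega>
      unfolding Psi_update unfolding Psi_def
      by (rule expected_psi_step[OF sturm_valid_sol sturm_valid_sol prob_space_axioms sets_P bounded mean var
            Psi_bounds(2)[of n \<omega>, unfolded Psi_def]])
    show "0 \<le> Psi n \<omega> + eta" for \<omega> using Psi_bounds(2)[of n \<omega>] by (simp add: eta_def)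
  qed
  also have "\<dots> = (\<integral>\<omega>. Psi n \<omega> \<partial>Pn n) + eta"
    by (subst Bochner_Integration.integral_add[OF int integrable_const_Pn]) (simp only: integral_const_Pn)
  finally show ?case using Suc by (simp add: algebra_simps)
qed

lemma ids_le_eta:
  assumes "E0 < a" "a \<le> E0 + \<tau>"
  shows "ids P \<sigma> {a..E0 + \<tau>} \<le> 2 * eta"
proof (rule LIMSEQ_le[OF ids_LIMSEQ[OF assms(2)]])
  show "(\<lambda>n. 2 * eta + 2 * (1 / real n)) \<longlonglongrightarrow> 2 * eta"
    using tendsto_add[OF tendsto_const tendsto_mult[OF tendsto_const lim_1_over_n], of "2 * eta" 2] by simp
  show "\<exists>N. \<forall>n\<ge>N. 1 / real n * (\<integral>\<omega>. real (eig_count (anderson_matrix \<omega> \<sigma> n) {a..E0 + \<tau>}) \<partial>Pn n) \<le> 2 * eta + 2 * (1 / real n)"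
  proof (intro exI allI impI)
    fix n :: nat assume n: "1 \<le> n"
    interpret Q: prob_space "Pn n" by (rule prob_space_Pn)
    have int: "integrable (Pn n) (Psi n)"
      using Psi_bounds[of n] by (intro Q.integrable_const_bound[of _ "real n / 2 + 1 / 2"] measurable_Psi) auto
    have "(\<integral>\<omega>. real (eig_count (anderson_matrix \<omega> \<sigma> n) {a..E0 + \<tau>}) \<partial>Pn n) \<le> (\<integral>\<omega>. 2 * Psi n \<omega> + 2 \<partial>Pn n)"
    proof (rule integral_mono)
      show "integrable (Pn n) (\<lambda>\<omega>. 2 * Psi n \<omega> + 2)"
        by (intro Bochner_Integration.integrable_add integrable_mult_right int integrable_const_Pn)
      show "real (eig_count (anderson_matrix \<omega> \<sigma> n) {a..E0 + \<tau>}) \<le> 2 * Psi n \<omega> + 2" for \<omega>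
      proof -
        \<comment> \<open>Going from the counters at \<open>n + 1\<close> to those at
          \<open>n\<close> costs one, the sign term in \<open>turns\<close> another. The factor 2 of
          \<open>Psi\<close> appears because each half turn weighs \<open>1 / 2\<close>.\<close>
        have "int (eig_count (anderson_matrix \<omega> \<sigma> n) {a..E0 + \<tau>}) \<le> cU \<omega> (Suc n) - cV \<omega> (Suc n)"
          using assms by (rule eig_count_le_osc_diff)
        also have "\<dots> \<le> cU \<omega> n - cV \<omega> n + 1"
          using osc_mono(2)[of "\<lambda>i. \<sigma> * \<omega> i" E0 n] osc_mono(1)[of "\<lambda>i. \<sigma> * \<omega> i" "E0 + \<tau>" n] by linarith
        also have "\<dots> \<le> rel_turns n \<omega> + 2" by (simp add: rel_turns_def turns_def)
        finally show ?thesis using Psi_bounds(1)[of n \<omega>] by linarith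
      qed
    qed (rule integrable_eig_count[OF assms(2)])
    also have "\<dots> = 2 * (\<integral>\<omega>. Psi n \<omega> \<partial>Pn n) + 2"
      by (subst Bochner_Integration.integral_add[OF integrable_mult_right[OF int] integrable_const_Pn])
        (simp only: integral_const_Pn integral_mult_right_zero)
    also have "\<dots> \<le> 2 * (real n * eta) + 2" using expected_Psi[of n] by simp
    finally show "1 / real n * (\<integral>\<omega>. real (eig_count (anderson_matrix \<omega> \<sigma> n) {a..E0 + \<tau>}) \<partial>Pn n) \<le> 2 * eta + 2 * (1 / real n)"
      using n by (simp add: field_simps)
  qed
qed

end

section \<open>Choice of the parameters\<close>

text \<open>\<open>2 * sqrt q\<close> and \<open>2 * \<bar>E0\<bar> * sqrt q\<close> are the moduli
  of the denominators of \<open>c1\<close> and \<open>c2\<close>. The case split at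
  \<open>\<bar>E0\<bar> = 1\<close> separates the resonance at 0 from those at the band
  edges.\<close>

lemma energy_bounds:
  fixes E0 \<gamma> q :: real
  assumes "0 < \<gamma>" "\<gamma> < \<bar>E0\<bar>" "\<bar>E0\<bar> < 2 - \<gamma>" and q: "q = 1 - E0\<^sup>2 / 4"
  shows "3 / 4 * \<gamma> \<le> q" "q \<le> sqrt q" "q \<le> 1" "3 / 4 * \<gamma> \<le> \<bar>E0\<bar> * sqrt q" "\<gamma> < 1"
proof -
  show \<gamma>: "\<gamma> < 1" using assms by linarith
  have "\<bar>E0\<bar>\<^sup>2 \<le> (2 - \<gamma>)\<^sup>2" using assms by (intro power_mono) auto
  moreover have "\<gamma> * \<gamma> \<le> \<gamma> * 1" using \<gamma> assms by (intro mult_left_mono) auto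
  ultimately show q1: "3 / 4 * \<gamma> \<le> q" unfolding q by (simp add: power2_eq_square algebra_simps)
  then have q0: "0 < q" using assms(1) by linarith
  show q2: "q \<le> 1" unfolding q by simp
  have le_sqrt: "t \<le> sqrt t" if "0 \<le> t" "t \<le> 1" for t :: real
    using that mult_left_mono[of t 1 t] by (intro real_le_rsqrt) (simp add: power2_eq_square)
  then show q3: "q \<le> sqrt q" using q0 q2 by simp
  show "3 / 4 * \<gamma> \<le> \<bar>E0\<bar> * sqrt q"
  proof (cases "1 \<le> \<bar>E0\<bar>")
    case True
    then have "1 * sqrt q \<le> \<bar>E0\<bar> * sqrt q" using q0 by (intro mult_right_mono) auto
    then show ?thesis using q1 q3 by linarith
  next
    case False
    then have "\<bar>E0\<bar>\<^sup>2 \<le> 1\<^sup>2" by (intro power_mono) auto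
    then have "3 / 4 \<le> sqrt q" using q3 unfolding q by simp
    then have "\<gamma> * (3 / 4) \<le> \<bar>E0\<bar> * sqrt q" using assms by (intro mult_mono) auto
    then show ?thesis by simp
  qed
qed

lemma prufer_parameters:
  fixes E0 \<tau> \<sigma> c0 \<gamma> \<kappa> :: real
  assumes \<gamma>: "0 < \<gamma>" and E0: "\<gamma> < \<bar>E0\<bar>" "\<bar>E0\<bar> < 2 - \<gamma>" and \<sigma>: "0 < \<sigma>" and c0: "1 \<le> c0"
    and \<kappa>: "\<kappa> = 460 * c0 ^ 3 * \<sigma> / \<gamma>" "\<kappa> < 1" and \<tau>: "0 < \<tau>" "\<tau> \<le> \<sigma> ^ 3"
  shows "\<exists>c1 c2. prufer E0 \<tau> \<sigma> c0 (1 - \<kappa> / 2) (1 - E0\<^sup>2 / 4) c1 c2"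
proof -
  define q where "q = 1 - E0\<^sup>2 / 4"
  define s where "s = 1 - \<kappa> / 2"
  define b where "b = \<sigma> / sqrt q"
  define \<delta> where "\<delta> = \<tau> / sqrt q"
  define e where "e = Complex (E0 / 2) (sqrt q)"
  define X where "X = c0 ^ 3 * \<sigma> / \<gamma>"
  note en = energy_bounds[OF \<gamma> E0 q_def]
  have q: "0 < q" using en(1) \<gamma> by linarith
  then have sq: "0 < sqrt q" "sqrt q * sqrt q = q" by auto
  have X: "\<kappa> = 460 * X" by (simp add: \<kappa> X_def)
  then have X1: "X < 1 / 460" using \<kappa> by simp
  have c03: "1 \<le> c0 ^ 3" using c0 by (rule one_le_power)
  have c0_le: "c0 \<le> c0 ^ 3" using power_increasing[of 1 3 c0] c0 by simp
  have \<sigma>\<gamma>: "\<sigma> / \<gamma> \<le> X" "c0 * (\<sigma> / \<gamma>) \<le> X"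
    using mult_right_mono[OF c03, of "\<sigma> / \<gamma>"] mult_right_mono[OF c0_le, of "\<sigma> / \<gamma>"] \<sigma> \<gamma>
    by (simp_all add: X_def)
  have "\<sigma> \<le> \<sigma> / \<gamma>" using \<sigma> \<gamma> en(5) mult_left_mono[of \<gamma> 1 \<sigma>] by (simp add: field_simps)
  then have \<sigma>X: "\<sigma> \<le> X" using \<sigma>\<gamma> by linarith
  have X0: "0 < X" using \<sigma>X \<sigma> by linarith
  have \<sigma>1: "\<sigma> \<le> 1" using \<sigma>X X1 by linarith
  \<comment> \<open>Halving \<open>\<kappa>\<close> keeps \<open>s\<close> above
    \<open>1 / 2\<close>, so that \<open>s * (1 - s)\<close> is comparable to
    \<open>1 - s\<close>.\<close>
  have s: "1 / 2 \<le> s" "s \<le> 1" "1 - s = 230 * X" using X X1 X0 by (simp_all add: s_def)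
  have b0: "0 < b" using \<sigma> sq by (simp add: b_def)
  have b_ge: "\<sigma> \<le> b"
    unfolding b_def using \<sigma> sq en(3) mult_left_mono[of "sqrt q" 1 \<sigma>] by (simp add: field_simps)
  have b_le: "b \<le> 4 / 3 * (\<sigma> / \<gamma>)"
  proof -
    have "b \<le> \<sigma> / (3 / 4 * \<gamma>)"
      unfolding b_def using \<sigma> \<gamma> en(1,2) by (intro divide_left_mono) auto
    then show ?thesis by simp
  qed
  have b2: "b\<^sup>2 = \<sigma>\<^sup>2 / q" using q by (simp add: b_def power_divide)
  have b2_le: "b\<^sup>2 \<le> 4 / 3 * (\<sigma>\<^sup>2 / \<gamma>)"
  proof -
    have "b\<^sup>2 \<le> \<sigma>\<^sup>2 / (3 / 4 * \<gamma>)"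
      unfolding b2 using \<gamma> en(1) q by (intro divide_left_mono) auto
    then show ?thesis by simp
  qed
  have \<delta>0: "0 < \<delta>" using \<tau> sq by (simp add: \<delta>_def)
  have \<delta>_le: "\<delta> \<le> \<sigma>\<^sup>2 * b"
  proof -
    have "\<delta> \<le> \<sigma> ^ 3 / sqrt q" unfolding \<delta>_def using \<tau> sq by (intro divide_right_mono) auto
    then show ?thesis by (simp add: b_def power3_eq_cube power2_eq_square)
  qed
  have \<sigma>2: "\<sigma>\<^sup>2 \<le> \<sigma>" "\<sigma>\<^sup>2 \<le> 1 / 100"
  proof -
    show "\<sigma>\<^sup>2 \<le> \<sigma>" using \<sigma> \<sigma>1 mult_left_mono[of \<sigma> 1 \<sigma>] by (simp add: power2_eq_square)
    then show "\<sigma>\<^sup>2 \<le> 1 / 100" using \<sigma>X X1 by linarith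
  qed
  \<comment> \<open>The offset shear does not average out, so its first-order term must be as small
    as the third-order remainders; \<open>\<tau> \<le> \<sigma> ^ 3\<close> ensures this.\<close>
  have \<delta>b2: "\<delta> \<le> \<sigma> * b\<^sup>2"
  proof -
    have "\<sigma>\<^sup>2 * b = \<sigma> * (\<sigma> * b)" by (simp add: power2_eq_square)
    also have "\<dots> \<le> \<sigma> * (b * b)" using \<sigma> b0 b_ge by (intro mult_left_mono mult_right_mono) auto
    finally show ?thesis using \<delta>_le by (simp add: power2_eq_square)
  qed
  have \<delta>sq: "\<delta>\<^sup>2 \<le> \<sigma> * b\<^sup>2"
  proof -
    have "\<delta>\<^sup>2 \<le> (\<sigma>\<^sup>2 * b)\<^sup>2" using \<delta>_le \<delta>0 by (intro power_mono) auto
    also have "\<dots> = (\<sigma>\<^sup>2 * \<sigma>\<^sup>2) * b\<^sup>2" by (simp add: power_mult_distrib power2_eq_square)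
    also have "\<dots> \<le> (1 * \<sigma>) * b\<^sup>2" using \<sigma>2 \<sigma> by (intro mult_right_mono mult_mono) auto
    finally show ?thesis by simp
  qed
  have A: "b * c0 + \<delta> \<le> 3 / 2 * X"
  proof -
    have bX: "b \<le> 4 / 3 * X" using b_le \<sigma>\<gamma> by linarith
    have "b * c0 \<le> 4 / 3 * (\<sigma> / \<gamma>) * c0" using b_le c0 by (intro mult_right_mono) auto
    moreover have "4 / 3 * (\<sigma> / \<gamma>) * c0 = 4 / 3 * (c0 * (\<sigma> / \<gamma>))" by simp
    moreover have "\<delta> \<le> 1 / 100 * b" using \<delta>_le mult_right_mono[OF \<sigma>2(2), of b] b0 by linarith
    ultimately show ?thesis using \<sigma>\<gamma>(2) bX X0 by linarith
  qed
  have e_norm: "cmod e = 1"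
  proof -
    have "(cmod e)\<^sup>2 = (E0 / 2)\<^sup>2 + (sqrt q)\<^sup>2" unfolding cmod_power2 e_def by simp
    also have "\<dots> = 1" using q by (simp add: q_def power_divide)
    finally show ?thesis using norm_ge_zero[of e] by (simp add: power2_eq_1_iff)
  qed
  have ee: "e * cnj e = 1" using e_norm by (simp add: complex_norm_square[symmetric])
  have d1: "cmod ((cnj e)\<^sup>2 - 1) = 2 * sqrt q"
  proof -
    have "(cnj e)\<^sup>2 - 1 = cnj e * (cnj e - e)" using ee by (simp add: power2_eq_square algebra_simps)
    also have "cnj e - e = - 2 * \<i> * of_real (sqrt q)" by (simp add: e_def complex_eq_iff)
    finally show ?thesis using e_norm sq by (simp add: norm_mult)
  qed
  have d2: "cmod ((cnj e) ^ 4 - 1) = 2 * (\<bar>E0\<bar> * sqrt q)"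
  proof -
    have "(cnj e) ^ 4 - 1 = (cnj e)\<^sup>2 * (cnj e - e) * (cnj e + e)"
    proof -
      have "(cnj e) ^ 4 - 1 = (cnj e)\<^sup>2 * (cnj e)\<^sup>2 - (e * cnj e)\<^sup>2"
        unfolding ee by (simp flip: power_add)
      then show ?thesis by (simp add: power2_eq_square algebra_simps)
    qed
    also have "cnj e - e = - 2 * \<i> * of_real (sqrt q)" by (simp add: e_def complex_eq_iff)
    also have "cnj e + e = of_real E0" by (simp add: e_def complex_eq_iff)
    finally show ?thesis using e_norm sq by (simp add: norm_mult norm_power)
  qed
  define c1 where "c1 = of_real (b\<^sup>2 * (s / 2)) / ((cnj e)\<^sup>2 - 1)"
  define c2 where "c2 = of_real (- b\<^sup>2 * (s * (s + 1) / 4)) / ((cnj e) ^ 4 - 1)"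
  have dpos: "0 < \<bar>E0\<bar> * sqrt q" using en(4) \<gamma> by linarith
  have K1: "cmod c1 \<le> b\<^sup>2 / (3 * \<gamma>)"
  proof -
    have "cmod c1 = b\<^sup>2 * (s / 2) / (2 * sqrt q)"
      unfolding c1_def norm_divide d1 norm_of_real using s by simp
    also have "\<dots> \<le> b\<^sup>2 * (1 / 2) / (2 * (3 / 4 * \<gamma>))"
      using s en(1,2) \<gamma> by (intro frac_le mult_left_mono) auto
    finally show ?thesis by simp
  qed
  have K2: "cmod c2 \<le> b\<^sup>2 / (3 * \<gamma>)"
  proof -
    have "cmod c2 = b\<^sup>2 * (s * (s + 1) / 4) / (2 * (\<bar>E0\<bar> * sqrt q))"
      unfolding c2_def norm_divide d2 norm_of_real using s by (simp add: abs_mult)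
    also have "\<dots> \<le> b\<^sup>2 * (1 * 2 / 4) / (2 * (3 / 4 * \<gamma>))"
    proof (rule frac_le)
      show "b\<^sup>2 * (s * (s + 1) / 4) \<le> b\<^sup>2 * (1 * 2 / 4)"
        using s by (intro mult_left_mono divide_right_mono mult_mono) auto
    qed (use en(4) \<gamma> in auto)
    finally show ?thesis by simp
  qed
  have K: "cmod c1 + cmod c2 \<le> X / 460"
  proof -
    have "b\<^sup>2 / (3 * \<gamma>) \<le> 4 / 3 * (\<sigma>\<^sup>2 / \<gamma>) / (3 * \<gamma>)"
      using b2_le \<gamma> by (intro divide_right_mono) auto
    also have "\<dots> = 4 / 9 * (\<sigma> / \<gamma>)\<^sup>2" by (simp add: power2_eq_square)
    finally have "cmod c1 + cmod c2 \<le> 8 / 9 * (\<sigma> / \<gamma>)\<^sup>2" using K1 K2 by linarith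
    moreover have "\<sigma> / \<gamma> \<le> 1 / 460" using \<sigma>\<gamma>(1) X1 by linarith
    then have "(\<sigma> / \<gamma>)\<^sup>2 \<le> X * (1 / 460)"
      unfolding power2_eq_square by (rule mult_mono[OF \<sigma>\<gamma>(1)]) (use \<sigma> \<gamma> X0 in auto)
    ultimately show ?thesis using X0 by linarith
  qed
  have small: "2 * \<delta> + 2 * \<delta>\<^sup>2 + (b\<^sup>2 + \<delta>\<^sup>2) * (35 * (cmod c1 + cmod c2) + 6 * (b * c0 + \<delta>)) \<le> s * (1 - s) / 4 * b\<^sup>2"
  proof -
    have "\<sigma> * b\<^sup>2 \<le> 1 * b\<^sup>2" using \<sigma>1 by (intro mult_right_mono) auto
    then have "b\<^sup>2 + \<delta>\<^sup>2 \<le> 2 * b\<^sup>2" using \<delta>sq by linarith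
    moreover have "35 * (cmod c1 + cmod c2) + 6 * (b * c0 + \<delta>) \<le> 10 * X" using A K X0 by argo
    ultimately have "(b\<^sup>2 + \<delta>\<^sup>2) * (35 * (cmod c1 + cmod c2) + 6 * (b * c0 + \<delta>)) \<le> (2 * b\<^sup>2) * (10 * X)"
      using b0 c0 \<delta>0 by (intro mult_mono) auto
    moreover have "\<sigma> * b\<^sup>2 \<le> X * b\<^sup>2" using \<sigma>X by (intro mult_right_mono) auto
    ultimately have "2 * \<delta> + 2 * \<delta>\<^sup>2 + (b\<^sup>2 + \<delta>\<^sup>2) * (35 * (cmod c1 + cmod c2) + 6 * (b * c0 + \<delta>)) \<le> 24 * (X * b\<^sup>2)"
      using \<delta>b2 \<delta>sq by (simp add: mult_ac)
    \<comment> \<open>Here the constant 460 is spent: the errors amount to 2 + 2 + 20 times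
      \<open>X * b\<^sup>2\<close>, and the drift offers \<open>230 / 8\<close>, which exceeds
      24.\<close>
    also have "\<dots> \<le> (1 / 2 * 230 / 4) * (X * b\<^sup>2)" using X0 by (intro mult_right_mono) auto
    also have "\<dots> = (1 / 2) * ((230 * X) / 4 * b\<^sup>2)" by simp
    also have "\<dots> \<le> s * ((230 * X) / 4 * b\<^sup>2)" using s X0 by (intro mult_right_mono) auto
    also have "\<dots> = s * (1 - s) / 4 * b\<^sup>2" unfolding s(3) by simp
    finally show ?thesis .
  qed
  have "prufer E0 \<tau> \<sigma> c0 s q c1 c2"
  proof
    show "cmod c1 + cmod c2 \<le> 1 / 100" using K X1 by linarith
    show "\<sigma> / sqrt q * c0 + \<tau> / sqrt q \<le> 1 / 100" using A X1 unfolding b_def \<delta>_def by linarith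
    have "(cnj e)\<^sup>2 - 1 \<noteq> 0" "(cnj e) ^ 4 - 1 \<noteq> 0" using d1 d2 sq dpos by (metis mult_pos_pos norm_eq_zero zero_less_numeral less_irrefl)+
    then show "c1 * ((cnj (Complex (E0 / 2) (sqrt q)))\<^sup>2 - 1) = complex_of_real ((\<sigma> / sqrt q)\<^sup>2 * (s / 2))"
      "c2 * ((cnj (Complex (E0 / 2) (sqrt q))) ^ 4 - 1) = complex_of_real (- (\<sigma> / sqrt q)\<^sup>2 * (s * (s + 1) / 4))"
      unfolding e_def[symmetric] b_def[symmetric] c1_def c2_def by (metis nonzero_eq_divide_eq, metis nonzero_eq_divide_eq)
  qed (use q q_def s \<sigma> \<tau> c0 small in \<open>simp_all add: b_def \<delta>_def\<close>)
  then show ?thesis unfolding s_def q_def by blast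
qed

theorem theorem1:
  fixes P :: "real measure" and c0 \<sigma> \<gamma> lambda0 lambda :: real
  assumes "prob_space P"
    and "sets P = sets borel"
    and "measure P {-c0..c0} = 1"
    and "(\<integral>x. x \<partial>P) = 0"
    and "(\<integral>x. x ^ 2 \<partial>P) = 1"
    and "0 < \<sigma>" and "\<sigma> \<le> 1"
    and "0 < \<gamma>"
    and "lambda0 \<in> {-2 + \<gamma> <..< -\<gamma>} \<union> {\<gamma> <..< 2 - \<gamma>}"
    and "0 < lambda" and "lambda \<le> 1"
  shows "ids P \<sigma> {lambda0..lambda0 + lambda}
           \<le> 2 / \<sigma> ^ 3 * lambda powr (1 - 460 * c0 ^ 3 * \<sigma> / \<gamma>)"
proof -
  interpret P: random_potential P
    using assms(1,2) by (simp add: random_potential_def random_potential_axioms_def)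
  define \<kappa> where "\<kappa> = 460 * c0 ^ 3 * \<sigma> / \<gamma>"
  have \<sigma>3: "0 < \<sigma> ^ 3" "\<sigma> ^ 3 \<le> 1" using assms(6,7) by (auto intro: power_le_one)
  have ids1: "ids P \<sigma> {lambda0..lambda0 + lambda} \<le> 1"
    using assms(10) by (intro P.ids_le_1) simp
  \<comment> \<open>Outside this case the claimed bound is at least 1. Inside it,
    \<open>lambda \<le> lambda powr (1 - \<kappa>)\<close> gives
    \<open>2 * lambda < \<sigma> ^ 3\<close>, the smallness that the window needs.\<close>
  show ?thesis
  proof (cases "\<kappa> < 1 \<and> 2 * lambda powr (1 - \<kappa>) < \<sigma> ^ 3")
    case False
    have "1 \<le> 2 / \<sigma> ^ 3 * lambda powr (1 - \<kappa>)"
    proof (cases "\<kappa> < 1")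
      case True
      then have "\<sigma> ^ 3 \<le> 2 * lambda powr (1 - \<kappa>)" using False by simp
      then show ?thesis using \<sigma>3 by (simp add: field_simps)
    next
      case False
      then have "lambda powr 0 \<le> lambda powr (1 - \<kappa>)" using assms(10,11) by (intro powr_mono') auto
      moreover have "1 \<le> 2 / \<sigma> ^ 3" using \<sigma>3 by (simp add: field_simps)
      ultimately have "1 * 1 \<le> 2 / \<sigma> ^ 3 * lambda powr (1 - \<kappa>)" using assms(6,10) by (intro mult_mono) auto
      then show ?thesis by simp
    qed
    then show ?thesis using ids1 unfolding \<kappa>_def by linarith
  next
    case True
    have AE: "AE x in P. \<bar>x\<bar> \<le> c0"
    proof -
      have "AE x in P. x \<in> {-c0..c0}"
        using assms(3) by (intro P.AE_prob_1)
      then show ?thesis by (rule AE_mp) (intro AE_I2 impI, auto)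
    qed
    have c0: "1 \<le> c0"
    proof -
      have nn: "0 \<le> c0"
      proof (rule ccontr)
        assume "\<not> 0 \<le> c0"
        then have "{-c0..c0} = {}" by auto
        then show False using assms(3) by simp
      qed
      have "(\<integral>x. x ^ 2 \<partial>P) \<le> (\<integral>x. c0\<^sup>2 \<partial>P)"
      proof (rule integral_mono_AE)
        \<comment> \<open>The integral 1 differs from the default value 0 of a non-integrable
          function.\<close>
        show "integrable P (\<lambda>x. x ^ 2)" using assms(5) not_integrable_integral_eq by fastforce
        show "AE x in P. x ^ 2 \<le> c0\<^sup>2"
          using AE by (rule AE_mp) (intro AE_I2 impI, metis abs_le_square_iff abs_of_nonneg nn)
      qed simp
      then have "1 \<le> c0\<^sup>2" using assms(5) by (simp add: P.prob_space)
      then show ?thesis using nn by (metis abs_of_nonneg abs_le_square_iff abs_one one_power2)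
    qed
    have \<kappa>0: "0 \<le> \<kappa>" using c0 assms(6,8) by (simp add: \<kappa>_def)
    then have lambda_le: "lambda \<le> lambda powr (1 - \<kappa>)"
      using powr_mono'[of "1 - \<kappa>" 1 lambda] assms(10,11) by simp
    \<comment> \<open>The distance from \<open>lambda0\<close> to the left end of its interval. The
      window starts slightly below \<open>lambda0\<close>, so that an eigenvalue at
      \<open>lambda0\<close> counts, but inside the same interval and with length at most
      \<open>2 * lambda\<close>.\<close>
    define room where "room = (if 0 < lambda0 then lambda0 - \<gamma> else lambda0 + 2 - \<gamma>)"
    define \<epsilon> where "\<epsilon> = min lambda (room / 2)"
    have room: "0 < room" using assms(8,9) by (auto simp: room_def)
    then have \<epsilon>: "0 < \<epsilon>" "\<epsilon> \<le> lambda" "\<epsilon> < room" using assms(10) by (auto simp: \<epsilon>_def min_def)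
    define E0 where "E0 = lambda0 - \<epsilon>"
    define \<tau> where "\<tau> = lambda + \<epsilon>"
    have E0: "\<gamma> < \<bar>E0\<bar>" "\<bar>E0\<bar> < 2 - \<gamma>"
      using assms(8,9) \<epsilon> by (auto simp: E0_def room_def split: if_splits)
    have \<tau>: "0 < \<tau>" "\<tau> \<le> 2 * lambda" "\<tau> \<le> \<sigma> ^ 3"
      using \<epsilon> assms(10) True lambda_le by (auto simp: \<tau>_def)
    define q where "q = 1 - E0\<^sup>2 / 4"
    define s where "s = 1 - \<kappa> / 2"
    obtain c1 c2 where "prufer E0 \<tau> \<sigma> c0 s q c1 c2"
      using prufer_parameters[OF assms(8) E0 assms(6) c0 \<kappa>_def _ \<tau>(1,3)] True unfolding s_def q_def by blast
    then interpret A: anderson_prufer E0 \<tau> \<sigma> c0 s q c1 c2 P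
      using P.random_potential_axioms AE assms(4,5)
      by (simp add: anderson_prufer_def anderson_prufer_axioms_def)
    have "ids P \<sigma> {lambda0..E0 + \<tau>} \<le> 2 * A.eta"
      by (rule A.ids_le_eta) (use \<epsilon> assms(10) in \<open>auto simp: E0_def \<tau>_def\<close>)
    moreover have "E0 + \<tau> = lambda0 + lambda" by (simp add: E0_def \<tau>_def)
    ultimately have "ids P \<sigma> {lambda0..lambda0 + lambda} \<le> 4 * (\<tau> / sqrt q) powr s"
      by (simp add: A.eta_def)
    also have "\<dots> \<le> 4 * (2 / sqrt q * lambda powr (1 - \<kappa>))"
    proof -
      note en = energy_bounds[OF assms(8) E0 q_def]
      have q0: "0 < q" using en(1) assms(8) by linarith
      then have sq: "0 < sqrt q" "sqrt q \<le> 1" using en(3) by auto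
      have "(\<tau> / sqrt q) powr s \<le> (2 / sqrt q * lambda) powr s"
        using \<tau> sq A.s by (intro powr_mono2) (auto simp: divide_right_mono)
      also have "\<dots> = (2 / sqrt q) powr s * lambda powr s"
        by (rule powr_mult)
      also have "\<dots> \<le> (2 / sqrt q) powr 1 * lambda powr (1 - \<kappa>)"
      proof (rule mult_mono)
        have "1 \<le> 2 / sqrt q" using sq by (subst le_divide_eq_1_pos) linarith+
        then show "(2 / sqrt q) powr s \<le> (2 / sqrt q) powr 1"
          using A.s by (intro powr_mono) auto
        show "lambda powr s \<le> lambda powr (1 - \<kappa>)"
          using assms(10,11) \<kappa>0 by (intro powr_mono') (auto simp: s_def)
      qed auto
      finally show ?thesis using sq by simp
    qed
    also have "\<dots> = 8 / sqrt q * lambda powr (1 - \<kappa>)" by simp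
    \<comment> \<open>\<open>\<kappa> < 1\<close> forces \<open>460 * \<sigma> < \<gamma>\<close>,
      so \<open>sqrt q\<close> dominates \<open>4 * \<sigma> ^ 3\<close> and the prefactor absorbs
      the constant 8.\<close>
    also have "\<dots> \<le> 2 / \<sigma> ^ 3 * lambda powr (1 - \<kappa>)"
    proof (rule mult_right_mono)
      note en = energy_bounds[OF assms(8) E0 q_def]
      have "1 * \<sigma> \<le> c0 ^ 3 * \<sigma>" using c0 assms(6) by (intro mult_right_mono) auto
      moreover have "460 * (c0 ^ 3 * \<sigma>) < \<gamma>" using True assms(8) by (simp add: \<kappa>_def field_simps)
      moreover have "\<sigma> ^ 3 \<le> \<sigma>" using power_decreasing[of 1 3 \<sigma>] assms(6,7) by simp
      ultimately have "4 * \<sigma> ^ 3 \<le> sqrt q" using en(1,2) \<sigma>3 by linarith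
      moreover have "0 < sqrt q" using A.sqrt_q(1) .
      ultimately show "8 / sqrt q \<le> 2 / \<sigma> ^ 3" using \<sigma>3 by (simp add: field_simps)
    qed simp
    finally show ?thesis unfolding \<kappa>_def .
  qed
qed

end
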